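(* Let $m \le n$ be positive integers. Then: (1) $\{\eta(S,T) : (S,T)\in\mathcal{P}_{m,n}\}$ is a basis for $\tilde H_{m-1}(M_{m,n})$; (2) $\{\gamma(S,T) : (S,T)\in\mathcal{P}_{m,n}\}$ is a basis for the free part of $\tilde H^{m-1}(M_{m,n})$. (Both families are indexed by $\mathcal{P}_{m,n}$.)
   Context: Chessboard complex: for finite sets $X,Y$ of positive integers, $M_{X,Y}$ is the abstract simplicial complex whose vertices are the edges $ij'$ ($i\in X$, $j\in Y$) of the complete bipartite graph with parts $X$ and $Y'=\{j':j\in Y\}$ and whose faces are the sets of pairwise disjoint edges (including the empty face); $M_{m,n}=M_{[m],[n]}$. Homology and cohomology are reduced, simplicial, over $\mathbb{Z}$. Chains and cochains are identified via the bilinear form on chains for which the (suitably oriented) simplices form an orthonormal basis; the coboundary map is the adjoint of the boundary map, and $\tilde H^k$ is the quotient of the cocycle group by the coboundary group $B^k$. The "free part" of $\tilde H^{m-1}$ means its quotient by its torsion subgroup (the basis consisting of the images of the elements $\gamma(S,T)$ in this quotient). Wedge product: for $X_1\cap X_2=\emptyset$ and $Y_1\cap Y_2=\emptyset$, concatenation of oriented simplices induces a homomorphism $\tilde H_{s-1}(M_{X_1,Y_1})\otimes\tilde H_{t-1}(M_{X_2,Y_2})\to\tilde H_{s+t-1}(M_{X_1\cup X_2,Y_1\cup Y_2})$, $\bar z_1\otimes\bar z_2\mapsto \bar z_1\wedge\bar z_2=\overline{z_1\wedge z_2}$; the empty simplex acts as the identity. $\mathcal{P}_{m,n}$ is the set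 of pairs $(S,T)$ of standard Young tableaux such that $S$ has $m$ cells, $T$ has $n$ cells, and the shape of $S$ is the shape of $T$ with its first row removed (so the first row of $T$ has $n-m$ cells). Given $(S,T)\in\mathcal{P}_{m,n}$, let $S^*$ be the semistandard tableau, of the same shape as $T$, obtained from $S$ by adding a cell with entry $\infty$ (regarded as larger than $m$) to the bottom of each of the first $n-m$ columns of $S$ (some of which may be empty). Apply the inverse Robinson–Schensted (row insertion) procedure to $(S^*,T)$: for $t=n,n-1,\dots,1$, cross out the entry $t$ of the right tableau $T$, remove the entry of the left tableau in the corresponding cell and reverse-bump it upward (an entry $x$ moving up into a row replaces the rightmost entry of that row that is strictly smaller than $x$), until an entry pops out of some cell of the top row of the left tableau (if the removed cell is in the top row, its entry pops from that cell); the popped entry is $\sigma(t)$. This produces a permutation $\sigma=\sigma(1)\cdots\sigma(n)$ of the multiset $\{1,\dots,m,\infty^{n-m}\}$. Cocycles: for a word $\sigma$ with letters indexed by a set of positions, in which the non-$\infty$ letters are distinct and occur in positions $i_1<\dots<i_k$, let $\tau(\sigma)$ be the oriented simplex $(\sigma(i_1)i_1',\dots,\sigma(i_k)i_k')$. $\gamma(S,T)\in\tilde H^{m-1}(M_{m,n})$ is the cohomology class (coset of $B^{m-1}(M_{m,n})$) of the top-dimensional oriented simplex $\tau(\sigma)$, where $\sigma$ is the multiset permutation produced above. Cycles: for $i=1,\dots,n-m$ let $A_i^*$ be the collection of entries popped from the $i$th cell of the top row of the left tableau during this procedure and let $B_i\subseteq[n]$ be the set of corresponding entries $t$ crossed out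 of $T$. Each $A_i^*$ is a set (no repetitions) containing $\infty$; let $A_i=A_i^*\setminus\{\infty\}$, so $|A_i|=|B_i|-1$. For finite sets $A,B$ of positive integers with $|A|=|B|-1$ let $$\rho_{A,B}=\sum_{\sigma}\operatorname{sgn}(\sigma)\,\tau(\sigma),$$ where $\sigma$ ranges over all permutations of $A\cup\{\infty\}$, written as words whose letters are placed, from left to right, in the positions given by the elements of $B$ in increasing order; this is a cycle generating the infinite cyclic group $\tilde H_{|A|-1}(M_{A,B})$ ($\rho_{\emptyset,\{b\}}$ is the empty simplex). Define $\eta(S,T)=\rho_{A_1,B_1}\wedge\cdots\wedge\rho_{A_{n-m},B_{n-m}}\in\tilde H_{m-1}(M_{m,n})$.
   Formalization: In ρ_{A,B} the simplex τ(σ) is oriented by listing its edges by increasing letter (left vertex) instead of increasing position, since with the position order the signed sum is not a cycle once |A| ≥ 2 (e.g. A={1,2}, B={1,2,3}). *)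

theory Defs
  imports
    "HOL-Algebra.Free_Abelian_Groups"
    "HOL-Combinatorics.Multiset_Permutations"
    "HOL-Library.Extended_Nat"
begin

subsection \<open>Simplicial complexes, oriented simplices and chains\<close>

text \<open>
  The pair \<open>(i, j)\<close> is the edge \<open>ij'\<close> of the complete bipartite graph. A complex is given by its
  set of faces, the empty face included.
\<close>

type_synonym vertex = "nat \<times> nat"

definition chessboard :: "nat set \<Rightarrow> nat set \<Rightarrow> vertex set set" where
  "chessboard X Y =
     {F. F \<subseteq> X \<times> Y \<and> (\<forall>e\<in>F. \<forall>f\<in>F. e \<noteq> f \<longrightarrow> fst e \<noteq> fst f \<and> snd e \<noteq> snd f)}"

text \<open>
  Chains are finitely supported integer functions on faces. The basis element \<open>frag_of F\<close> stands
  for the face \<open>F\<close> oriented by listing its vertices in increasing lexicographic order; any other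
  listing of the vertices differs from it by the sign of the sorting permutation.
\<close>

type_synonym chain = "vertex set \<Rightarrow>\<^sub>0 int"

definition vless :: "vertex \<Rightarrow> vertex \<Rightarrow> bool" where
  "vless u v \<longleftrightarrow> (u, v) \<in> less_than <*lex*> less_than"

definition inversions :: "('a \<Rightarrow> 'a \<Rightarrow> bool) \<Rightarrow> 'a list \<Rightarrow> (nat \<times> nat) set" where
  "inversions lt xs = {(i, j). i < j \<and> j < length xs \<and> lt (xs ! j) (xs ! i)}"

definition inv_sign :: "('a \<Rightarrow> 'a \<Rightarrow> bool) \<Rightarrow> 'a list \<Rightarrow> int" where
  "inv_sign lt xs = (-1) ^ card (inversions lt xs)"

definition oriented_simplex :: "vertex list \<Rightarrow> chain" where
  "oriented_simplex vs = frag_cmul (inv_sign vless vs) (frag_of (set vs))"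

text \<open>
  In the increasing listing of \<open>F\<close> the vertex \<open>v\<close> is preceded by \<open>card {u \<in> F. vless u v}\<close> vertices.
  A single vertex has the empty face as its boundary, so the homology below is reduced.
\<close>

definition boundary :: "chain \<Rightarrow> chain" where
  "boundary = frag_extend
     (\<lambda>F. \<Sum>v\<in>F. frag_cmul ((-1) ^ card {u \<in> F. vless u v}) (frag_of (F - {v})))"

definition pairing :: "chain \<Rightarrow> chain \<Rightarrow> int" where
  "pairing c d = (\<Sum>F\<in>Poly_Mapping.keys c. Poly_Mapping.lookup c F * Poly_Mapping.lookup d F)"

text \<open>For finite \<open>K\<close> this is the adjoint of \<open>boundary\<close>, see \<open>pairing_coboundary\<close> below.\<close>

definition coboundary :: "vertex set set \<Rightarrow> chain \<Rightarrow> chain" where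
  "coboundary K c = (\<Sum>F\<in>K. frag_cmul (pairing c (boundary (frag_of F))) (frag_of F))"

text \<open>
  Concatenating the increasing listings of \<open>F\<close> and \<open>G\<close> gives a listing of \<open>F \<union> G\<close> whose inversions
  are the pairs counted here (\<open>F\<close> and \<open>G\<close> are disjoint in all uses), see \<open>wedge_oriented_simplex\<close>.
\<close>

definition wedge :: "chain \<Rightarrow> chain \<Rightarrow> chain" where
  "wedge c d = frag_extend (\<lambda>F. frag_extend (\<lambda>G.
     frag_cmul ((-1) ^ card {(u, v) \<in> F \<times> G. vless v u}) (frag_of (F \<union> G))) d) c"

subsection \<open>Reduced homology and cohomology over the integers\<close>

text \<open>Dimensions are integers, so that the empty face has dimension \<open>-1\<close>.\<close>

definition chain_group :: "vertex set set \<Rightarrow> int \<Rightarrow> chain monoid" where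
  "chain_group K p = free_Abelian_group {F \<in> K. finite F \<and> int (card F) = p + 1}"

definition cycle_group :: "vertex set set \<Rightarrow> int \<Rightarrow> chain monoid" where
  "cycle_group K p =
     (chain_group K p)\<lparr>carrier := {c \<in> carrier (chain_group K p). boundary c = 0}\<rparr>"

definition boundaries :: "vertex set set \<Rightarrow> int \<Rightarrow> chain set" where
  "boundaries K p = boundary ` carrier (chain_group K (p + 1))"

definition homology_group :: "int \<Rightarrow> vertex set set \<Rightarrow> chain set monoid" where
  "homology_group p K = cycle_group K p Mod boundaries K p"

definition homology_class :: "int \<Rightarrow> vertex set set \<Rightarrow> chain \<Rightarrow> chain set" where
  "homology_class p K c = boundaries K p #>\<^bsub>cycle_group K p\<^esub> c"

definition cocycle_group :: "vertex set set \<Rightarrow> int \<Rightarrow> chain monoid" where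
  "cocycle_group K p =
     (chain_group K p)\<lparr>carrier := {c \<in> carrier (chain_group K p). coboundary K c = 0}\<rparr>"

definition coboundaries :: "vertex set set \<Rightarrow> int \<Rightarrow> chain set" where
  "coboundaries K p = coboundary K ` carrier (chain_group K (p - 1))"

definition cohomology_group :: "int \<Rightarrow> vertex set set \<Rightarrow> chain set monoid" where
  "cohomology_group p K = cocycle_group K p Mod coboundaries K p"

definition cohomology_class :: "int \<Rightarrow> vertex set set \<Rightarrow> chain \<Rightarrow> chain set" where
  "cohomology_class p K c = coboundaries K p #>\<^bsub>cocycle_group K p\<^esub> c"

subsection \<open>Bases and free parts of abelian groups\<close>

definition torsion_subgroup :: "('a, 'b) monoid_scheme \<Rightarrow> 'a set" where
  "torsion_subgroup G = {x \<in> carrier G. \<exists>k::nat. 0 < k \<and> x [^]\<^bsub>G\<^esub> k = \<one>\<^bsub>G\<^esub>}"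

definition free_part :: "('a, 'b) monoid_scheme \<Rightarrow> 'a set monoid" where
  "free_part G = G Mod torsion_subgroup G"

definition free_part_class :: "('a, 'b) monoid_scheme \<Rightarrow> 'a \<Rightarrow> 'a set" where
  "free_part_class G x = torsion_subgroup G #>\<^bsub>G\<^esub> x"

text \<open>A basis is an indexed family: the uniqueness of \<open>c\<close> forces \<open>b\<close> to be injective on \<open>I\<close>.\<close>

definition is_basis :: "('a, 'b) monoid_scheme \<Rightarrow> 'i set \<Rightarrow> ('i \<Rightarrow> 'a) \<Rightarrow> bool" where
  "is_basis G I b \<longleftrightarrow> comm_group G \<and> b \<in> I \<rightarrow> carrier G \<and>
     (\<forall>x\<in>carrier G. \<exists>!c :: 'i \<Rightarrow>\<^sub>0 int. Poly_Mapping.keys c \<subseteq> I \<and>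
        x = (\<Otimes>\<^bsub>G\<^esub>i\<in>Poly_Mapping.keys c. b i [^]\<^bsub>G\<^esub> Poly_Mapping.lookup c i))"

subsection \<open>Tableaux and the inverse Robinson--Schensted procedure\<close>

text \<open>A tableau is the list of its rows, from top to bottom.\<close>

type_synonym 'a tableau = "'a list list"

definition shape :: "'a tableau \<Rightarrow> nat list" where
  "shape T = map length T"

definition standard_tableau :: "nat \<Rightarrow> nat tableau \<Rightarrow> bool" where
  "standard_tableau k T \<longleftrightarrow>
     0 \<notin> set (shape T) \<and> sorted_wrt (\<ge>) (shape T) \<and>
     (\<forall>row\<in>set T. sorted_wrt (<) row) \<and>
     (\<forall>r c. Suc r < length T \<and> c < length (T ! Suc r) \<longrightarrow> T ! r ! c < T ! Suc r ! c) \<and>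
     distinct (concat T) \<and> set (concat T) = {1..k}"

definition tableau_pairs :: "nat \<Rightarrow> nat \<Rightarrow> (nat tableau \<times> nat tableau) set" where
  "tableau_pairs m n =
     {(S, T). standard_tableau m S \<and> standard_tableau n T \<and> T \<noteq> [] \<and> shape S = tl (shape T)}"

text \<open>
  \<open>add_infinities k S\<close> adds a cell with entry \<open>\<infinity>\<close> at the bottom of each of the first \<open>k\<close> columns
  (\<open>k\<close> is at least the length of the first row). Row by row: each row is filled up with \<open>\<infinity>\<close> to the
  length of the row above it in the original tableau, the topmost row to length \<open>k\<close>.
\<close>

fun add_infinities :: "nat \<Rightarrow> nat tableau \<Rightarrow> enat tableau" where
  "add_infinities k [] = [replicate k \<infinity>]"
| "add_infinities k (row # S) =
     (map enat row @ replicate (k - length row) \<infinity>) # add_infinities (length row) S"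

text \<open>
  In \<open>reverse_bump P r c x\<close> the entry \<open>x\<close> has just left cell \<open>(r, c)\<close> of \<open>P\<close>. Rows and columns are
  counted from 0. The result consists of the remaining tableau, the column of the top row from
  which an entry pops out, and that entry.
\<close>

fun reverse_bump :: "enat tableau \<Rightarrow> nat \<Rightarrow> nat \<Rightarrow> enat \<Rightarrow> enat tableau \<times> nat \<times> enat" where
  "reverse_bump P 0 c x = (P, c, x)"
| "reverse_bump P (Suc r) c x =
     (let row = P ! r;
          c' = last (filter (\<lambda>j. row ! j < x) [0..<length row])
      in reverse_bump (P[r := row[c' := x]]) r c' (row ! c'))"

definition row_of :: "nat tableau \<Rightarrow> nat \<Rightarrow> nat" where
  "row_of T t = length (takeWhile (\<lambda>row. t \<notin> set row) T)"

definition column_of :: "nat tableau \<Rightarrow> nat \<Rightarrow> nat" where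
  "column_of T t = length (takeWhile (\<lambda>x. x \<noteq> t) (T ! row_of T t))"

text \<open>
  When \<open>t\<close> is crossed out of \<open>T\<close>, the larger entries have already been crossed out and the left
  tableau \<open>P\<close> has the shape of the rest; the cell of \<open>t\<close> is therefore the last one of its row in \<open>P\<close>.
\<close>

definition crossing_step :: "enat tableau \<Rightarrow> nat tableau \<Rightarrow> nat \<Rightarrow> enat tableau \<times> nat \<times> enat" where
  "crossing_step P T t =
     (let r = row_of T t; c = column_of T t
      in reverse_bump (P[r := take c (P ! r)]) r c (P ! r ! c))"

text \<open>
  Element \<open>t - 1\<close> of the list \<open>popped P T n\<close> gives the column and the entry popped when \<open>t\<close> is
  crossed out.
\<close>

fun popped :: "enat tableau \<Rightarrow> nat tableau \<Rightarrow> nat \<Rightarrow> (nat \<times> enat) list" where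
  "popped P T 0 = []"
| "popped P T (Suc t) =
     (case crossing_step P T (Suc t) of (P', c, x) \<Rightarrow> popped P' T t @ [(c, x)])"

definition rs_pops :: "nat \<Rightarrow> nat \<Rightarrow> nat tableau \<Rightarrow> nat tableau \<Rightarrow> (nat \<times> enat) list" where
  "rs_pops m n S T = popped (add_infinities (n - m) S) T n"

definition rs_word :: "nat \<Rightarrow> nat \<Rightarrow> nat tableau \<Rightarrow> nat tableau \<Rightarrow> enat list" where
  "rs_word m n S T = map snd (rs_pops m n S T)"

subsection \<open>The cocycles and the cycles\<close>

text \<open>The word \<open>w\<close> has its letters placed in the positions \<open>is\<close>, listed in increasing order.\<close>

definition word_simplex :: "nat list \<Rightarrow> enat list \<Rightarrow> vertex list" where
  "word_simplex is w = map (\<lambda>(i, x). (the_enat x, i)) (filter (\<lambda>(i, x). x \<noteq> \<infinity>) (zip is w))"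

definition gamma_class :: "nat \<Rightarrow> nat \<Rightarrow> nat tableau \<Rightarrow> nat tableau \<Rightarrow> chain set" where
  "gamma_class m n S T = cohomology_class (int m - 1) (chessboard {1..m} {1..n})
     (oriented_simplex (word_simplex [1..<Suc n] (rs_word m n S T)))"

text \<open>
  The simplices of \<open>rho A B\<close> are oriented by listing the edges in increasing order of the letters
  (the left vertices). Two words that differ by exchanging \<open>\<infinity>\<close> with another letter then contribute
  opposite multiples of their common codimension one face, so \<open>rho A B\<close> is a cycle. With the edges
  listed in increasing order of the positions, as in \<open>word_simplex\<close>, the signed sum has nonzero
  boundary as soon as \<open>A\<close> has two elements.
\<close>

definition rho :: "nat set \<Rightarrow> nat set \<Rightarrow> chain" where
  "rho A B = (\<Sum>w\<in>permutations_of_set (insert \<infinity> (enat ` A)).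
     frag_cmul (inv_sign (<) w)
       (oriented_simplex (sort_key fst (word_simplex (sorted_list_of_set B) w))))"

definition pop_entries :: "nat \<Rightarrow> nat \<Rightarrow> nat tableau \<Rightarrow> nat tableau \<Rightarrow> nat \<Rightarrow> nat set" where
  "pop_entries m n S T c = {a. (c, enat a) \<in> set (rs_pops m n S T)}"

definition pop_positions :: "nat \<Rightarrow> nat \<Rightarrow> nat tableau \<Rightarrow> nat tableau \<Rightarrow> nat \<Rightarrow> nat set" where
  "pop_positions m n S T c = {t \<in> {1..n}. fst (rs_pops m n S T ! (t - 1)) = c}"

definition eta_cycle :: "nat \<Rightarrow> nat \<Rightarrow> nat tableau \<Rightarrow> nat tableau \<Rightarrow> chain" where
  "eta_cycle m n S T =
     foldr wedge (map (\<lambda>c. rho (pop_entries m n S T c) (pop_positions m n S T c)) [0..<n - m])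
       (frag_of {})"

definition eta_class :: "nat \<Rightarrow> nat \<Rightarrow> nat tableau \<Rightarrow> nat tableau \<Rightarrow> chain set" where
  "eta_class m n S T =
     homology_class (int m - 1) (chessboard {1..m} {1..n}) (eta_cycle m n S T)"

subsection \<open>Agreement with the usual descriptions\<close>

lemma shape_add_infinities:
  assumes "sorted_wrt (\<ge>) (k # shape S)"
  shows "shape (add_infinities k S) = k # shape S"
  using assms by (induction k S rule: add_infinities.induct) (auto simp: shape_def)

lemma pairing_superset:
  assumes "finite A" "Poly_Mapping.keys c \<subseteq> A \<or> Poly_Mapping.keys d \<subseteq> A"
  shows "pairing c d = (\<Sum>F\<in>A. Poly_Mapping.lookup c F * Poly_Mapping.lookup d F)"
proof -
  have *: "pairing c d = (\<Sum>F\<in>A \<union> Poly_Mapping.keys c. Poly_Mapping.lookup c F * Poly_Mapping.lookup d F)"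
    unfolding pairing_def using assms(1)
    by (intro sum.mono_neutral_left) (auto simp: in_keys_iff)
  show ?thesis
    unfolding * using assms
    by (intro sum.mono_neutral_right) (auto simp: in_keys_iff)
qed

lemma pairing_extend_right:
  "pairing c (frag_extend f d) =
     (\<Sum>F\<in>Poly_Mapping.keys d. Poly_Mapping.lookup d F * pairing c (f F))"
proof -
  have "pairing c (frag_extend f d) = (\<Sum>G\<in>Poly_Mapping.keys c.
      \<Sum>F\<in>Poly_Mapping.keys d. Poly_Mapping.lookup d F * (Poly_Mapping.lookup c G * Poly_Mapping.lookup (f F) G))"
    by (simp add: pairing_def frag_extend_def lookup_sum sum_distrib_left mult_ac)
  also have "\<dots> = (\<Sum>F\<in>Poly_Mapping.keys d. \<Sum>G\<in>Poly_Mapping.keys c.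
      Poly_Mapping.lookup d F * (Poly_Mapping.lookup c G * Poly_Mapping.lookup (f F) G))"
    by (rule sum.swap)
  finally show ?thesis by (simp add: pairing_def sum_distrib_left)
qed

lemma pairing_coboundary:
  assumes "finite K" "Poly_Mapping.keys d \<subseteq> K"
  shows "pairing (coboundary K c) d = pairing c (boundary d)"
proof -
  have lk: "Poly_Mapping.lookup (coboundary K c) F = pairing c (boundary (frag_of F))" if "F \<in> K" for F
    using assms(1) that by (simp add: coboundary_def lookup_sum if_distrib sum.delta cong: if_cong)
  have "pairing (coboundary K c) d =
      (\<Sum>F\<in>Poly_Mapping.keys d. Poly_Mapping.lookup (coboundary K c) F * Poly_Mapping.lookup d F)"
    by (intro pairing_superset) auto
  also have "\<dots> = (\<Sum>F\<in>Poly_Mapping.keys d. Poly_Mapping.lookup d F * pairing c (boundary (frag_of F)))"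
    using assms(2) by (intro sum.cong) (auto simp: lk)
  also have "\<dots> = pairing c (boundary d)"
    unfolding boundary_def pairing_extend_right by simp
  finally show ?thesis .
qed

lemma card_inversions_Cons:
  "card (inversions lt (x # xs)) = length (filter (\<lambda>y. lt y x) xs) + card (inversions lt xs)"
proof -
  let ?A = "{j. j < length xs \<and> lt (xs ! j) x}"
  have eq: "inversions lt (x # xs) =
      (\<lambda>j. (0, Suc j)) ` ?A \<union> (\<lambda>(i, j). (Suc i, Suc j)) ` inversions lt xs"
    (is "?L = ?R")
  proof (rule Set.set_eqI)
    fix p :: "nat \<times> nat"
    obtain i j where p: "p = (i, j)" by (cases p)
    show "p \<in> ?L \<longleftrightarrow> p \<in> ?R"
      unfolding p by (cases i; cases j) (auto simp: inversions_def image_iff)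
  qed
  have fin: "finite (inversions lt xs)"
    by (rule finite_subset[of _ "{..<length xs} \<times> {..<length xs}"]) (auto simp: inversions_def)
  have "card (inversions lt (x # xs)) =
      card ((\<lambda>j. (0::nat, Suc j)) ` ?A) + card ((\<lambda>(i, j). (Suc i, Suc j)) ` inversions lt xs)"
    unfolding eq using fin by (intro card_Un_disjoint) auto
  also have "card ((\<lambda>j. (0::nat, Suc j)) ` ?A) = card ?A"
    by (intro card_image inj_onI) auto
  also have "card ((\<lambda>(i, j). (Suc i, Suc j)) ` inversions lt xs) = card (inversions lt xs)"
    by (intro card_image inj_onI) auto
  finally show ?thesis by (simp add: length_filter_conv_card)
qed

lemma card_inversions_append:
  assumes "distinct (xs @ ys)"
  shows "card (inversions lt (xs @ ys)) =
    card (inversions lt xs) + card (inversions lt ys) + card {(u, v) \<in> set xs \<times> set ys. lt v u}"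
  using assms
proof (induction xs)
  case Nil
  then show ?case by (simp add: inversions_def)
next
  case (Cons x xs)
  have "{(u, v) \<in> set (x # xs) \<times> set ys. lt v u} =
      Pair x ` {v \<in> set ys. lt v x} \<union> {(u, v) \<in> set xs \<times> set ys. lt v u}"
    by auto
  also have "card \<dots> = card (Pair x ` {v \<in> set ys. lt v x}) + card {(u, v) \<in> set xs \<times> set ys. lt v u}"
    using Cons.prems
    by (intro card_Un_disjoint) (auto intro: finite_subset[of _ "set xs \<times> set ys"])
  also have "card (Pair x ` {v \<in> set ys. lt v x}) = card {v \<in> set ys. lt v x}"
    by (intro card_image inj_onI) auto
  also have "\<dots> = length (filter (\<lambda>v. lt v x) ys)"
    using Cons.prems by (simp add: distinct_length_filter Int_def conj_commute)
  finally show ?case using Cons by (simp add: card_inversions_Cons)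
qed

lemma wedge_oriented_simplex:
  assumes "distinct (xs @ ys)"
  shows "wedge (oriented_simplex xs) (oriented_simplex ys) = oriented_simplex (xs @ ys)"
  using card_inversions_append[OF assms, of vless]
  by (simp add: wedge_def oriented_simplex_def frag_extend_cmul inv_sign_def power_add mult_ac)

lemma card_inversions_insert:
  "card (inversions lt (xs @ v # ys)) = card (inversions lt (xs @ ys)) +
     length (filter (\<lambda>u. lt v u) xs) + length (filter (\<lambda>u. lt u v) ys)"
  by (induction xs) (auto simp: card_inversions_Cons)

lemma vless_linear: "u \<noteq> v \<Longrightarrow> vless u v \<longleftrightarrow> \<not> vless v u" "\<not> vless v v"
  by (cases u; cases v; auto simp: vless_def)+

lemma inv_sign_remove:
  assumes "distinct (xs @ v # ys)"
  shows "inv_sign vless (xs @ v # ys) * (-1) ^ card {u \<in> set (xs @ v # ys). vless u v} =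
    (-1) ^ length xs * inv_sign vless (xs @ ys)"
proof -
  have "{u \<in> set (xs @ v # ys). vless u v} = set (filter (\<lambda>u. vless u v) (xs @ ys))"
    using vless_linear(2) by auto
  moreover have "distinct (filter (\<lambda>u. vless u v) (xs @ ys))"
    using assms by auto
  ultimately have "card {u \<in> set (xs @ v # ys). vless u v} =
      length (filter (\<lambda>u. vless u v) (xs @ ys))"
    by (simp only: distinct_card)
  moreover have "length (filter (\<lambda>u. vless v u) xs) + length (filter (\<lambda>u. vless u v) xs) = length xs"
  proof -
    have "u \<noteq> v" if "u \<in> set xs" for u
      using assms that by auto
    then have "filter (\<lambda>u. vless u v) xs = filter (\<lambda>u. \<not> vless v u) xs"
      by (intro filter_cong refl vless_linear(1))
    then show ?thesis by (simp add: sum_length_filter_compl)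
  qed
  ultimately have "card (inversions vless (xs @ v # ys)) + card {u \<in> set (xs @ v # ys). vless u v} =
      length xs + card (inversions vless (xs @ ys)) + 2 * length (filter (\<lambda>u. vless u v) ys)"
    by (simp add: card_inversions_insert)
  then show ?thesis
    by (simp add: inv_sign_def power_add[symmetric]) (simp add: power_add power_mult)
qed

lemma boundary_oriented_simplex:
  assumes "distinct vs"
  shows "boundary (oriented_simplex vs) =
    (\<Sum>i<length vs. frag_cmul ((-1) ^ i) (oriented_simplex (take i vs @ drop (Suc i) vs)))"
proof -
  let ?s = "\<lambda>v. inv_sign vless vs * (-1) ^ card {u \<in> set vs. vless u v}"
  have "boundary (oriented_simplex vs) = (\<Sum>v\<in>set vs. frag_cmul (?s v) (frag_of (set vs - {v})))"
    by (simp add: boundary_def oriented_simplex_def frag_extend_cmul frag_cmul_sum)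
  also have "\<dots> = (\<Sum>i<length vs. frag_cmul (?s (vs ! i)) (frag_of (set vs - {vs ! i})))"
    by (rule sum.reindex_bij_betw[symmetric, OF bij_betw_nth[OF assms]]) auto
  also have "\<dots> =
      (\<Sum>i<length vs. frag_cmul ((-1) ^ i) (oriented_simplex (take i vs @ drop (Suc i) vs)))"
  proof (rule sum.cong, rule refl)
    fix i assume "i \<in> {..<length vs}"
    then have i: "i < length vs" by simp
    define xs ys v where "xs = take i vs" and "ys = drop (Suc i) vs" and "v = vs ! i"
    have vs: "vs = xs @ v # ys" and len: "length xs = i"
      using i by (simp_all add: xs_def ys_def v_def id_take_nth_drop[symmetric])
    have "set vs - {v} = set (xs @ ys)" using assms by (auto simp: vs)
    moreover have "?s v = (-1) ^ i * inv_sign vless (xs @ ys)"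
      using inv_sign_remove[of xs v ys] assms by (simp add: vs len)
    ultimately show "frag_cmul (?s (vs ! i)) (frag_of (set vs - {vs ! i})) =
        frag_cmul ((-1) ^ i) (oriented_simplex (take i vs @ drop (Suc i) vs))"
      by (simp add: oriented_simplex_def flip: xs_def ys_def v_def)
  qed
  finally show ?thesis .
qed

end

theory Submission
  imports Defs "HOL-Library.List_Lexorder"
begin

text \<open>
  A face of top dimension is a word of length \<open>n\<close>: the edge \<open>aj'\<close> puts the letter \<open>a\<close> in position \<open>j\<close>, and the
  \<open>n - m\<close> free positions get the letter \<open>\<infinity>\<close>. As edges are ordered by their left vertices, removing the edge of \<open>a\<close>
  from such a face has a sign that depends on \<open>a\<close> only. So, if all letters but one are fixed, the sum of the faces
  over the positions of the remaining letter is a coboundary up to sign, and a chain of top dimension is a cycle as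
  soon as the corresponding sums of its coefficients vanish.
  
  Spanning. More generally, the placements of a set of letters that avoid a smaller set of positions add up to a
  coboundary (\<open>avoiding_sum_coboundary\<close>). If a word has a weakly increasing subsequence with more than \<open>n - m\<close>
  letters, this relation expresses the word by words that are smaller in the lexicographic order of reversed words
  (\<open>straightening\<close>). Modulo coboundaries, all faces are therefore integer combinations of words without such a
  subsequence.
  
  Tableaux. The first row of the insertion tableau of a word is not longer than its longest weakly increasing
  subsequence. The \<open>n - m\<close> letters \<open>\<infinity>\<close> lie in different columns; if there are at most \<open>n - m\<close> columns, each of
  them ends with \<open>\<infinity>\<close>, which means that the tableau is \<open>S\<^sup>*\<close> for a standard tableau \<open>S\<close>. Hence the words that are left
  over come from the pairs \<open>(S, T)\<close> (\<open>rs_word_surject\<close>), each of them from one pair only (\<open>rs_word_inject\<close>).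
  
  Triangularity. The letters popped from one column decrease from left to right in the word \<open>\<sigma>\<close> of \<open>(S, T)\<close>. The
  cycle \<open>\<eta>(S, T)\<close> is a signed sum of the words that permute the letters of \<open>\<sigma>\<close> within these blocks, and \<open>\<sigma>\<close> is the
  smallest of them in the order above (\<open>lookup_eta_triangular\<close>). So the coefficients of the cycles \<open>\<eta>\<close> at the words
  \<open>\<sigma>\<close> form a unitriangular matrix.
  
  Cycles pair to zero with coboundaries, hence a cycle is determined by its coefficients at the words \<open>\<sigma>\<close>, and the
  unitriangular system produces it as a unique combination of the cycles \<open>\<eta>\<close>. The cocycles \<open>\<gamma>\<close> are these words up to
  sign; they span the cohomology, and their pairing with the cycles \<open>\<eta>\<close> shows that they are independent modulo
  torsion.
\<close>

section \<open>Row insertion and its inverse\<close>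

definition column_strict :: "'a::linorder list \<Rightarrow> 'a list \<Rightarrow> bool" where
  "column_strict u v \<longleftrightarrow> length v \<le> length u \<and> (\<forall>c<length v. u ! c < v ! c)"

fun semistandard :: "'a::linorder tableau \<Rightarrow> bool" where
  "semistandard [] \<longleftrightarrow> True"
| "semistandard [u] \<longleftrightarrow> sorted u"
| "semistandard (u # v # P) \<longleftrightarrow> sorted u \<and> column_strict u v \<and> semistandard (v # P)"

definition bump_column :: "'a::linorder list \<Rightarrow> 'a \<Rightarrow> nat" where
  "bump_column u x = (LEAST c. c < length u \<and> x < u ! c)"

definition unbump_column :: "'a::linorder list \<Rightarrow> 'a \<Rightarrow> nat" where
  "unbump_column u y = last (filter (\<lambda>c. u ! c < y) [0..<length u])"

fun insert_entry :: "'a::linorder \<Rightarrow> 'a tableau \<Rightarrow> 'a tableau \<times> nat" where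
  "insert_entry x [] = ([[x]], 0)"
| "insert_entry x (u # P) =
     (if \<forall>z\<in>set u. z \<le> x then ((u @ [x]) # P, 0)
      else let c = bump_column u x in
        case insert_entry (u ! c) P of (P', r) \<Rightarrow> (u[c := x] # P', Suc r))"

text \<open>
  The recursion runs down to the row of the corner and bumps on the way back, which makes it the mirror
  image of \<open>insert_entry\<close>; \<open>reverse_bump\<close> modifies the same rows, but starting from the corner. A row that
  loses its only cell stays in the list as an empty row. The equation for the empty list is a default
  value, a corner lies in a nonempty tableau.
\<close>

fun delete_corner :: "'a::linorder tableau \<Rightarrow> nat \<Rightarrow> 'a tableau \<times> nat \<times> 'a" where
  "delete_corner [] r = ([], 0, undefined)"
| "delete_corner (u # P) 0 = (butlast u # P, length u - 1, last u)"
| "delete_corner (u # P) (Suc r) =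
     (case delete_corner P r of (P', _, y) \<Rightarrow>
        let c = unbump_column u y in (u[c := y] # P', c, u ! c))"

definition corner :: "'a tableau \<Rightarrow> nat \<Rightarrow> bool" where
  "corner P r \<longleftrightarrow> r < length P \<and> P ! r \<noteq> [] \<and>
     (Suc r < length P \<longrightarrow> length (P ! Suc r) < length (P ! r))"

lemma corner_Cons_Suc [simp]: "corner (u # P) (Suc r) \<longleftrightarrow> corner P r"
  by (simp add: corner_def)

lemma semistandard_ConsD: "semistandard (u # P) \<Longrightarrow> sorted u \<and> semistandard P"
  by (cases P) auto

lemma semistandard_Cons_iff:
  "semistandard (u # P) \<longleftrightarrow> sorted u \<and> semistandard P \<and> (P \<noteq> [] \<longrightarrow> column_strict u (hd P))"
  by (cases P) auto

lemma bump_column: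
  assumes "\<not> (\<forall>z\<in>set u. z \<le> x)"
  shows "bump_column u x < length u" "x < u ! bump_column u x"
    "\<And>j. j < bump_column u x \<Longrightarrow> u ! j \<le> x"
proof -
  obtain c where c: "c < length u \<and> x < u ! c"
    using assms by (metis in_set_conv_nth not_le)
  show *: "bump_column u x < length u" "x < u ! bump_column u x"
    using LeastI[of "\<lambda>c. c < length u \<and> x < u ! c", OF c] by (simp_all add: bump_column_def)
  show "u ! j \<le> x" if "j < bump_column u x" for j
    using not_less_Least[of j "\<lambda>c. c < length u \<and> x < u ! c"] that *(1)
    by (auto simp flip: bump_column_def)
qed

lemma unbump_column:
  assumes "d < length u" "u ! d < y"
  shows "unbump_column u y < length u" "u ! unbump_column u y < y" "d \<le> unbump_column u y"
    "\<And>j. unbump_column u y < j \<Longrightarrow> j < length u \<Longrightarrow> y \<le> u ! j"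
proof -
  define f where "f = filter (\<lambda>c. u ! c < y) [0..<length u]"
  have f: "unbump_column u y = last f" by (simp add: f_def unbump_column_def)
  have set_f: "set f = {c. c < length u \<and> u ! c < y}" by (auto simp: f_def)
  then have d: "d \<in> set f" using assms by auto
  then have ne: "f \<noteq> []" by auto
  then have "last f \<in> set f" by (rule last_in_set)
  then show *: "unbump_column u y < length u" "u ! unbump_column u y < y"
    by (auto simp: f set_f)
  have srt: "sorted f" unfolding f_def by (intro sorted_wrt_filter) simp
  have mx: "j \<le> unbump_column u y" if j: "j \<in> set f" for j
  proof -
    obtain i where i: "i < length f" "f ! i = j" using j unfolding in_set_conv_nth by blast
    have "f ! i \<le> f ! (length f - 1)" using srt i(1) by (intro sorted_nth_mono) auto
    then show ?thesis unfolding f last_conv_nth[OF ne] i(2) .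
  qed
  show "d \<le> unbump_column u y" using mx[OF d] .
  show "y \<le> u ! j" if "unbump_column u y < j" "j < length u" for j
    using mx[of j] that by (auto simp: set_f not_less[symmetric])
qed

lemma unbump_column_eqI:
  assumes "c < length u" "u ! c < y" "\<And>j. c < j \<Longrightarrow> j < length u \<Longrightarrow> y \<le> u ! j"
  shows "unbump_column u y = c"
  using unbump_column[OF assms(1,2)] assms(3)
  by (metis leD le_neq_implies_less)

lemma bump_column_eqI:
  assumes "c < length u" "x < u ! c" "\<And>j. j < c \<Longrightarrow> u ! j \<le> x"
  shows "bump_column u x = c"
  unfolding bump_column_def
  using assms by (intro Least_equality) (auto simp: leD intro: leI)

lemma mset_list_update: "c < length u \<Longrightarrow> mset (u[c := x]) + {#u ! c#} = mset u + {#x#}"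
  by (simp add: mset_update)

lemma sorted_list_update:
  fixes u :: "'a::linorder list"
  assumes "sorted u" "c < length u" "\<And>j. j < c \<Longrightarrow> u ! j \<le> y" "\<And>j. c < j \<Longrightarrow> j < length u \<Longrightarrow> y \<le> u ! j"
  shows "sorted (u[c := y])"
  unfolding sorted_iff_nth_mono
proof (intro allI impI)
  fix i j assume "i \<le> j" "j < length (u[c := y])"
  then show "u[c := y] ! i \<le> u[c := y] ! j"
    using assms by (cases "i = c"; cases "j = c") (auto simp: nth_list_update sorted_nth_mono)
qed

lemma sorted_butlast: "sorted u \<Longrightarrow> sorted (butlast u)" for u :: "'a::linorder list"
  by (simp add: butlast_conv_take sorted_wrt_take)

text \<open>
  The induction needs to know how the top row changes: only its entry in column \<open>d\<close> does, and from
  column \<open>d\<close> on the new row is larger than the popped entry \<open>y\<close>. One row further up, \<open>y\<close> lands in a column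
  \<open>c \<ge> d\<close>, because the entry above the old position of \<open>y\<close> is smaller than \<open>y\<close>; hence the columns stay
  strict. The last conclusion holds because each row insertion undoes the corresponding row deletion.
\<close>

lemma delete_corner:
  assumes "semistandard P" "corner P r" "delete_corner P r = (P', d, y)"
  shows "semistandard P' \<and> length P' = length P \<and>
    (\<forall>i<length P. length (P' ! i) = length (P ! i) - (if i = r then 1 else 0)) \<and>
    mset (concat P) = mset (concat P') + {#y#} \<and>
    d < length (P ! 0) \<and> y = P ! 0 ! d \<and>
    (\<forall>i. d \<le> i \<and> i < length (P' ! 0) \<longrightarrow> y < P' ! 0 ! i) \<and>
    (\<forall>i. i \<noteq> d \<and> i < length (P' ! 0) \<longrightarrow> P' ! 0 ! i = P ! 0 ! i) \<and>
    insert_entry y P' = (P, r)"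
  using assms
proof (induction P r arbitrary: P' d y rule: delete_corner.induct)
  case (1 r)
  then show ?case by (simp add: corner_def)
next
  case (2 u P)
  have u: "u \<noteq> []" and srt: "sorted u" and P: "semistandard P"
    using 2 semistandard_ConsD[of u P] by (auto simp: corner_def)
  have eq: "P' = butlast u # P" "d = length u - 1" "y = last u" using 2 by auto
  have cs: "column_strict (butlast u) (hd P)" if "P \<noteq> []"
  proof -
    have "length (hd P) < length u" "column_strict u (hd P)"
      using 2 that by (auto simp: corner_def hd_conv_nth semistandard_Cons_iff)
    then show ?thesis by (auto simp: column_strict_def nth_butlast)
  qed
  have "z \<le> last u" if "z \<in> set (butlast u)" for z
    using srt u that by (metis append_butlast_last_id list.set_intros(1) sorted_append)
  then have ins: "insert_entry y P' = (u # P, 0)"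
    using u by (simp add: eq)
  have "mset u = mset (butlast u) + {#last u#}"
    using u by (metis append_butlast_last_id mset.simps(1,2) mset_append add_mset_add_single empty_neutral(1))
  then have mset: "mset (concat (u # P)) = mset (concat P') + {#y#}"
    by (simp add: eq)
  have ss: "semistandard P'" using P cs srt by (simp add: eq semistandard_Cons_iff sorted_butlast)
  have len: "\<forall>i<length (u # P). length (P' ! i) = length ((u # P) ! i) - (if i = 0 then 1 else 0)"
    by (auto simp: eq nth_Cons split: nat.splits)
  have "length P' = length (u # P)" "d < length ((u # P) ! 0)" "y = (u # P) ! 0 ! d"
    "\<forall>i. d \<le> i \<and> i < length (P' ! 0) \<longrightarrow> y < P' ! 0 ! i"
    "\<forall>i. i \<noteq> d \<and> i < length (P' ! 0) \<longrightarrow> P' ! 0 ! i = (u # P) ! 0 ! i"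
    using u by (auto simp: eq last_conv_nth nth_butlast)
  then show ?case using ins mset ss len by blast
next
  case (3 u P r)
  obtain Q e z where del: "delete_corner P r = (Q, e, z)" by (cases "delete_corner P r")
  define c where "c = unbump_column u z"
  have eq: "P' = u[c := z] # Q" "d = c" "y = u ! c"
    using 3(4) del by (auto simp: c_def Let_def)
  have srt: "sorted u" and P: "semistandard P" and cor: "corner P r"
    using 3 semistandard_ConsD[of u P] by auto
  then have ne: "P \<noteq> []" by (auto simp: corner_def)
  with 3(2) have cs: "column_strict u (P ! 0)" by (auto simp: semistandard_Cons_iff hd_conv_nth)
  from 3(1)[OF P cor del] have IH: "semistandard Q" "length Q = length P"
    "\<forall>i<length P. length (Q ! i) = length (P ! i) - (if i = r then 1 else 0)"
    "mset (concat P) = mset (concat Q) + {#z#}"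
    "e < length (P ! 0)" "z = P ! 0 ! e"
    "\<forall>i. e \<le> i \<and> i < length (Q ! 0) \<longrightarrow> z < Q ! 0 ! i"
    "\<forall>i. i \<noteq> e \<and> i < length (Q ! 0) \<longrightarrow> Q ! 0 ! i = P ! 0 ! i"
    "insert_entry z Q = (P, r)"
    by blast+
  have ue: "e < length u" "u ! e < z" using cs IH(5,6) by (auto simp: column_strict_def)
  note c = unbump_column[OF ue, folded c_def]
  have srt': "sorted (u[c := z])"
    using srt c
    by (intro sorted_list_update) (auto intro: order.trans[OF sorted_nth_mono[OF srt, of _ c]])
  have lenQ: "length (Q ! 0) \<le> length (P ! 0)" using IH(2,3) ne by auto
  have cs': "column_strict (u[c := z]) (Q ! 0)"
    unfolding column_strict_def
  proof (intro conjI allI impI)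
    show "length (Q ! 0) \<le> length (u[c := z])" using lenQ cs by (simp add: column_strict_def)
    fix i assume i: "i < length (Q ! 0)"
    show "u[c := z] ! i < Q ! 0 ! i"
    proof (cases "i = c")
      case True
      then show ?thesis using IH(7) c i by simp
    next
      case False
      have "u ! i < P ! 0 ! i" using cs i lenQ by (simp add: column_strict_def)
      also have "P ! 0 ! i \<le> Q ! 0 ! i"
        using IH(6,7,8) i by (cases "i = e") (auto intro: less_imp_le)
      finally show ?thesis using False by simp
    qed
  qed
  have ge: "\<forall>i. c \<le> i \<and> i < length (u[c := z]) \<longrightarrow> u ! c < u[c := z] ! i"
    using c by (auto simp: nth_list_update le_less less_le_trans)
  have "\<not> (\<forall>x\<in>set (u[c := z]). x \<le> u ! c)"
    using ge c(1) by (metis leD length_list_update nth_mem order_refl)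
  moreover have "bump_column (u[c := z]) (u ! c) = c"
    using c srt by (intro bump_column_eqI) (auto simp: sorted_nth_mono)
  ultimately have ins: "insert_entry y P' = (u # P, Suc r)"
    using IH(9) c(1) by (simp add: eq)
  have len: "\<forall>i<length (u # P). length (P' ! i) = length ((u # P) ! i) - (if i = Suc r then 1 else 0)"
    using IH(3) by (auto simp: eq nth_Cons split: nat.splits)
  have mset: "mset (concat (u # P)) = mset (concat P') + {#y#}"
    using IH(4) mset_list_update[OF c(1), of z] by (simp add: eq)
  show ?case
    using ins len mset srt' cs' IH(1,2) ne ge c(1)
    by (auto simp: eq semistandard_Cons_iff hd_conv_nth)
qed

text \<open>
  If no new row is opened, the insertion stops before it reaches the rows \<open>R\<close>.
\<close>

lemma insert_entry_pad:
  assumes "insert_entry x P = (Q, r)" "length Q = length P"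
  shows "insert_entry x (P @ R) = (Q @ R, r)"
  using assms
  by (induction x P arbitrary: Q r rule: insert_entry.induct)
    (auto simp: Let_def split: prod.splits if_splits)

text \<open>
  The empty last row absorbs a new corner, so that deletion restores the very same list of rows. Columns
  stay strict since an entry that is bumped from column \<open>c\<close> lands in a column \<open>e \<le> c\<close> of the next row:
  the entry below its old cell is larger.
\<close>

lemma insert_entry:
  assumes "semistandard P" "P \<noteq> []" "last P = []" "insert_entry x P = (P', r)"
  shows "semistandard P' \<and> length P' = length P \<and> corner P' r \<and>
    (\<forall>i<length P. length (P' ! i) = length (P ! i) + (if i = r then 1 else 0)) \<and>
    (\<exists>e<length (P' ! 0). P' ! 0 ! e = x \<and>
       (\<forall>i<length (P' ! 0). i \<noteq> e \<longrightarrow> i < length (P ! 0) \<and> P' ! 0 ! i = P ! 0 ! i) \<and>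
       (\<forall>i<e. P ! 0 ! i \<le> x) \<and> e \<le> length (P ! 0) \<and> delete_corner P' r = (P, e, x))"
  using assms
proof (induction x P arbitrary: P' r rule: insert_entry.induct)
  case (1 x)
  then show ?case by simp
next
  case (2 x u P)
  have srt: "sorted u" and P: "semistandard P"
    using 2 semistandard_ConsD[of u P] by auto
  have cs: "column_strict u (P ! 0)" if "P \<noteq> []"
    using 2(2) that by (auto simp: semistandard_Cons_iff hd_conv_nth)
  show ?case
  proof (cases "\<forall>z\<in>set u. z \<le> x")
    case True
    then have eq: "P' = (u @ [x]) # P" "r = 0" using 2 by auto
    have "column_strict (u @ [x]) (P ! 0)" if "P \<noteq> []"
      using cs[OF that] by (auto simp: column_strict_def nth_append)
    then have "semistandard P'"
      using srt P True by (auto simp: eq semistandard_Cons_iff sorted_append hd_conv_nth)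
    moreover have "corner P' r"
      using cs by (auto simp: eq corner_def column_strict_def le_imp_less_Suc)
    ultimately show ?thesis
      using True by (auto simp: eq nth_append nth_Cons split: nat.splits intro!: exI[of _ "length u"])
  next
    case False
    define c where "c = bump_column u x"
    note c = bump_column[OF False, folded c_def]
    obtain Q s where ins: "insert_entry (u ! c) P = (Q, s)" by (cases "insert_entry (u ! c) P")
    have eq: "P' = u[c := x] # Q" "r = Suc s"
      using 2(5) ins False by (auto simp: Let_def c_def)
    have ne: "P \<noteq> []" "last P = []" using False 2(4) by (auto split: if_splits)
    from 2(1)[OF False c_def P ne ins] obtain e where
      IH: "semistandard Q" "length Q = length P" "corner Q s"
      "\<forall>i<length P. length (Q ! i) = length (P ! i) + (if i = s then 1 else 0)"
      and e: "e < length (Q ! 0)" "Q ! 0 ! e = u ! c"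
      "\<forall>i<length (Q ! 0). i \<noteq> e \<longrightarrow> i < length (P ! 0) \<and> Q ! 0 ! i = P ! 0 ! i"
      "\<forall>i<e. P ! 0 ! i \<le> u ! c" "e \<le> length (P ! 0)" "delete_corner Q s = (P, e, u ! c)"
      by blast
    note cs = cs[OF ne(1)]
    have ec: "e \<le> c"
    proof (rule ccontr)
      assume "\<not> e \<le> c"
      then have "c < e" by simp
      then have "P ! 0 ! c \<le> u ! c" "c < length (P ! 0)" using e by auto
      then show False using cs by (auto simp: column_strict_def leD)
    qed
    have srt': "sorted (u[c := x])"
      using c less_imp_le[OF c(2)] srt
      by (intro sorted_list_update) (auto intro: order.trans[OF _ sorted_nth_mono])
    have cs': "column_strict (u[c := x]) (Q ! 0)"
      unfolding column_strict_def
    proof (intro conjI allI impI)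
      have "length (Q ! 0) \<le> length u"
      proof (rule ccontr)
        assume *: "\<not> length (Q ! 0) \<le> length u"
        then have "length u \<noteq> e" using ec c(1) by auto
        then have "length u < length (P ! 0)" using * e(3) by auto
        then show False using cs by (simp add: column_strict_def)
      qed
      then show "length (Q ! 0) \<le> length (u[c := x])" by simp
      fix i assume i: "i < length (Q ! 0)"
      show "u[c := x] ! i < Q ! 0 ! i"
      proof (cases "i = e")
        case True
        then show ?thesis
          using e(2) c ec by (cases "e = c") (auto intro: le_less_trans[of _ x])
      next
        case False
        then have "i < length (P ! 0)" "Q ! 0 ! i = P ! 0 ! i" using e(3) i by auto
        moreover have "u[c := x] ! i \<le> u ! i"
          using c by (cases "i = c") (auto intro: less_imp_le)
        ultimately show ?thesis
          using cs by (auto simp: column_strict_def intro: le_less_trans)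
      qed
    qed
    have unb: "unbump_column (u[c := x]) (u ! c) = c"
      using c srt by (intro unbump_column_eqI) (auto simp: sorted_nth_mono)
    then have "delete_corner P' r = (u # P, c, x)"
      using e(6) c(1) by (simp add: eq)
    moreover have "semistandard P'"
      using srt' cs' IH(1,2) ne by (auto simp: eq semistandard_Cons_iff hd_conv_nth)
    ultimately show ?thesis
      using IH c by (auto simp: eq nth_Cons split: nat.splits intro!: exI[of _ c])
  qed
qed

section \<open>The correspondence between words and pairs of tableaux\<close>

definition row_count :: "(nat \<Rightarrow> nat) \<Rightarrow> nat \<Rightarrow> nat \<Rightarrow> nat" where
  "row_count y t r = card {s \<in> {1..t}. y s = r}"

text \<open>
  A standard tableau is encoded by the map \<open>y\<close> from its entries to their rows. The ballot condition says
  that the entries \<open>1, \<dots>, t\<close> occupy a partition shape for every \<open>t\<close>; it replaces the conditions on rows and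
  columns.
\<close>

definition ballot :: "(nat \<Rightarrow> nat) \<Rightarrow> nat \<Rightarrow> bool" where
  "ballot y n \<longleftrightarrow> (\<forall>t\<le>n. \<forall>r. row_count y t (Suc r) \<le> row_count y t r)"

definition fits :: "'a tableau \<Rightarrow> (nat \<Rightarrow> nat) \<Rightarrow> nat \<Rightarrow> bool" where
  "fits P y t \<longleftrightarrow> (\<forall>s\<in>{1..t}. y s < length P) \<and> (\<forall>r<length P. length (P ! r) = row_count y t r)"

text \<open>
  The right tableau enters the inverse correspondence only through the rows of its entries. In this form
  the procedure can be unwound by induction on \<open>t\<close> without changing the tableau.
\<close>

fun pops :: "'a::linorder tableau \<Rightarrow> (nat \<Rightarrow> nat) \<Rightarrow> nat \<Rightarrow> (nat \<times> 'a) list" where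
  "pops P y 0 = []"
| "pops P y (Suc t) = (case delete_corner P (y (Suc t)) of (P', c, x) \<Rightarrow> pops P' y t @ [(c, x)])"

lemma row_count_0 [simp]: "row_count y 0 r = 0"
  by (simp add: row_count_def)

lemma row_count_Suc: "row_count y (Suc t) r = row_count y t r + (if y (Suc t) = r then 1 else 0)"
proof -
  have "{s \<in> {1..Suc t}. y s = r} =
      {s \<in> {1..t}. y s = r} \<union> (if y (Suc t) = r then {Suc t} else {})"
    by (auto simp: le_Suc_eq)
  then show ?thesis by (auto simp: row_count_def)
qed

lemma row_count_cong: "(\<And>s. s \<in> {1..t} \<Longrightarrow> y s = z s) \<Longrightarrow> row_count y t r = row_count z t r"
  unfolding row_count_def by (metis (mono_tags, lifting))

lemma ballot_mono: "ballot y n \<Longrightarrow> t \<le> n \<Longrightarrow> ballot y t"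
  by (auto simp: ballot_def)

lemma length_pops [simp]: "length (pops P y t) = t"
  by (induction P y t rule: pops.induct) (auto split: prod.splits)

lemma pops_cong: "(\<And>s. s \<in> {1..t} \<Longrightarrow> y s = z s) \<Longrightarrow> pops P y t = pops P z t"
  by (induction P y t rule: pops.induct) (auto split: prod.splits)

lemma delete_corner_pad:
  "r < length P \<Longrightarrow> delete_corner (P @ R) r =
     (case delete_corner P r of (P', c, x) \<Rightarrow> (P' @ R, c, x))"
  by (induction P r rule: delete_corner.induct) (auto simp: Let_def split: prod.splits)

lemma corner_if_fits:
  assumes "fits P y (Suc t)" "ballot y (Suc t)"
  shows "corner P (y (Suc t))"
proof -
  let ?r = "y (Suc t)"
  have "row_count y t (Suc ?r) \<le> row_count y t ?r" using assms(2) by (simp add: ballot_def)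
  then have "row_count y (Suc t) (Suc ?r) < row_count y (Suc t) ?r" by (simp add: row_count_Suc)
  moreover have r: "?r < length P" using assms(1) by (auto simp: fits_def)
  moreover have "length (P ! r) = row_count y (Suc t) r" if "r < length P" for r
    using assms(1) that by (simp add: fits_def)
  ultimately show ?thesis by (force simp: corner_def)
qed

lemma delete_corner_fits:
  assumes "semistandard P" "fits P y (Suc t)" "ballot y (Suc t)"
    and "delete_corner P (y (Suc t)) = (P', c, x)"
  shows "semistandard P'" "fits P' y t" "length P' = length P"
    "insert_entry x P' = (P, y (Suc t))"
  using delete_corner[OF assms(1) corner_if_fits[OF assms(2,3)] assms(4)] assms(2)
  by (auto simp: fits_def row_count_Suc)

lemma pops_pad:
  assumes "\<forall>s\<in>{1..t}. y s < length P" "semistandard P" "fits P y t" "ballot y t"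
  shows "pops (P @ R) y t = pops P y t"
  using assms
proof (induction P y t rule: pops.induct)
  case (1 P y)
  then show ?case by simp
next
  case (2 P y t)
  obtain P' c x where del: "delete_corner P (y (Suc t)) = (P', c, x)"
    by (cases "delete_corner P (y (Suc t))")
  note P' = delete_corner_fits[OF 2(3,4,5) del]
  have "y (Suc t) < length P" using 2(2) by simp
  moreover have "pops (P' @ R) y t = pops P' y t"
    using 2 P' del by (intro 2(1)) (auto intro: ballot_mono)
  ultimately show ?case by (simp add: delete_corner_pad del)
qed

lemma fits_0_replicate: "fits P y 0 \<Longrightarrow> P = replicate (length P) []"
  by (intro nth_equalityI) (auto simp: fits_def)

lemma mset_pops:
  assumes "semistandard P" "fits P y t" "ballot y t"
  shows "mset (map snd (pops P y t)) = mset (concat P)"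
  using assms
proof (induction P y t rule: pops.induct)
  case (1 P y)
  then show ?case by (subst fits_0_replicate[OF 1(2)]) (simp add: concat_replicate_trivial)
next
  case (2 P y t)
  obtain P' c x where del: "delete_corner P (y (Suc t)) = (P', c, x)"
    by (cases "delete_corner P (y (Suc t))")
  note P' = delete_corner_fits[OF 2(2,3,4) del]
  have "mset (map snd (pops P' y t)) = mset (concat P')"
    using 2 P' del by (intro 2(1)) (auto intro: ballot_mono)
  then show ?case
    using delete_corner[OF 2(2) corner_if_fits[OF 2(3,4)] del] by (simp add: del)
qed

text \<open>
  The entry that pops from a cell of the top row is replaced by a larger one, or its cell disappears for
  good. The positions are crossed out from right to left, so that the entries popped from one column
  decrease from left to right.
\<close>

lemma pops_column_decreasing:
  assumes "semistandard P" "fits P y t" "ballot y t"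
  shows "(\<forall>i<t. fst (pops P y t ! i) < length (P ! 0) \<and>
              P ! 0 ! fst (pops P y t ! i) \<le> snd (pops P y t ! i)) \<and>
         (\<forall>i j. i < j \<and> j < t \<and> fst (pops P y t ! i) = fst (pops P y t ! j) \<longrightarrow>
              snd (pops P y t ! j) < snd (pops P y t ! i))"
  using assms
proof (induction P y t rule: pops.induct)
  case (1 P y)
  then show ?case by simp
next
  case (2 P y t)
  obtain P' d x where del: "delete_corner P (y (Suc t)) = (P', d, x)"
    by (cases "delete_corner P (y (Suc t))")
  note P' = delete_corner_fits[OF 2(2,3,4) del]
  let ?L = "pops P' y t"
  have IH: "\<And>i. i < t \<Longrightarrow> fst (?L ! i) < length (P' ! 0) \<and> P' ! 0 ! fst (?L ! i) \<le> snd (?L ! i)"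
    "\<And>i j. i < j \<Longrightarrow> j < t \<Longrightarrow> fst (?L ! i) = fst (?L ! j) \<Longrightarrow> snd (?L ! j) < snd (?L ! i)"
    using 2(1)[OF del[symmetric] refl P'(1,2)] ballot_mono[OF 2(4)] by auto
  have cor: "corner P (y (Suc t))" by (rule corner_if_fits[OF 2(3,4)])
  note dc = delete_corner[OF 2(2) cor del]
  have "P \<noteq> []" using cor by (auto simp: corner_def)
  then have len: "length (P' ! 0) \<le> length (P ! 0)" using dc by auto
  have old: "fst (?L ! i) < length (P ! 0) \<and> P ! 0 ! fst (?L ! i) \<le> snd (?L ! i) \<and>
      (fst (?L ! i) = d \<longrightarrow> x < snd (?L ! i))" if "i < t" for i
    using IH(1)[OF that] len dc by (cases "fst (?L ! i) = d") (auto intro: less_le_trans less_imp_le)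
  have new: "d < length (P ! 0)" "P ! 0 ! d = x" using dc by auto
  show ?case
    using old new IH(2) by (auto simp: del nth_append less_Suc_eq)
qed

text \<open>
  Reinserting the word letter by letter recovers both the rows of the corners and the left tableau. The
  number of empty rows that are left after all deletions is not visible in the word; padding with empty rows
  makes the two left tableaux comparable.
\<close>

lemma pops_inject:
  assumes "semistandard P" "fits P y t" "ballot y t"
    and "semistandard Q" "fits Q z t" "ballot z t"
    and "map snd (pops P y t) = map snd (pops Q z t)"
  shows "(\<forall>s\<in>{1..t}. y s = z s) \<and> P @ replicate (length Q) [] = Q @ replicate (length P) []"
  using assms
proof (induction t arbitrary: P Q)
  case 0
  obtain k l where "P = replicate k []" "Q = replicate l []"
    using 0(2,5) fits_0_replicate by metis
  then show ?case by (simp flip: replicate_add add: add.commute)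
next
  case (Suc t)
  obtain P' c x where dP: "delete_corner P (y (Suc t)) = (P', c, x)"
    by (cases "delete_corner P (y (Suc t))")
  obtain Q' d x' where dQ: "delete_corner Q (z (Suc t)) = (Q', d, x')"
    by (cases "delete_corner Q (z (Suc t))")
  note P' = delete_corner_fits[OF Suc(2,3,4) dP]
  note Q' = delete_corner_fits[OF Suc(5,6,7) dQ]
  have eq: "map snd (pops P' y t) = map snd (pops Q' z t)" "x = x'"
    using Suc(8) by (auto simp: dP dQ)
  have IH: "\<forall>s\<in>{1..t}. y s = z s"
    "P' @ replicate (length Q) [] = Q' @ replicate (length P) []"
    using Suc.IH[OF P'(1,2) ballot_mono[OF Suc(4)] Q'(1,2) ballot_mono[OF Suc(7)] eq(1)] P'(3) Q'(3)
    by auto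
  have "insert_entry x (P' @ replicate (length Q) []) = (P @ replicate (length Q) [], y (Suc t))"
    using P'(3,4) by (intro insert_entry_pad) auto
  moreover have "insert_entry x (Q' @ replicate (length P) []) = (Q @ replicate (length P) [], z (Suc t))"
    using Q'(3,4) by (intro insert_entry_pad) (auto simp: eq(2))
  ultimately show ?case using IH by (auto simp: le_Suc_eq)
qed

lemma semistandard_column_strict:
  "semistandard P \<Longrightarrow> Suc r < length P \<Longrightarrow> column_strict (P ! r) (P ! Suc r)"
proof (induction P arbitrary: r)
  case (Cons u P)
  then show ?case
    by (cases r) (auto simp: semistandard_Cons_iff hd_conv_nth)
qed simp

lemma semistandard_snoc_empty: "semistandard P \<Longrightarrow> semistandard (P @ [[]])"
  by (induction P rule: semistandard.induct) (auto simp: column_strict_def)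

text \<open>
  The increasing subsequences are weakly increasing, and they are given by their sets of positions. In a
  word with letters \<open>\<infinity>\<close> these may be repeated.
\<close>

definition increasing_on :: "nat set \<Rightarrow> 'a::linorder list \<Rightarrow> bool" where
  "increasing_on I w \<longleftrightarrow> I \<subseteq> {..<length w} \<and> (\<forall>i\<in>I. \<forall>j\<in>I. i < j \<longrightarrow> w ! i \<le> w ! j)"

lemma increasing_on_append: "increasing_on I w \<Longrightarrow> increasing_on I (w @ v)"
  by (auto simp: increasing_on_def nth_append subset_iff)

text \<open>
  The left tableau is obtained by inserting the letters of \<open>w\<close>, with one more empty row for each letter. The
  last conclusion is the easy half of Schensted's theorem: by induction, the entry in column \<open>j\<close> of the first
  row bounds an increasing subsequence with \<open>j + 1\<close> letters, as the entry to its left did so for \<open>j\<close>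
  letters when it was inserted. The row appended to \<open>P\<close> covers the empty word.
\<close>

lemma pops_surject:
  fixes w :: "'a::linorder list"
  shows "\<exists>P y. length P = length w \<and> semistandard P \<and> fits P y (length w) \<and>
    ballot y (length w) \<and> map snd (pops P y (length w)) = w \<and>
    (\<forall>j<length ((P @ [[]]) ! 0). \<exists>I. increasing_on I w \<and> card I = Suc j \<and>
       (\<forall>i\<in>I. w ! i \<le> (P @ [[]]) ! 0 ! j))"
proof (induction w rule: rev_induct)
  case Nil
  show ?case by (intro exI[of _ "[]"]) (auto simp: fits_def ballot_def)
next
  case (snoc x w)
  define t where "t = length w"
  from snoc obtain P y where P: "length P = t" "semistandard P" "fits P y t" "ballot y t"
    "map snd (pops P y t) = w"
    and incr: "\<And>j. j < length ((P @ [[]]) ! 0) \<Longrightarrow> \<exists>I. increasing_on I w \<and> card I = Suc j \<and>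
       (\<forall>i\<in>I. w ! i \<le> (P @ [[]]) ! 0 ! j)"
    unfolding t_def[symmetric] by blast
  define P0 where "P0 = P @ [[]]"
  obtain P' r where ins: "insert_entry x P0 = (P', r)" by (cases "insert_entry x P0")
  have P0: "semistandard P0" "P0 \<noteq> []" "last P0 = []" "length P0 = Suc t"
    using P by (auto simp: P0_def semistandard_snoc_empty)
  from insert_entry[OF P0(1-3) ins, unfolded P0(4)] obtain e where
    P': "semistandard P'" "length P' = Suc t" "corner P' r"
    "\<And>i. i < Suc t \<Longrightarrow> length (P' ! i) = length (P0 ! i) + (if i = r then 1 else 0)"
    and e: "e < length (P' ! 0)" "P' ! 0 ! e = x"
    "\<And>i. i < length (P' ! 0) \<Longrightarrow> i \<noteq> e \<Longrightarrow> i < length (P0 ! 0) \<and> P' ! 0 ! i = P0 ! 0 ! i"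
    "\<And>i. i < e \<Longrightarrow> P0 ! 0 ! i \<le> x" "e \<le> length (P0 ! 0)" "delete_corner P' r = (P0, e, x)"
    by (elim conjE exE) blast
  define y' where "y' = y(Suc t := r)"
  have yy': "s \<in> {1..t} \<Longrightarrow> y' s = y s" for s by (auto simp: y'_def)
  have rc: "row_count y' (Suc t) i = row_count y t i + (if i = r then 1 else 0)" for i
    using row_count_cong[of t y' y i, OF yy'] by (auto simp: row_count_Suc y'_def)
  have rc_t: "row_count y t i = 0" if "t \<le> i" for i
  proof -
    have "y s < t" if "s \<in> {1..t}" for s using P(1,3) that by (simp add: fits_def)
    then have "{s \<in> {1..t}. y s = i} = {}" using that by (auto dest: leD)
    then show ?thesis unfolding row_count_def by simp
  qed
  have lenP0: "length (P0 ! i) = row_count y t i" if "i < Suc t" for i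
    using P(1,3) rc_t that by (auto simp: P0_def nth_append fits_def less_Suc_eq)
  have r: "r < Suc t" using P'(2,3) by (auto simp: corner_def)
  have fits': "fits P' y' (Suc t)"
    unfolding fits_def
  proof (intro conjI ballI allI impI)
    show "y' s < length P'" if "s \<in> {1..Suc t}" for s
    proof (cases "s = Suc t")
      case True
      then show ?thesis using r P'(2) by (simp add: y'_def)
    next
      case False
      then have "s \<in> {1..t}" using that by auto
      then show ?thesis using yy'[of s] P(1,3) P'(2) by (auto simp: fits_def intro: less_SucI)
    qed
    show "length (P' ! i) = row_count y' (Suc t) i" if "i < length P'" for i
      using that P'(2,4) lenP0 rc by simp
  qed
  have ballot': "ballot y' (Suc t)"
    unfolding ballot_def
  proof (intro allI impI)
    fix t' i assume "t' \<le> Suc t"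
    show "row_count y' t' (Suc i) \<le> row_count y' t' i"
    proof (cases "t' = Suc t")
      case True
      show ?thesis
      proof (cases "Suc i < Suc t")
        case True
        then show ?thesis
          using semistandard_column_strict[OF P'(1), of i] fits' P'(2) \<open>t' = Suc t\<close>
          by (auto simp: fits_def column_strict_def)
      next
        case False
        then have "row_count y' (Suc t) (Suc i) = 0"
          using rc[of "Suc i"] rc_t[of "Suc i"] r by auto
        then show ?thesis using True by simp
      qed
    next
      case False
      then have t': "t' \<le> t" using \<open>t' \<le> Suc t\<close> by simp
      then have "row_count y' t' j = row_count y t' j" for j
        by (intro row_count_cong yy') auto
      then show ?thesis using P(4) t' by (simp add: ballot_def)
    qed
  qed
  have "pops P0 y' t = pops P y t"
    using P(3) pops_pad[OF _ P(2,3,4), of "[[]]"] pops_cong[of t y' y P0, OF yy']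
    by (simp add: P0_def fits_def)
  then have pops': "map snd (pops P' y' (Suc t)) = w @ [x]"
    using e(6) P(5) by (simp add: y'_def)
  have incr': "\<exists>I. increasing_on I (w @ [x]) \<and> card I = Suc j \<and> (\<forall>i\<in>I. (w @ [x]) ! i \<le> P' ! 0 ! j)"
    if j: "j < length (P' ! 0)" for j
  proof (cases "j = e")
    case False
    with e(3)[OF j] incr[of j, folded P0_def] obtain I where
      "increasing_on I w" "card I = Suc j" "\<forall>i\<in>I. w ! i \<le> P' ! 0 ! j" by auto
    then show ?thesis
      by (intro exI[of _ I] conjI increasing_on_append)
        (auto simp: increasing_on_def nth_append)
  next
    case True
    show ?thesis
    proof (cases e)
      case 0
      then show ?thesis
        using True e(2) by (intro exI[of _ "{t}"]) (auto simp: increasing_on_def t_def)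
    next
      case (Suc e')
      with e(5) incr[of e', folded P0_def] obtain I where
        I: "increasing_on I w" "card I = Suc e'" "\<forall>i\<in>I. w ! i \<le> P0 ! 0 ! e'" by auto
      then have le: "w ! i \<le> x" "i < t" if "i \<in> I" for i
        using e(4)[of e'] Suc that by (auto simp: increasing_on_def t_def intro: order.trans)
      have "finite I" "t \<notin> I" using I(1) by (auto simp: increasing_on_def t_def intro: finite_subset)
      then have "card (insert t I) = Suc j" using I(2) True Suc by simp
      moreover have "increasing_on (insert t I) (w @ [x])"
        using I(1) le by (fastforce simp: increasing_on_def nth_append t_def)
      ultimately show ?thesis
        using True e(2) le by (intro exI[of _ "insert t I"]) (auto simp: nth_append t_def)
    qed
  qed
  have "(P' @ [[]]) ! 0 = P' ! 0" using P'(2) by (simp add: nth_append)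
  then show ?case
    using P' fits' ballot' pops' incr' by (intro exI[of _ P'] exI[of _ y']) (auto simp: t_def[symmetric])
qed

section \<open>Standard tableaux as ballot sequences\<close>

text \<open>
  The top row is the last one to be modified.
\<close>

lemma reverse_bump_Cons:
  "reverse_bump (u # P) (Suc r) c x =
     (case reverse_bump P r c x of (P', c', z) \<Rightarrow> reverse_bump (u # P') (Suc 0) c' z)"
proof (induction P r c x rule: reverse_bump.induct)
  case (2 P r c x)
  show ?case
    by (subst reverse_bump.simps(2), subst (2) reverse_bump.simps(2))
      (simp only: Let_def nth_Cons_Suc list_update_code(3) 2[OF refl refl])
qed simp

lemma reverse_bump_eq_delete_corner:
  "r < length P \<Longrightarrow>
     reverse_bump (P[r := butlast (P ! r)]) r (length (P ! r) - 1) (last (P ! r)) = delete_corner P r"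
proof (induction P r rule: delete_corner.induct)
  case (3 u P r)
  obtain P' c z where del: "delete_corner P r = (P', c, z)" by (cases "delete_corner P r")
  have "reverse_bump (P[r := butlast (P ! r)]) r (length (P ! r) - 1) (last (P ! r)) = (P', c, z)"
    using 3 del by simp
  then have "reverse_bump ((u # P)[Suc r := butlast ((u # P) ! Suc r)]) (Suc r)
      (length ((u # P) ! Suc r) - 1) (last ((u # P) ! Suc r)) = reverse_bump (u # P') (Suc 0) c z"
    unfolding nth_Cons_Suc list_update_code(3) by (subst reverse_bump_Cons) simp
  also have "\<dots> =
      (u[unbump_column u z := z] # P', unbump_column u z, u ! unbump_column u z)"
    by (simp add: unbump_column_def Let_def)
  finally show ?case
    by (simp add: del Let_def)
qed auto

lemma crossing_step_eq_delete_corner: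
  assumes "row_of T t < length P" "P ! row_of T t \<noteq> []"
    and "column_of T t = length (P ! row_of T t) - 1"
  shows "crossing_step P T t = delete_corner P (row_of T t)"
  unfolding crossing_step_def Let_def assms(3) reverse_bump_eq_delete_corner[OF assms(1), symmetric]
  by (simp only: butlast_conv_take last_conv_nth[OF assms(2)])

lemma popped_eq_pops:
  assumes "semistandard P" "fits P (row_of T) t" "ballot (row_of T) t"
    and "\<And>s. s < t \<Longrightarrow> column_of T (Suc s) = row_count (row_of T) s (row_of T (Suc s))"
  shows "popped P T t = pops P (row_of T) t"
  using assms
proof (induction P T t rule: popped.induct)
  case (2 P T t)
  let ?y = "row_of T"
  obtain P' c x where del: "delete_corner P (?y (Suc t)) = (P', c, x)"
    by (cases "delete_corner P (?y (Suc t))")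
  note P' = delete_corner_fits[OF 2(2,3,4) del]
  have cor: "corner P (?y (Suc t))" by (rule corner_if_fits[OF 2(3,4)])
  have "column_of T (Suc t) = length (P ! ?y (Suc t)) - 1"
    using 2(3,5) by (auto simp: fits_def row_count_Suc)
  then have "crossing_step P T (Suc t) = (P', c, x)"
    using cor del by (subst crossing_step_eq_delete_corner) (auto simp: corner_def)
  moreover have "popped P' T t = pops P' ?y t"
    using 2(1)[OF calculation[symmetric] refl P'(1,2) ballot_mono[OF 2(4)]] 2(5) by auto
  ultimately show ?case by (simp add: del)
qed simp

lemma less_length_filter_le_iff:
  fixes xs :: "nat list"
  assumes "sorted_wrt (<) xs"
  shows "c < length (filter (\<lambda>x. x \<le> t) xs) \<longleftrightarrow> c < length xs \<and> xs ! c \<le> t"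
  using assms
proof (induction xs arbitrary: c)
  case (Cons x xs)
  show ?case
  proof (cases "x \<le> t")
    case True
    then show ?thesis using Cons by (cases c) auto
  next
    case False
    then have "filter (\<lambda>x. x \<le> t) (x # xs) = []" using Cons(2) by (auto simp: filter_empty_conv)
    moreover have "\<not> (x # xs) ! c \<le> t" if "c < length (x # xs)"
      using Cons(2) False that nth_mem[of c "x # xs"] by auto
    ultimately show ?thesis by (metis length_0_conv not_less_zero)
  qed
qed simp

lemma distinct_concat_unique_row:
  assumes "distinct (concat T)" "i < length T" "j < length T" "t \<in> set (T ! i)" "t \<in> set (T ! j)"
  shows "i = j"
  using assms
proof (induction T arbitrary: i j)
  case (Cons u T)
  then show ?case
    by (cases i; cases j) (auto dest: nth_mem, (meson disjoint_iff nth_mem UN_I)+)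
qed simp

lemma row_of_eqI:
  assumes "distinct (concat T)" "r < length T" "t \<in> set (T ! r)"
  shows "row_of T t = r"
proof -
  have "takeWhile (\<lambda>row. t \<notin> set row) T = take r T"
    using assms distinct_concat_unique_row[OF assms(1) _ assms(2) _ assms(3)]
    by (intro takeWhile_eq_take_P_nth) blast+
  then show ?thesis using assms(2) by (simp add: row_of_def)
qed

context
  fixes n :: nat and T :: "nat tableau"
  assumes T: "standard_tableau n T"
begin

lemma standard_tableau_row_of:
  assumes "t \<in> {1..n}"
  shows "row_of T t < length T" "t \<in> set (T ! row_of T t)"
proof -
  have "t \<in> set (concat T)" using assms T by (simp add: standard_tableau_def)
  then obtain u where "u \<in> set T" "t \<in> set u" by auto
  then obtain r where "r < length T" "t \<in> set (T ! r)" by (metis in_set_conv_nth)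
  moreover from this have "row_of T t = r" using T by (intro row_of_eqI) (auto simp: standard_tableau_def)
  ultimately show "row_of T t < length T" "t \<in> set (T ! row_of T t)" by auto
qed

lemma standard_tableau_row_set:
  assumes "r < length T"
  shows "set (T ! r) = {t \<in> {1..n}. row_of T t = r}"
proof (intro equalityI subsetI)
  fix t assume t: "t \<in> set (T ! r)"
  then have "t \<in> set (concat T)" using assms by auto
  then show "t \<in> {t \<in> {1..n}. row_of T t = r}"
    using T row_of_eqI[of T r t] t assms by (auto simp: standard_tableau_def)
qed (use standard_tableau_row_of in auto)

lemma standard_tableau_row_sorted: "r < length T \<Longrightarrow> sorted_wrt (<) (T ! r)"
  using T by (simp add: standard_tableau_def)

lemma standard_tableau_row_count:
  assumes "r < length T" "t \<le> n"
  shows "row_count (row_of T) t r = length (filter (\<lambda>x. x \<le> t) (T ! r))"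
proof -
  have "distinct (T ! r)"
    using standard_tableau_row_sorted[OF assms(1)] strict_sorted_iff by blast
  then have "length (filter (\<lambda>x. x \<le> t) (T ! r)) = card {x \<in> set (T ! r). x \<le> t}"
    by (simp add: distinct_length_filter Int_def conj_commute)
  also have "{x \<in> set (T ! r). x \<le> t} = {s \<in> {1..t}. row_of T s = r}"
    using assms by (auto simp: standard_tableau_row_set)
  finally show ?thesis by (simp add: row_count_def)
qed

text \<open>
  If row \<open>r + 1\<close> has more entries \<open>\<le> t\<close> than row \<open>r\<close>, the first surplus entry is smaller than the one above
  it.
\<close>

lemma standard_tableau_ballot: "ballot (row_of T) n"
  unfolding ballot_def
proof (intro allI impI)
  fix t r assume t: "t \<le> n"
  show "row_count (row_of T) t (Suc r) \<le> row_count (row_of T) t r"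
  proof (cases "Suc r < length T")
    case True
    let ?f = "filter (\<lambda>x. x \<le> t)"
    have "length (?f (T ! Suc r)) \<le> length (?f (T ! r))"
    proof (rule ccontr)
      define c where "c = length (?f (T ! r))"
      assume "\<not> length (?f (T ! Suc r)) \<le> length (?f (T ! r))"
      then have "c < length (?f (T ! Suc r))" by (simp add: c_def)
      then have c: "c < length (T ! Suc r)" "T ! Suc r ! c \<le> t"
        using less_length_filter_le_iff[OF standard_tableau_row_sorted[OF True]] by auto
      have "T ! r ! c < T ! Suc r ! c" using T True c(1) by (simp add: standard_tableau_def)
      moreover have "length (T ! Suc r) \<le> length (T ! r)"
        using T True sorted_wrt_nth_less[of "(\<ge>)" "shape T" r "Suc r"]
        by (auto simp: standard_tableau_def shape_def)
      ultimately have "c < length (?f (T ! r))"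
        using c True less_length_filter_le_iff[OF standard_tableau_row_sorted[of r]] by auto
      then show False by (simp add: c_def)
    qed
    then show ?thesis using True t by (simp add: standard_tableau_row_count)
  next
    case False
    then have "{s \<in> {1..t}. row_of T s = Suc r} = {}"
      using standard_tableau_row_of(1) t by fastforce
    then show ?thesis unfolding row_count_def by (simp only: card.empty le0)
  qed
qed

lemma standard_tableau_column_of:
  assumes "s < n"
  shows "column_of T (Suc s) = row_count (row_of T) s (row_of T (Suc s))"
proof -
  define r where "r = row_of T (Suc s)"
  have r: "r < length T" "Suc s \<in> set (T ! r)"
    using standard_tableau_row_of[of "Suc s"] assms by (auto simp: r_def)
  note srt = standard_tableau_row_sorted[OF r(1)]
  obtain c where c: "c < length (T ! r)" "T ! r ! c = Suc s" using r(2) by (auto simp: in_set_conv_nth)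
  have "takeWhile (\<lambda>x. x \<noteq> Suc s) (T ! r) = take c (T ! r)"
    using c sorted_wrt_nth_less[OF srt] by (intro takeWhile_eq_take_P_nth) fastforce+
  then have "column_of T (Suc s) = c"
    using c(1) by (simp add: column_of_def flip: r_def)
  moreover have "c = length (filter (\<lambda>x. x \<le> s) (T ! r))"
  proof (rule antisym)
    let ?d = "length (filter (\<lambda>x. x \<le> s) (T ! r))"
    show "?d \<le> c" using less_length_filter_le_iff[OF srt, of c s] c by auto
    show "c \<le> ?d"
    proof (rule ccontr)
      assume "\<not> c \<le> ?d"
      then have "T ! r ! ?d < T ! r ! c" using c(1) sorted_wrt_nth_less[OF srt] by auto
      then show False
        using less_length_filter_le_iff[OF srt, of ?d s] c \<open>\<not> c \<le> ?d\<close> by auto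
    qed
  qed
  ultimately show ?thesis
    using standard_tableau_row_count[OF r(1)] assms by (simp add: r_def)
qed

lemma standard_tableau_fits: "shape P = shape T \<Longrightarrow> fits P (row_of T) n"
proof -
  assume sh: "shape P = shape T"
  then have "length P = length T" by (metis length_map shape_def)
  moreover have "length (P ! r) = row_count (row_of T) n r" if r: "r < length T" for r
  proof -
    have "length (P ! r) = shape P ! r" using r \<open>length P = length T\<close> by (simp add: shape_def)
    also have "\<dots> = length (T ! r)" unfolding sh using r by (simp add: shape_def)
    also have "\<dots> = length (filter (\<lambda>x. x \<le> n) (T ! r))"
      using standard_tableau_row_set[OF r] by (intro arg_cong[of _ _ length] sym[OF filter_True]) auto
    finally show ?thesis using standard_tableau_row_count[OF r] by simp
  qed
  ultimately show ?thesis using standard_tableau_row_of(1) by (auto simp: fits_def)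
qed

lemma standard_tableau_size: "sum_list (shape T) = n"
proof -
  have "length (concat T) = card {1..n}"
    using T by (metis distinct_card standard_tableau_def)
  then show ?thesis by (simp add: shape_def length_concat)
qed

end

definition ballot_tableau :: "(nat \<Rightarrow> nat) \<Rightarrow> nat \<Rightarrow> nat \<Rightarrow> nat tableau" where
  "ballot_tableau y n L = map (\<lambda>r. filter (\<lambda>s. y s = r) [1..<Suc n]) [0..<L]"

text \<open>
  Conversely, the entry in column \<open>c\<close> of row \<open>r\<close> is the \<open>(c + 1)\<close>st position at which \<open>y\<close> takes the value \<open>r\<close>,
  and the ballot condition makes it precede the corresponding position for \<open>r + 1\<close>.
\<close>

lemma ballot_tableau:
  assumes "ballot y n" "\<And>s. s \<in> {1..n} \<Longrightarrow> y s < L" "\<And>r. r < L \<Longrightarrow> 0 < row_count y n r"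
  shows "standard_tableau n (ballot_tableau y n L)"
    "\<And>s. s \<in> {1..n} \<Longrightarrow> row_of (ballot_tableau y n L) s = y s"
    "shape (ballot_tableau y n L) = map (row_count y n) [0..<L]"
proof -
  let ?T = "ballot_tableau y n L"
  have row: "?T ! r = filter (\<lambda>s. y s = r) [1..<Suc n]" if "r < L" for r
    using that by (simp add: ballot_tableau_def)
  have len: "length ?T = L" by (simp add: ballot_tableau_def)
  have srt: "sorted_wrt (<) (filter (\<lambda>s. y s = r) [1..<Suc n])" for r
    by (intro sorted_wrt_filter sorted_wrt_upt)
  have cnt: "length (filter (\<lambda>x. x \<le> t) (?T ! r)) = row_count y t r" if "r < L" "t \<le> n" for r t
  proof -
    have "filter (\<lambda>x. x \<le> t) (?T ! r) = filter (\<lambda>x. x \<le> t \<and> y x = r) [1..<Suc n]"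
      using that by (simp add: row conj_commute)
    then have "length (filter (\<lambda>x. x \<le> t) (?T ! r)) = card ({x. x \<le> t \<and> y x = r} \<inter> {1..<Suc n})"
      by (simp only:) (simp add: distinct_length_filter del: upt_Suc)
    also have "{x. x \<le> t \<and> y x = r} \<inter> {1..<Suc n} = {s \<in> {1..t}. y s = r}" using that by auto
    finally show ?thesis by (simp add: row_count_def)
  qed
  have lenrow: "length (?T ! r) = row_count y n r" if "r < L" for r
  proof -
    have "filter (\<lambda>x. x \<le> n) (?T ! r) = ?T ! r" using that by (intro filter_True) (auto simp: row)
    then show ?thesis using cnt[OF that, of n] by simp
  qed
  show sh: "shape ?T = map (row_count y n) [0..<L]"
    using lenrow len by (intro nth_equalityI) (auto simp: shape_def)
  have dist: "distinct (concat (ballot_tableau y n L))"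
  proof (induction L)
    case (Suc L)
    have "ballot_tableau y n (Suc L) = ballot_tableau y n L @ [filter (\<lambda>s. y s = L) [1..<Suc n]]"
      by (simp add: ballot_tableau_def del: upt_Suc) (simp add: upt_Suc)
    moreover have "y s < L" if "s \<in> set (concat (ballot_tableau y n L))" for s
      using that by (auto simp: ballot_tableau_def simp del: upt_Suc)
    ultimately show ?case using Suc by (auto simp del: upt_Suc)
  qed (simp add: ballot_tableau_def)
  have set: "set (concat ?T) = {1..n}"
    using assms(2) by (auto simp: ballot_tableau_def)
  have cols: "?T ! r ! c < ?T ! Suc r ! c" if r: "Suc r < L" and c: "c < length (?T ! Suc r)" for r c
  proof -
    define t where "t = ?T ! Suc r ! c"
    have "t \<in> set (?T ! Suc r)" using c by (simp add: t_def)
    then have t: "t \<le> n" "y t = Suc r" using r by (auto simp: row)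
    have "c < length (filter (\<lambda>x. x \<le> t) (?T ! Suc r))"
      using less_length_filter_le_iff[OF srt[of "Suc r"], of c t] c r
      by (simp add: row t_def del: upt_Suc)
    also have "\<dots> \<le> length (filter (\<lambda>x. x \<le> t) (?T ! r))"
      using assms(1) r t by (simp add: cnt ballot_def)
    finally have "c < length (?T ! r) \<and> ?T ! r ! c \<le> t"
      using less_length_filter_le_iff[OF srt[of r], of c t] r by (simp add: row del: upt_Suc)
    moreover from this have "?T ! r ! c \<in> set (?T ! r)" by simp
    then have "?T ! r ! c \<noteq> t" using t r by (auto simp: row)
    ultimately show ?thesis by (simp flip: t_def)
  qed
  have "sorted_wrt (\<ge>) (shape ?T)"
    unfolding sh using assms(1)
    by (subst sorted_wrt_iff_nth_Suc_transp) (auto simp: ballot_def transp_def)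
  moreover have "0 \<notin> set (shape ?T)" using assms(3) by (fastforce simp: sh)
  moreover have "\<forall>row\<in>set ?T. sorted_wrt (<) row" using srt by (auto simp: ballot_tableau_def simp del: upt_Suc)
  ultimately show "standard_tableau n ?T"
    using cols dist set unfolding standard_tableau_def len by blast
  show "row_of ?T s = y s" if "s \<in> {1..n}" for s
    using dist assms(2)[OF that] that by (intro row_of_eqI) (auto simp: len row simp del: upt_Suc)
qed

section \<open>Words without long increasing subsequences\<close>

definition words :: "nat \<Rightarrow> nat \<Rightarrow> enat list set" where
  "words m n = {w. mset w = image_mset enat (mset_set {1..m}) + replicate_mset (n - m) \<infinity>}"

definition finite_part :: "enat list \<Rightarrow> nat list" where
  "finite_part u = map the_enat (filter (\<lambda>x. x \<noteq> \<infinity>) u)"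

lemma finite_part_simps [simp]:
  "finite_part [] = []" "finite_part (u @ v) = finite_part u @ finite_part v"
  "finite_part (map enat xs) = xs" "finite_part (replicate k \<infinity>) = []"
  by (auto simp: finite_part_def filter_map o_def)

lemma length_finite_part: "length u = length (finite_part u) + count (mset u) \<infinity>"
  by (induction u) (auto simp: finite_part_def)

lemma sorted_eq_finite_part:
  assumes "sorted u"
  shows "u = map enat (finite_part u) @ replicate (length u - length (finite_part u)) \<infinity>"
  using assms
proof (induction u)
  case (Cons x u)
  show ?case
  proof (cases x)
    case (enat a)
    then show ?thesis using Cons by (simp add: finite_part_def)
  next
    case infinity
    then have "\<forall>y\<in>set u. y = \<infinity>" using Cons(2) by simp
    then show ?thesis using infinity
      by (auto simp: finite_part_def filter_empty_conv intro: replicate_eqI)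
  qed
qed (simp add: finite_part_def)

text \<open>
  Columns are strict and \<open>\<infinity>\<close> is the largest entry, so every column contains it at most once and only at
  its bottom. If the bound is attained, every column ends with \<open>\<infinity>\<close>: each row is as long as the finite part of
  the row above it, and this is how \<open>add_infinities\<close> fills up the rows.
\<close>

lemma semistandard_infinities:
  assumes "semistandard (u # P)"
  shows "count (mset (concat (u # P))) \<infinity> \<le> length u \<and>
    (count (mset (concat (u # P))) \<infinity> = length u \<longrightarrow>
       u # P = add_infinities (length u) (map finite_part (butlast (u # P))) \<and>
       map (length \<circ> finite_part) (butlast (u # P)) = map length P \<and>
       finite_part (last (u # P)) = [])"
  using assms
proof (induction P arbitrary: u)
  case Nil
  then show ?case
    using length_finite_part[of u] sorted_eq_finite_part[of u] by (auto simp: finite_part_def)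
next
  case (Cons v P)
  define k where "k = length (finite_part u)"
  have len: "length u = k + count (mset u) \<infinity>"
    using length_finite_part[of u] by (simp add: k_def)
  have u: "u = map enat (finite_part u) @ replicate (length u - k) \<infinity>"
    using Cons(2) sorted_eq_finite_part[of u] by (simp add: k_def)
  have v: "length v \<le> k"
  proof (rule ccontr)
    assume "\<not> length v \<le> k"
    then have "k < length v" by simp
    then have "k < length u" "u ! k < v ! k" using Cons(2) by (auto simp: column_strict_def)
    moreover from this have "u ! k = \<infinity>" by (subst u) (simp add: nth_append k_def)
    ultimately show False by simp
  qed
  have vP: "semistandard (v # P)" using Cons(2) by simp
  note IH = Cons(1)[OF vP]
  show ?case
  proof (intro conjI impI)
    show "count (mset (concat (u # v # P))) \<infinity> \<le> length u" using conjunct1[OF IH] v len by simp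
    assume "count (mset (concat (u # v # P))) \<infinity> = length u"
    then have lv: "length v = k" "count (mset (concat (v # P))) \<infinity> = length v"
      using conjunct1[OF IH] v len by simp_all
    from mp[OF conjunct2[OF IH] lv(2)]
    have eq: "v # P = add_infinities (length v) (map finite_part (butlast (v # P)))"
      "map (length \<circ> finite_part) (butlast (v # P)) = map length P"
      "finite_part (last (v # P)) = []" by blast+
    have "map enat (finite_part u) @ replicate (length u - length (finite_part u)) \<infinity> = u"
      using u[symmetric] by (simp only: k_def)
    moreover have "add_infinities (length (finite_part u)) (map finite_part (butlast (v # P))) = v # P"
      using eq(1)[symmetric] lv(1) by (simp only: k_def)
    ultimately have "u # v # P = add_infinities (length u) (finite_part u # map finite_part (butlast (v # P)))"
      by (simp only: add_infinities.simps)
    moreover have "butlast (u # v # P) = u # butlast (v # P)" by simp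
    ultimately show "u # v # P = add_infinities (length u) (map finite_part (butlast (u # v # P)))"
      by (simp only: list.map)
    show "map (length \<circ> finite_part) (butlast (u # v # P)) = map length (v # P)"
      using eq(2) lv by (simp add: k_def)
    show "finite_part (last (u # v # P)) = []" using eq(3) by simp
  qed
qed

lemma semistandard_add_infinities:
  assumes "sorted_wrt (\<ge>) (k # shape S)" "\<forall>row\<in>set S. sorted row"
    and "\<And>r c. Suc r < length S \<Longrightarrow> c < length (S ! Suc r) \<Longrightarrow> S ! r ! c < S ! Suc r ! c"
  shows "semistandard (add_infinities k S)"
  using assms
proof (induction k S rule: add_infinities.induct)
  case (2 k row S)
  have "semistandard (add_infinities (length row) S)"
    using 2(2,3) 2(4)[of "Suc _"] by (intro 2(1)) (auto simp: shape_def)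
  moreover have "sorted (map enat row @ replicate (k - length row) \<infinity>)"
    using 2(3) by (auto simp: sorted_append sorted_map)
  moreover have "column_strict (map enat row @ replicate (k - length row) \<infinity>)
      (hd (add_infinities (length row) S))"
  proof (cases S)
    case Nil
    then show ?thesis using 2(2) by (auto simp: column_strict_def nth_append shape_def)
  next
    case (Cons row' S')
    have "row ! c < row' ! c" if "c < length row'" for c
      using 2(4)[of 0 c] that by (simp add: Cons)
    then show ?thesis
      using 2(2) by (auto simp: column_strict_def nth_append shape_def Cons)
  qed
  ultimately show ?case by (simp add: semistandard_Cons_iff)
qed simp

lemma mset_concat_add_infinities:
  assumes "sorted_wrt (\<ge>) (k # shape S)"
  shows "mset (concat (add_infinities k S)) = image_mset enat (mset (concat S)) + replicate_mset k \<infinity>"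
  using assms
proof (induction k S rule: add_infinities.induct)
  case (2 k row S)
  then have "length row \<le> k" by (simp add: shape_def)
  then have "replicate_mset k (\<infinity> :: enat) =
      replicate_mset (k - length row) \<infinity> + replicate_mset (length row) \<infinity>"
    by (intro multiset_eqI) auto
  then show ?case using 2 by (simp add: shape_def)
qed simp

lemma finite_part_add_infinities: "map finite_part (add_infinities k S) = S @ [[]]"
  by (induction k S rule: add_infinities.induct) auto

lemma mset_finite_part_words: "mset u = image_mset enat M + replicate_mset k \<infinity> \<Longrightarrow> mset (finite_part u) = M"
proof -
  assume u: "mset u = image_mset enat M + replicate_mset k \<infinity>"
  have "mset (finite_part u) = image_mset the_enat (filter_mset (\<lambda>x. x \<noteq> \<infinity>) (mset u))"
    by (simp add: finite_part_def)
  also have "\<dots> = M"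
    unfolding u by (simp add: filter_mset_image_mset multiset.map_comp o_def filter_mset_eq_conv)
  finally show ?thesis .
qed

lemma tableau_pairsD:
  assumes "(S, T) \<in> tableau_pairs m n"
  defines "P \<equiv> add_infinities (n - m) S"
  shows "sorted_wrt (\<ge>) ((n - m) # shape S)" "shape P = shape T" "semistandard P"
    "fits P (row_of T) n" "ballot (row_of T) n" "rs_pops m n S T = pops P (row_of T) n"
    "length (P ! 0) = n - m" "mset (concat P) = image_mset enat (mset_set {1..m}) + replicate_mset (n - m) \<infinity>"
    "[] \<notin> set P"
proof -
  have S: "standard_tableau m S" and T: "standard_tableau n T" and "T \<noteq> []" "shape S = tl (shape T)"
    using assms(1) by (auto simp: tableau_pairs_def)
  then obtain k where shT: "shape T = k # shape S" by (cases T) (auto simp: shape_def)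
  then have k: "n - m = k"
    using standard_tableau_size[OF S] standard_tableau_size[OF T] by simp
  show srt: "sorted_wrt (\<ge>) ((n - m) # shape S)"
    using T unfolding k shT[symmetric] by (simp add: standard_tableau_def)
  show sh: "shape P = shape T"
    unfolding P_def using shape_add_infinities[OF srt] by (simp add: shT k)
  show ss: "semistandard P"
    unfolding P_def
    using S by (intro semistandard_add_infinities[OF srt]) (auto simp: standard_tableau_def strict_sorted_iff)
  show f: "fits P (row_of T) n" by (rule standard_tableau_fits[OF T sh])
  show b: "ballot (row_of T) n" by (rule standard_tableau_ballot[OF T])
  show "rs_pops m n S T = pops P (row_of T) n"
    unfolding rs_pops_def P_def[symmetric]
    using standard_tableau_column_of[OF T] by (intro popped_eq_pops[OF ss f b])
  have "P \<noteq> []" unfolding P_def by (cases S) auto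
  then show "length (P ! 0) = n - m"
    using sh shT k by (cases P) (auto simp: shape_def)
  have "mset (concat S) = mset_set {1..m}"
    using S by (metis mset_set_set standard_tableau_def)
  then show "mset (concat P) = image_mset enat (mset_set {1..m}) + replicate_mset (n - m) \<infinity>"
    unfolding P_def using mset_concat_add_infinities[OF srt] by simp
  have "0 \<notin> set (shape P)" using T by (simp add: sh standard_tableau_def)
  then show "[] \<notin> set P" by (force simp: shape_def)
qed

lemma rs_word_in_words: "(S, T) \<in> tableau_pairs m n \<Longrightarrow> rs_word m n S T \<in> words m n"
  using mset_pops[OF tableau_pairsD(3,4,5)] tableau_pairsD(8)
  by (simp add: words_def rs_word_def tableau_pairsD(6))

lemma append_replicate_Nil_eqD:
  assumes "P @ replicate k [] = Q @ replicate l []" "[] \<notin> set P" "[] \<notin> set Q"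
  shows "P = Q"
proof -
  have "filter (\<lambda>u. u \<noteq> []) (P @ replicate k []) = filter (\<lambda>u. u \<noteq> []) (Q @ replicate l [])"
    using assms(1) by simp
  moreover have "filter (\<lambda>u. u \<noteq> []) P = P" "filter (\<lambda>u. u \<noteq> []) Q = Q"
    using assms by (auto intro!: filter_True)
  ultimately show ?thesis by simp
qed

lemma rs_word_inject:
  assumes "(S, T) \<in> tableau_pairs m n" "(S', T') \<in> tableau_pairs m n"
    and "rs_word m n S T = rs_word m n S' T'"
  shows "S = S'" "T = T'"
proof -
  note D = tableau_pairsD[OF assms(1)]
  note D' = tableau_pairsD[OF assms(2)]
  from pops_inject[OF D(3-5) D'(3-5)] assms(3)
  have y: "\<forall>s\<in>{1..n}. row_of T s = row_of T' s"
    and "add_infinities (n - m) S = add_infinities (n - m) S'"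
    using append_replicate_Nil_eqD[OF _ D(9) D'(9)] by (auto simp: rs_word_def D(6) D'(6))
  then have "map finite_part (add_infinities (n - m) S) = map finite_part (add_infinities (n - m) S')"
    and sh: "shape T = shape T'" using D(2) D'(2) by auto
  then show "S = S'" by (simp add: finite_part_add_infinities)
  have T: "standard_tableau n T" "standard_tableau n T'"
    using assms(1,2) by (auto simp: tableau_pairs_def)
  have len: "length T = length T'" using sh by (metis length_map shape_def)
  show "T = T'"
  proof (rule nth_equalityI[OF len])
    fix r assume r: "r < length T"
    have "set (T ! r) = set (T' ! r)"
      using r len y by (auto simp: standard_tableau_row_set[OF T(1)] standard_tableau_row_set[OF T(2)])
    then show "T ! r = T' ! r"
      using T r len by (intro strict_sorted_equal) (auto simp: standard_tableau_row_sorted)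
  qed
qed

lemma semistandard_appendD: "semistandard (P @ R) \<Longrightarrow> semistandard P"
  by (induction P rule: semistandard.induct) (auto simp: semistandard_Cons_iff)

text \<open>
  The insertion tableau of \<open>w\<close> has a first row with at most \<open>n - m\<close> cells, by Schensted, and contains
  \<open>n - m\<close> letters \<open>\<infinity>\<close>. Hence all its columns end with \<open>\<infinity>\<close>, and removing these letters leaves \<open>S\<close>.
\<close>

lemma rs_word_surject:
  assumes "0 < m" "m \<le> n" "w \<in> words m n"
    and "\<And>I. increasing_on I w \<Longrightarrow> card I \<le> n - m"
  obtains S T where "(S, T) \<in> tableau_pairs m n" "rs_word m n S T = w"
proof -
  have mset: "mset w = image_mset enat (mset_set {1..m}) + replicate_mset (n - m) \<infinity>"
    using assms(3) by (simp add: words_def)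
  have "size (mset w) = n" using assms(2) by (simp add: mset)
  then have len: "length w = n" by simp
  obtain P y where P: "length P = n" "semistandard P" "fits P y n" "ballot y n" "map snd (pops P y n) = w"
    and incr: "\<And>j. j < length ((P @ [[]]) ! 0) \<Longrightarrow> \<exists>I. increasing_on I w \<and> card I = Suc j"
    using pops_surject[of w] unfolding len by blast
  define k where "k = length (P ! 0)"
  have "P \<noteq> []" using P(1) assms by auto
  have k: "k \<le> n - m"
  proof (cases k)
    case (Suc j)
    then have "j < length ((P @ [[]]) ! 0)" using \<open>P \<noteq> []\<close> by (simp add: k_def nth_append)
    with incr[of j] obtain I where "increasing_on I w" "card I = Suc j" by blast
    then show ?thesis using assms(4)[of I] Suc by simp
  qed simp
  define Q where "Q = takeWhile (\<lambda>u. u \<noteq> []) P"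
  define L where "L = length Q"
  obtain R where PQ: "P = Q @ R" by (metis takeWhile_dropWhile_id Q_def)
  have lenP: "length (P ! r) = row_count y n r" if "r < n" for r
    using P(1,3) that by (simp add: fits_def)
  have ssQ: "semistandard Q" using P(2) PQ semistandard_appendD by blast
  have LQ: "L \<le> n" using P(1) PQ by (simp add: L_def)
  have pos: "0 < row_count y n r" if "r < L" for r
  proof -
    have "Q ! r \<noteq> []" using that nth_mem[of r Q] set_takeWhileD[of _ "\<lambda>u. u \<noteq> []" P]
      by (auto simp: L_def Q_def)
    moreover have "length (Q ! r) = row_count y n r"
      using lenP[of r] that LQ by (simp add: PQ nth_append L_def)
    ultimately show ?thesis by (metis length_greater_0_conv)
  qed
  have antimono: "row_count y n s \<le> row_count y n r" if "r \<le> s" for r s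
    using that P(4) by (induction rule: dec_induct) (auto simp: ballot_def intro: order.trans)
  have yL: "y s < L" if "s \<in> {1..n}" for s
  proof (rule ccontr)
    assume "\<not> y s < L"
    moreover have "0 < row_count y n (y s)" using that by (auto simp: row_count_def card_gt_0_iff)
    ultimately have "0 < row_count y n L" using antimono[of L "y s"] by simp
    moreover have "y s < n" using P(1,3) that by (auto simp: fits_def)
    ultimately have "L < n" "P ! L \<noteq> []" using \<open>\<not> y s < L\<close> lenP[of L] by auto
    then show False
      using nth_length_takeWhile[of "\<lambda>u. u \<noteq> []" P] P(1) by (simp add: L_def Q_def)
  qed
  have fitsQ: "fits Q y n"
    unfolding fits_def
  proof (intro conjI ballI allI impI)
    show "y s < length Q" if "s \<in> {1..n}" for s using yL[OF that] by (simp add: L_def)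
    show "length (Q ! r) = row_count y n r" if "r < length Q" for r
      using lenP[of r] that LQ by (simp add: PQ nth_append L_def)
  qed
  have popsQ: "map snd (pops Q y n) = w"
    using P(5) pops_pad[OF _ ssQ fitsQ P(4), of R] yL by (simp add: PQ L_def)
  have msetQ: "mset (concat Q) = mset w"
    using mset_pops[OF ssQ fitsQ P(4)] popsQ by simp
  have "0 < L" using yL[of 1] assms by auto
  then obtain u U where Q: "Q = u # U" by (cases Q) (auto simp: L_def)
  have "length u = k" using PQ Q by (simp add: k_def)
  moreover have cnt: "count (mset (concat Q)) \<infinity> = n - m"
    unfolding msetQ mset by (simp add: count_eq_zero_iff image_iff)
  ultimately have lu: "length u = n - m"
    using k semistandard_infinities[of u U] ssQ Q by simp
  define S where "S = map finite_part (butlast Q)"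
  define T where "T = ballot_tableau y n L"
  have S: "Q = add_infinities (n - m) S" "map (length \<circ> finite_part) (butlast Q) = map length U"
    "finite_part (last Q) = []"
    using mp[OF conjunct2[OF semistandard_infinities[OF ssQ[unfolded Q]]] trans[OF cnt[unfolded Q] lu[symmetric]]]
    unfolding Q S_def lu by blast+
  note T = ballot_tableau[OF P(4) yL pos, folded T_def]
  have lenQ: "length (Q ! r) = row_count y n r" if "r < length Q" for r
    using fitsQ that by (simp add: fits_def)
  have "map (row_count y n) [0..<L] = shape Q"
    by (intro nth_equalityI) (simp_all add: shape_def L_def lenQ)
  then have shT: "shape T = shape Q" using T(3) by simp
  have shS: "shape S = tl (shape T)" using S(2) shT by (simp add: shape_def S_def Q)
  have stS: "standard_tableau m S"
  proof -
    have shT': "sorted_wrt (\<ge>) (shape T)" "0 \<notin> set (shape T)" using T(1) by (auto simp: standard_tableau_def)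
    have "shape T = k # shape S" using shS shT \<open>length u = k\<close> by (simp add: Q shape_def)
    then have shS': "sorted_wrt (\<ge>) (shape S)" "0 \<notin> set (shape S)" using shT' by auto
    have "concat S = finite_part (concat Q)"
    proof -
      have "concat (map finite_part X) = finite_part (concat X)" for X
        by (induction X) auto
      moreover have "finite_part (concat Q) = finite_part (concat (butlast Q @ [last Q]))"
        using Q by (metis append_butlast_last_id list.distinct(1))
      ultimately show ?thesis using S(3) by (simp add: S_def)
    qed
    then have msetS: "mset (concat S) = mset_set {1..m}"
      using mset_finite_part_words[OF mset[folded msetQ]] by simp
    then have conc: "distinct (concat S)" "set (concat S) = {1..m}"
      using mset_eq_imp_distinct_iff[of "concat S" "sorted_list_of_set {1..m}"]
        mset_eq_setD[of "concat S" "sorted_list_of_set {1..m}"]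
        mset_set_set[of "sorted_list_of_set {1..m}"] by simp_all
    have row: "S ! r = finite_part (Q ! r)" "r < length Q" if "r < length S" for r
      using that by (auto simp: S_def nth_butlast)
    have srtQ: "sorted (Q ! r)" if "r < length Q" for r
      using ssQ that by (induction Q arbitrary: r) (auto simp: semistandard_Cons_iff nth_Cons split: nat.splits)
    have ent: "c < length (Q ! r) \<and> Q ! r ! c = enat (S ! r ! c)" if "r < length S" "c < length (S ! r)" for r c
    proof -
      have "Q ! r = map enat (S ! r) @ replicate (length (Q ! r) - length (S ! r)) \<infinity>"
        using sorted_eq_finite_part[OF srtQ] row that by metis
      then show ?thesis using that by (metis length_append length_map nth_append nth_map trans_less_add1)
    qed
    have "sorted_wrt (<) (S ! r)" if r: "r < length S" for r
    proof -
      have "sorted (S ! r)"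
      proof -
        have "sorted (map enat (S ! r))"
          using sorted_eq_finite_part[OF srtQ[OF row(2)[OF r]]] srtQ[OF row(2)[OF r]] row(1)[OF r]
          by (metis sorted_append)
        then show ?thesis by (simp add: sorted_map)
      qed
      moreover have "distinct (S ! r)"
        using conc(1) r by (metis distinct_concat_iff nth_mem)
      ultimately show ?thesis by (simp add: strict_sorted_iff)
    qed
    moreover have "S ! r ! c < S ! Suc r ! c" if r: "Suc r < length S" and c: "c < length (S ! Suc r)" for r c
    proof -
      have "length (S ! Suc r) \<le> length (S ! r)"
        using shS'(1) r sorted_wrt_nth_less[of "(\<ge>)" "shape S" r "Suc r"] by (simp add: shape_def)
      moreover have "column_strict (Q ! r) (Q ! Suc r)"
        using semistandard_column_strict[OF ssQ] row(2)[OF r] by simp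
      ultimately show ?thesis
        using ent[of r c] ent[of "Suc r" c] r c by (auto simp: column_strict_def)
    qed
    ultimately show ?thesis
      using shS' conc by (auto simp: standard_tableau_def in_set_conv_nth)
  qed
  have "T \<noteq> []" using shT Q by (auto simp: shape_def)
  then have pair: "(S, T) \<in> tableau_pairs m n"
    using stS T(1) shS by (simp add: tableau_pairs_def)
  moreover have "rs_word m n S T = w"
    using tableau_pairsD(6)[OF pair] pops_cong[of n "row_of T" y Q, OF T(2)] popsQ
    by (simp add: rs_word_def S(1)[symmetric])
  ultimately show ?thesis by (rule that)
qed

section \<open>Top dimensional faces and coboundaries\<close>

abbreviation coeff :: "('a \<Rightarrow>\<^sub>0 int) \<Rightarrow> 'a \<Rightarrow> int" where
  "coeff \<equiv> Poly_Mapping.lookup"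

abbreviation support :: "('a \<Rightarrow>\<^sub>0 int) \<Rightarrow> 'a set" where
  "support \<equiv> Poly_Mapping.keys"

text \<open>
  If \<open>A\<close> is finite, these are the faces of dimension \<open>card A - 1\<close>. They are the injective placements of
  the letters \<open>A\<close> in the positions \<open>B\<close>.
\<close>

definition full_faces :: "nat set \<Rightarrow> nat set \<Rightarrow> vertex set set" where
  "full_faces A B = {F \<in> chessboard A B. fst ` F = A}"

lemma chessboardD:
  assumes "F \<in> chessboard A B"
  shows "F \<subseteq> A \<times> B" "inj_on fst F" "inj_on snd F"
  using assms by (auto simp: chessboard_def inj_on_def)

lemma chessboardI: "F \<subseteq> A \<times> B \<Longrightarrow> inj_on fst F \<Longrightarrow> inj_on snd F \<Longrightarrow> F \<in> chessboard A B"
  unfolding chessboard_def inj_on_def by blast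

lemma finite_chessboard: "finite A \<Longrightarrow> finite B \<Longrightarrow> finite (chessboard A B)"
  by (rule finite_subset[of _ "Pow (A \<times> B)"]) (auto simp: chessboard_def)

lemma finite_full_faces: "finite A \<Longrightarrow> finite B \<Longrightarrow> finite (full_faces A B)"
  unfolding full_faces_def by (rule finite_subset[OF _ finite_chessboard[of A B]]) auto

lemma full_faces_card: "F \<in> full_faces A B \<Longrightarrow> card F = card A"
  using card_image[OF chessboardD(2), of F A B] by (auto simp: full_faces_def)

lemma chessboard_card:
  assumes "F \<in> chessboard A B" "finite A" "finite B"
  shows "finite F" "card F \<le> card A" "card F = card A \<longleftrightarrow> F \<in> full_faces A B"
proof -
  note F = chessboardD[OF assms(1)]
  show "finite F" using F(1) assms finite_subset by blast
  have sub: "fst ` F \<subseteq> A" using F(1) by auto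
  have c: "card (fst ` F) = card F" by (rule card_image[OF F(2)])
  show "card F \<le> card A" using card_mono[OF assms(2) sub] c by simp
  show "card F = card A \<longleftrightarrow> F \<in> full_faces A B"
    using card_subset_eq[OF assms(2) sub] c assms(1) by (auto simp: full_faces_def)
qed

lemma full_faces_Un:
  assumes "F \<in> full_faces A B" "G \<in> full_faces A' B'" "A \<inter> A' = {}" "B \<inter> B' = {}"
  shows "F \<union> G \<in> full_faces (A \<union> A') (B \<union> B')"
proof -
  have *: "F \<in> chessboard A B" "G \<in> chessboard A' B'" "fst ` F = A" "fst ` G = A'"
    using assms by (auto simp: full_faces_def)
  note F = chessboardD[OF *(1)] and G = chessboardD[OF *(2)]
  have fst: "fst ` F \<inter> fst ` G = {}" using * assms(3) by simp
  have snd: "snd ` F \<inter> snd ` G = {}" using F(1) G(1) assms(4) by fastforce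
  have "inj_on fst (F \<union> G)" "inj_on snd (F \<union> G)"
    unfolding inj_on_Un using F G fst snd by blast+
  moreover have "F \<union> G \<subseteq> (A \<union> A') \<times> (B \<union> B')" using F(1) G(1) by blast
  ultimately show ?thesis
    using *(3,4) by (simp add: full_faces_def image_Un chessboardI)
qed

lemma full_faces_mono: "B \<subseteq> B' \<Longrightarrow> full_faces A B \<subseteq> full_faces A B'"
  by (auto simp: full_faces_def chessboard_def)

lemma singleton_full_faces: "{(a, j)} \<in> full_faces {a} {j}"
  by (auto simp: full_faces_def chessboard_def)

lemma full_faces_insert:
  assumes "F \<in> full_faces A B" "a \<notin> A" "j \<notin> B"
  shows "insert (a, j) F \<in> full_faces (insert a A) (insert j B)"
  using full_faces_Un[OF singleton_full_faces assms(1), of a j] assms by simp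

lemma full_faces_snd: "F \<in> full_faces A B \<Longrightarrow> F \<in> full_faces A (snd ` F)"
  unfolding full_faces_def chessboard_def by force

lemma full_faces_remove:
  assumes "F \<in> full_faces A B" "(a, j) \<in> F"
  shows "F - {(a, j)} \<in> full_faces (A - {a}) (B - {j})"
proof -
  note F = chessboardD[of F A B]
  have *: "F \<in> chessboard A B" "fst ` F = A" using assms by (auto simp: full_faces_def)
  have "fst ` (F - {(a, j)}) = A - {a}"
    using inj_on_image_set_diff[OF F(2), of F "{(a, j)}"] * assms(2) by auto
  moreover have "F - {(a, j)} \<subseteq> (A - {a}) \<times> (B - {j})"
    using F[OF *(1)] assms(2) by (fastforce simp: inj_on_def)
  ultimately show ?thesis
    using F[OF *(1)] by (auto simp: full_faces_def intro!: chessboardI elim: inj_on_subset)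
qed

lemma lookup_boundary_frag_of:
  "coeff (boundary (frag_of F)) G =
     (\<Sum>v\<in>F. (-1) ^ card {u \<in> F. vless u v} * (if F - {v} = G then 1 else 0))"
  by (auto simp: boundary_def lookup_sum lookup_frag_of intro!: sum.cong)

text \<open>
  Edges are ordered by their left vertices first, and every element of \<open>X\<close> is a left vertex of \<open>F\<close>. So the
  sign with which the edge of \<open>a\<close> is removed is the same for all these faces. This is why signs disappear from
  the description of cycles and coboundaries in the top dimension.
\<close>

lemma lookup_boundary_full_face:
  assumes "finite X" "F \<in> full_faces X Y" "a \<in> X" "fst ` G = X - {a}"
  shows "coeff (boundary (frag_of F)) G =
     (if \<exists>j. F = insert (a, j) G then (-1) ^ card {b \<in> X. b < a} else 0)"
proof -
  have F: "F \<subseteq> X \<times> Y" "inj_on fst F" "fst ` F = X"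
    using assms(2) chessboardD[of F X Y] by (auto simp: full_faces_def)
  have finF: "finite F" using F(2,3) assms(1) finite_imageD by blast
  have vertex: "\<exists>j. v = (a, j) \<and> F = insert (a, j) G" if v: "v \<in> F" "F - {v} = G" for v
  proof -
    have "fst ` G = X - {fst v}"
      using inj_on_image_set_diff[OF F(2), of F "{v}"] v F(3) by auto
    moreover have "fst v \<in> X" using v F by auto
    ultimately have "fst v = a" using assms(3,4) by blast
    then show ?thesis using v by (cases v) auto
  qed
  show ?thesis
  proof (cases "\<exists>j. F = insert (a, j) G")
    case True
    then obtain j where j: "F = insert (a, j) G" by blast
    have G: "(a, j) \<notin> G" using assms(4) by force
    have sgn: "card {u \<in> F. vless u (a, j)} = card {b \<in> X. b < a}"
    proof -
      have "{u \<in> F. vless u (a, j)} = {u \<in> F. fst u < a}"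
        using F(2) j by (auto simp: vless_def inj_on_def)
      moreover have "fst ` {u \<in> F. fst u < a} = {b \<in> X. b < a}" using F(3) by auto
      ultimately show ?thesis
        using card_image[OF inj_on_subset[OF F(2), of "{u \<in> F. fst u < a}"]] by simp
    qed
    have "coeff (boundary (frag_of F)) G =
        (\<Sum>v\<in>{(a, j)}. (-1) ^ card {u \<in> F. vless u v} * (if F - {v} = G then 1 else 0))"
      unfolding lookup_boundary_frag_of
    proof (intro sum.mono_neutral_right finF ballI)
      fix v assume v: "v \<in> F - {(a, j)}"
      have "F - {v} \<noteq> G" using v vertex[of v] j G by auto
      then show "(-1) ^ card {u \<in> F. vless u v} * (if F - {v} = G then 1 else 0) = (0::int)" by simp
    qed (use j in auto)
    also have "F - {(a, j)} = G" using j G by auto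
    ultimately show ?thesis using True sgn by simp
  next
    case False
    then have "F - {v} \<noteq> G" if "v \<in> F" for v using vertex[OF that] by blast
    then show ?thesis using False by (auto simp: lookup_boundary_frag_of intro!: sum.neutral)
  qed
qed

lemma pairing_frag_of: "pairing (frag_of G) d = coeff d G"
  by (simp add: pairing_def)

lemma pairing_add: "pairing (c + d) e = pairing c e + pairing d e"
proof -
  let ?A = "support e"
  have "pairing x e = (\<Sum>F\<in>?A. coeff x F * coeff e F)" for x
    by (intro pairing_superset) auto
  then show ?thesis by (simp add: lookup_add ring_distribs sum.distrib)
qed

lemma pairing_cmul: "pairing (frag_cmul k c) e = k * pairing c e"
proof -
  let ?A = "support e"
  have "pairing x e = (\<Sum>F\<in>?A. coeff x F * coeff e F)" for x
    by (intro pairing_superset) auto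
  then show ?thesis by (simp add: sum_distrib_left mult.assoc)
qed

lemma coboundary_add: "coboundary K (c + d) = coboundary K c + coboundary K d"
  by (simp add: coboundary_def pairing_add frag_cmul_distrib sum.distrib)

lemma coboundary_cmul: "coboundary K (frag_cmul k c) = frag_cmul k (coboundary K c)"
  by (simp add: coboundary_def pairing_cmul frag_cmul_sum)

lemma coboundaries_iff:
  "c \<in> coboundaries K p \<longleftrightarrow>
     (\<exists>b. support b \<subseteq> {F \<in> K. finite F \<and> int (card F) = p} \<and> c = coboundary K b)"
  by (simp only: coboundaries_def chain_group_def image_iff Bex_def
      carrier_free_Abelian_group_iff diff_add_cancel)

lemma coboundaries_add:
  assumes "c \<in> coboundaries K p" "d \<in> coboundaries K p"
  shows "c + d \<in> coboundaries K p"
proof -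
  let ?S = "{F \<in> K. finite F \<and> int (card F) = p}"
  obtain b b' where b: "support b \<subseteq> ?S" "support b' \<subseteq> ?S"
    "c = coboundary K b" "d = coboundary K b'"
    using assms unfolding coboundaries_iff by blast
  have "support (b + b') \<subseteq> ?S" using keys_add[of b b'] b(1,2) by blast
  then show ?thesis unfolding coboundaries_iff b(3,4) coboundary_add[symmetric] by blast
qed

lemma coboundaries_cmul:
  assumes "c \<in> coboundaries K p"
  shows "frag_cmul k c \<in> coboundaries K p"
proof -
  let ?S = "{F \<in> K. finite F \<and> int (card F) = p}"
  obtain b where b: "support b \<subseteq> ?S" "c = coboundary K b"
    using assms unfolding coboundaries_iff by blast
  have "support (frag_cmul k b) \<subseteq> ?S" using keys_cmul[of k b] b(1) by blast
  then show ?thesis unfolding coboundaries_iff b(2) coboundary_cmul[symmetric] by blast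
qed

lemma coboundaries_0: "0 \<in> coboundaries K p"
  unfolding coboundaries_def chain_group_def
  by (rule image_eqI[of _ _ 0]) (auto simp: coboundary_def pairing_def)

lemma coboundaries_diff:
  "c \<in> coboundaries K p \<Longrightarrow> d \<in> coboundaries K p \<Longrightarrow> c - d \<in> coboundaries K p"
  using coboundaries_add[of c K p "frag_cmul (-1) d"] coboundaries_cmul[of d K p "-1"] by simp

lemma coboundaries_sum: "(\<And>i. i \<in> I \<Longrightarrow> f i \<in> coboundaries K p) \<Longrightarrow> sum f I \<in> coboundaries K p"
  by (induction I rule: infinite_finite_induct) (auto intro: coboundaries_0 coboundaries_add)

text \<open>
  Up to a sign that depends on \<open>a\<close> only, the sum is the coboundary of \<open>G\<close>.
\<close>

lemma one_letter_sum_coboundary: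
  assumes "finite X" "finite Y" "a \<in> X" "G \<in> full_faces (X - {a}) Y"
  shows "(\<Sum>j\<in>Y - snd ` G. frag_of (insert (a, j) G)) \<in>
    coboundaries (chessboard X Y) (int (card X) - 1)"
proof -
  let ?K = "chessboard X Y"
  define s :: int where "s = (-1) ^ card {b \<in> X. b < a}"
  have G: "fst ` G = X - {a}" "G \<subseteq> (X - {a}) \<times> Y" "inj_on fst G" "inj_on snd G"
    using assms(4) chessboardD[of G "X - {a}" Y] by (auto simp: full_faces_def)
  have finG: "finite G" using finite_subset[OF G(2)] assms by auto
  let ?f = "\<lambda>j. insert (a, j) G"
  have inj: "inj_on ?f (Y - snd ` G)"
  proof (rule inj_onI)
    fix i j assume "?f i = ?f j"
    then have "(a, i) \<in> ?f j" by blast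
    then show "i = j" using G(2) by auto
  qed
  have "snd ` G \<subseteq> Y" using G(2) by auto
  have ins: "?f j \<in> full_faces X Y" if j: "j \<in> Y - snd ` G" for j
  proof -
    have "?f j \<in> full_faces (insert a (X - {a})) (insert j (snd ` G))"
      using j by (intro full_faces_insert full_faces_snd[OF assms(4)]) auto
    moreover have "insert j (snd ` G) \<subseteq> Y" using j \<open>snd ` G \<subseteq> Y\<close> by auto
    ultimately show ?thesis
      using full_faces_mono assms(3) by (metis insert_Diff subsetD)
  qed
  have "coboundary ?K (frag_of G) =
      (\<Sum>F\<in>?K. frag_cmul (coeff (boundary (frag_of F)) G) (frag_of F))"
    by (simp add: coboundary_def pairing_frag_of)
  also have "\<dots> = (\<Sum>F\<in>?f ` (Y - snd ` G). frag_cmul (coeff (boundary (frag_of F)) G) (frag_of F))"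
  proof (intro sum.mono_neutral_right finite_chessboard assms ballI)
    show "?f ` (Y - snd ` G) \<subseteq> ?K" using ins by (auto simp: full_faces_def)
    fix F assume F: "F \<in> ?K - ?f ` (Y - snd ` G)"
    have "F - {v} \<noteq> G" if v: "v \<in> F" for v
    proof
      assume "F - {v} = G"
      then have Fv: "F = insert v G" "v \<notin> G" using v by auto
      note F' = chessboardD[of F X Y]
      have "fst v \<notin> fst ` G" "snd v \<notin> snd ` G" "v \<in> X \<times> Y"
        using F F' Fv by (auto simp: inj_on_def image_iff)
      then have "v = (a, snd v)" "snd v \<in> Y - snd ` G"
        using G(1) by (cases v; auto)+
      then have "F = ?f (snd v)" using Fv(1) by metis
      then show False using F \<open>snd v \<in> Y - snd ` G\<close> by blast
    qed
    then have "coeff (boundary (frag_of F)) G = 0"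
      by (auto simp: lookup_boundary_frag_of intro!: sum.neutral)
    then show "frag_cmul (coeff (boundary (frag_of F)) G) (frag_of F) = 0" by simp
  qed
  also have "\<dots> = (\<Sum>j\<in>Y - snd ` G. frag_cmul s (frag_of (?f j)))"
    using lookup_boundary_full_face[OF assms(1) ins assms(3) G(1)]
    by (subst sum.reindex[OF inj]) (auto simp: s_def intro!: sum.cong)
  finally have "frag_cmul s (coboundary ?K (frag_of G)) = (\<Sum>j\<in>Y - snd ` G. frag_of (?f j))"
    by (simp add: frag_cmul_sum s_def flip: power_add mult_2)
  moreover have "coboundary ?K (frag_of G) \<in> coboundaries ?K (int (card X) - 1)"
  proof -
    have "card G = card X - 1" using full_faces_card[OF assms(4)] assms by simp
    moreover have "0 < card X" using assms by (auto simp: card_gt_0_iff)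
    moreover have "G \<in> ?K" using G by (intro chessboardI) auto
    ultimately have "frag_of G \<in> carrier (chain_group ?K (int (card X) - 1 - 1))"
      using finG by (simp add: chain_group_def)
    then show ?thesis by (simp add: coboundaries_def)
  qed
  ultimately show ?thesis using coboundaries_cmul by metis
qed

section \<open>Sums over the placements of a set of letters\<close>

lemma sum_full_faces_split:
  fixes g :: "vertex set \<Rightarrow> 'b::comm_monoid_add"
  assumes "finite A" "finite B" "a \<in> A"
  shows "(\<Sum>H\<in>full_faces A B. g H) =
    (\<Sum>H\<in>full_faces (A - {a}) B. \<Sum>j\<in>B - snd ` H. g (insert (a, j) H))"
proof -
  have fin: "finite (full_faces (A - {a}) B)" using assms by (intro finite_full_faces) auto
  have "(\<Sum>H\<in>full_faces (A - {a}) B. \<Sum>j\<in>B - snd ` H. g (insert (a, j) H)) =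
      (\<Sum>(H, j)\<in>Sigma (full_faces (A - {a}) B) (\<lambda>H. B - snd ` H). g (insert (a, j) H))"
    using fin assms by (intro sum.Sigma) auto
  also have "\<dots> = (\<Sum>H\<in>full_faces A B. g H)"
  proof (rule sum.reindex_bij_witness[where
        j = "\<lambda>(H, j). insert (a, j) H" and
        i = "\<lambda>H. (H - {(a, THE j. (a, j) \<in> H)}, THE j. (a, j) \<in> H)"])
    fix H assume H: "H \<in> full_faces A B"
    then have *: "inj_on fst H" "fst ` H = A" "H \<subseteq> A \<times> B"
      using chessboardD[of H A B] by (auto simp: full_faces_def)
    obtain j where j: "(a, j) \<in> H" using *(2) assms(3) by force
    have the: "(THE j. (a, j) \<in> H) = j"
      using j inj_onD[OF *(1)] by (intro the_equality) fastforce+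
    have "H - {(a, j)} \<in> full_faces (A - {a}) (B - {j})" by (rule full_faces_remove[OF H j])
    then show "(H - {(a, THE j. (a, j) \<in> H)}, THE j. (a, j) \<in> H)
        \<in> Sigma (full_faces (A - {a}) B) (\<lambda>H. B - snd ` H)"
      using full_faces_mono[of "B - {j}" B "A - {a}"] j *(3)
        chessboardD(1)[of "H - {(a, j)}" "A - {a}" "B - {j}"]
      unfolding the by (auto simp: full_faces_def)
    show "(case (H - {(a, THE j. (a, j) \<in> H)}, THE j. (a, j) \<in> H) of (H, j) \<Rightarrow> insert (a, j) H) = H"
      unfolding the using j by auto
  next
    fix p assume "p \<in> Sigma (full_faces (A - {a}) B) (\<lambda>H. B - snd ` H)"
    then obtain H j where p: "p = (H, j)" "H \<in> full_faces (A - {a}) B" "j \<in> B" "j \<notin> snd ` H"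
      by auto
    have H: "H \<subseteq> (A - {a}) \<times> B" using p(2) chessboardD(1) by (auto simp: full_faces_def)
    have the: "(THE i. (a, i) \<in> insert (a, j) H) = j" using H by auto
    show "(\<lambda>H. (H - {(a, THE j. (a, j) \<in> H)}, THE j. (a, j) \<in> H)) (case p of (H, j) \<Rightarrow> insert (a, j) H) = p"
      unfolding p(1) prod.case the using H by auto
    have "insert (a, j) H \<in> full_faces A (insert j (snd ` H))"
      using full_faces_insert[OF full_faces_snd[OF p(2)], of a j] p(4) assms(3)
      by (auto simp: insert_absorb)
    moreover have "insert j (snd ` H) \<subseteq> B" using p(3) H by auto
    ultimately show "(case p of (H, j) \<Rightarrow> insert (a, j) H) \<in> full_faces A B"
      unfolding p(1) prod.case by (rule subsetD[OF full_faces_mono, rotated])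
    show "g (case p of (H, j) \<Rightarrow> insert (a, j) H) = (case p of (H, j) \<Rightarrow> g (insert (a, j) H))"
      by (simp add: p)
  qed
  finally show ?thesis by simp
qed

text \<open>
  A placement in \<open>B\<close> either avoids the position \<open>e\<close> or puts exactly one letter \<open>a\<close> there.
\<close>

lemma sum_full_faces_avoid:
  fixes g :: "vertex set \<Rightarrow> 'b::comm_monoid_add"
  assumes "finite A" "finite B" "e \<in> B"
  shows "(\<Sum>H\<in>full_faces A B. g H) = (\<Sum>H\<in>full_faces A (B - {e}). g H) +
    (\<Sum>a\<in>A. \<Sum>H\<in>full_faces (A - {a}) (B - {e}). g (insert (a, e) H))"
proof -
  let ?I = "\<lambda>a. insert (a, e) ` full_faces (A - {a}) (B - {e})"
  have fin: "finite (full_faces A' (B - {e}))" if "A' \<subseteq> A" for A'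
    using assms that by (intro finite_full_faces) (auto intro: finite_subset)
  have mem: "(b, e) \<notin> H" if "H \<in> full_faces A' (B - {e})" for b H A'
    using that by (auto simp: full_faces_def chessboard_def)
  have eq: "full_faces A B = full_faces A (B - {e}) \<union> (\<Union>a\<in>A. ?I a)"
  proof (intro equalityI subsetI)
    fix H assume H: "H \<in> full_faces A B"
    show "H \<in> full_faces A (B - {e}) \<union> (\<Union>a\<in>A. ?I a)"
    proof (cases "\<exists>a. (a, e) \<in> H")
      case True
      then obtain a where a: "(a, e) \<in> H" by blast
      have "a \<in> A" using H a by (auto simp: full_faces_def chessboard_def)
      moreover have "H = insert (a, e) (H - {(a, e)})" using a by auto
      ultimately show ?thesis using full_faces_remove[OF H a] by blast
    next
      case False
      then have "H \<in> full_faces A (B - {e})" using H by (auto simp: full_faces_def chessboard_def)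
      then show ?thesis by blast
    qed
  next
    fix H assume "H \<in> full_faces A (B - {e}) \<union> (\<Union>a\<in>A. ?I a)"
    then show "H \<in> full_faces A B"
    proof
      assume "H \<in> full_faces A (B - {e})"
      then show ?thesis using full_faces_mono[of "B - {e}" B A] by auto
    next
      assume "H \<in> (\<Union>a\<in>A. ?I a)"
      then obtain a H' where "a \<in> A" "H = insert (a, e) H'" "H' \<in> full_faces (A - {a}) (B - {e})"
        by blast
      then show ?thesis
        using full_faces_insert[of H' "A - {a}" "B - {e}" a e] assms(3) by (simp add: insert_absorb)
    qed
  qed
  have "(\<Sum>H\<in>full_faces A B. g H) = (\<Sum>H\<in>full_faces A (B - {e}). g H) + (\<Sum>H\<in>(\<Union>a\<in>A. ?I a). g H)"
    unfolding eq using fin assms mem by (intro sum.union_disjoint) blast+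
  also have "(\<Sum>H\<in>(\<Union>a\<in>A. ?I a). g H) = (\<Sum>a\<in>A. \<Sum>H\<in>?I a. g H)"
  proof (intro sum.UNION_disjoint ballI impI)
    fix a b :: nat assume "a \<noteq> b"
    show "?I a \<inter> ?I b = {}"
    proof (rule ccontr)
      assume "?I a \<inter> ?I b \<noteq> {}"
      then obtain H H' where H: "insert (a, e) H = insert (b, e) H'" "H' \<in> full_faces (A - {b}) (B - {e})"
        by blast
      then have "(a, e) \<in> insert (b, e) H'" by blast
      then show False using mem[OF H(2)] \<open>a \<noteq> b\<close> by auto
    qed
  qed (use assms fin in auto)
  also have "\<dots> = (\<Sum>a\<in>A. \<Sum>H\<in>full_faces (A - {a}) (B - {e}). g (insert (a, e) H))"
  proof (rule sum.cong[OF refl])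
    fix a :: nat
    have "inj_on (insert (a, e)) (full_faces (A - {a}) (B - {e}))"
      using mem by (intro inj_onI) (metis insert_ident)
    then show "(\<Sum>H\<in>?I a. g H) = (\<Sum>H\<in>full_faces (A - {a}) (B - {e}). g (insert (a, e) H))"
      by (simp add: sum.reindex)
  qed
  finally show ?thesis .
qed

text \<open>
  Fewer positions are forbidden for the letters \<open>A\<close> than there are letters. For \<open>E = {}\<close>, one letter can be
  moved while the others are fixed. In the induction step, the sum avoiding one more position \<open>e\<close> is the sum
  avoiding \<open>E\<close> minus the sums in which a letter \<open>a\<close> is fixed at \<open>e\<close>. In the latter, the letters \<open>A - {a}\<close> still
  outnumber \<open>E\<close>.
\<close>

lemma avoiding_sum_coboundary:
  assumes "finite X" "finite Y" "finite E" "A \<subseteq> X" "G \<in> full_faces (X - A) Y" "card E < card A"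
  shows "(\<Sum>H\<in>full_faces A (Y - snd ` G - E). frag_of (G \<union> H)) \<in>
    coboundaries (chessboard X Y) (int (card X) - 1)"
  using assms(3-)
proof (induction E arbitrary: A G rule: finite_induct)
  case empty
  let ?Y = "Y - snd ` G"
  obtain a where a: "a \<in> A" using empty by fastforce
  have finA: "finite A" using empty assms(1) finite_subset by blast
  have "(\<Sum>H\<in>full_faces A ?Y. frag_of (G \<union> H)) =
      (\<Sum>H\<in>full_faces (A - {a}) ?Y. \<Sum>j\<in>?Y - snd ` H. frag_of (G \<union> insert (a, j) H))"
    using finA assms a by (intro sum_full_faces_split) auto
  also have "\<dots> \<in> coboundaries (chessboard X Y) (int (card X) - 1)"
  proof (rule coboundaries_sum)
    fix H assume H: "H \<in> full_faces (A - {a}) ?Y"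
    have "G \<union> H \<in> full_faces ((X - A) \<union> (A - {a})) (snd ` G \<union> ?Y)"
      using H by (intro full_faces_Un full_faces_snd[OF empty(2)]) auto
    moreover have "(X - A) \<union> (A - {a}) = X - {a}" using a empty by auto
    moreover have "snd ` G \<union> ?Y = Y" using empty(2) by (auto simp: full_faces_def chessboard_def)
    ultimately have "G \<union> H \<in> full_faces (X - {a}) Y" by simp
    moreover have "?Y - snd ` H = Y - snd ` (G \<union> H)" by auto
    ultimately show "(\<Sum>j\<in>?Y - snd ` H. frag_of (G \<union> insert (a, j) H)) \<in>
        coboundaries (chessboard X Y) (int (card X) - 1)"
      using one_letter_sum_coboundary[OF assms(1,2), of a "G \<union> H"] a empty by auto
  qed
  finally show ?case by simp
next
  case (insert e E)
  let ?Y = "Y - snd ` G - E"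
  let ?N = "coboundaries (chessboard X Y) (int (card X) - 1)"
  have finA: "finite A" using insert assms(1) finite_subset by blast
  have IH: "(\<Sum>H\<in>full_faces A ?Y. frag_of (G \<union> H)) \<in> ?N"
    using insert by (intro insert.IH) auto
  have Y: "Y - snd ` G - insert e E = ?Y - {e}" by auto
  show ?case
  proof (cases "e \<in> ?Y")
    case True
    have "(\<Sum>H\<in>full_faces (A - {a}) (?Y - {e}). frag_of (G \<union> insert (a, e) H)) \<in> ?N"
      if a: "a \<in> A" for a
    proof -
      have "insert (a, e) G \<in> full_faces (insert a (X - A)) (insert e (snd ` G))"
        using a True by (intro full_faces_insert full_faces_snd[OF insert(5)]) auto
      moreover have "insert a (X - A) = X - (A - {a})" using a insert by auto
      moreover have "insert e (snd ` G) \<subseteq> Y"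
        using True insert(5) by (auto simp: full_faces_def chessboard_def)
      ultimately have "insert (a, e) G \<in> full_faces (X - (A - {a})) Y"
        using full_faces_mono by (metis subsetD)
      then have "(\<Sum>H\<in>full_faces (A - {a}) (Y - snd ` insert (a, e) G - E). frag_of (insert (a, e) G \<union> H)) \<in> ?N"
        using insert a finA by (intro insert.IH) auto
      moreover have "Y - snd ` insert (a, e) G - E = ?Y - {e}" by auto
      ultimately show ?thesis by simp
    qed
    then have "(\<Sum>a\<in>A. \<Sum>H\<in>full_faces (A - {a}) (?Y - {e}). frag_of (G \<union> insert (a, e) H)) \<in> ?N"
      by (rule coboundaries_sum)
    from coboundaries_diff[OF IH this] show ?thesis
      using sum_full_faces_avoid[of A ?Y e "\<lambda>H. frag_of (G \<union> H)"] finA assms(2) True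
      unfolding Y by simp
  next
    case False
    then have "?Y - {e} = ?Y" by auto
    then show ?thesis using IH unfolding Y by simp
  qed
qed

section \<open>Words as faces of top dimension\<close>

definition word_face :: "enat list \<Rightarrow> vertex set" where
  "word_face w = {(a, Suc i) | a i. i < length w \<and> w ! i = enat a}"

lemma mem_word_face: "(a, j) \<in> word_face w \<longleftrightarrow> (\<exists>i<length w. j = Suc i \<and> w ! i = enat a)"
  by (auto simp: word_face_def)

lemma mem_word_face_Suc [simp]: "(a, Suc i) \<in> word_face w \<longleftrightarrow> i < length w \<and> w ! i = enat a"
  by (auto simp: word_face_def)

lemma finite_part_conv_nth:
  "finite_part w = map (\<lambda>i. the_enat (w ! i)) (filter (\<lambda>i. w ! i \<noteq> \<infinity>) [0..<length w])"
proof -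
  have "finite_part (map ((!) w) [0..<length w]) =
      map (\<lambda>i. the_enat (w ! i)) (filter (\<lambda>i. w ! i \<noteq> \<infinity>) [0..<length w])"
    by (simp only: finite_part_def filter_map map_map) (simp add: o_def)
  then show ?thesis by (simp only: map_nth)
qed

lemma mset_eq_mset_set_iff:
  fixes A :: "'a::linorder set"
  assumes "finite A"
  shows "mset xs = mset_set A \<longleftrightarrow> distinct xs \<and> set xs = A"
proof
  assume "mset xs = mset_set A"
  then have "mset xs = mset (sorted_list_of_set A)"
    using mset_set_set[of "sorted_list_of_set A"] assms by simp
  then show "distinct xs \<and> set xs = A"
    using mset_eq_imp_distinct_iff[of xs "sorted_list_of_set A"] mset_eq_setD[of xs "sorted_list_of_set A"] assms
    by simp
qed (auto simp: mset_set_set)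

lemma mset_eq_finite_part:
  "mset w = image_mset enat (mset (finite_part w)) + replicate_mset (count (mset w) \<infinity>) \<infinity>"
  by (induction w) (auto simp: finite_part_def)

lemma words_iff:
  assumes "m \<le> n"
  shows "w \<in> words m n \<longleftrightarrow> length w = n \<and> (\<forall>a. (\<exists>i<n. w ! i = enat a) \<longleftrightarrow> a \<in> {1..m}) \<and>
    (\<forall>i<n. \<forall>j<n. w ! i = w ! j \<and> w ! i \<noteq> \<infinity> \<longrightarrow> i = j)"
proof -
  have "w \<in> words m n \<longleftrightarrow> length w = n \<and> mset (finite_part w) = mset_set {1..m}"
  proof
    assume "w \<in> words m n"
    then have w: "mset w = image_mset enat (mset_set {1..m}) + replicate_mset (n - m) \<infinity>"
      by (simp add: words_def)
    have "size (mset w) = n" using assms by (simp add: w)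
    then show "length w = n \<and> mset (finite_part w) = mset_set {1..m}"
      using mset_finite_part_words[OF w] by simp
  next
    assume w: "length w = n \<and> mset (finite_part w) = mset_set {1..m}"
    have "length (finite_part w) = m"
      using w by (metis card_atLeastAtMost diff_Suc_1 size_mset size_mset_set)
    then have "count (mset w) \<infinity> = n - m" using length_finite_part[of w] w by simp
    then show "w \<in> words m n" using mset_eq_finite_part[of w] w by (simp add: words_def)
  qed
  also have "mset (finite_part w) = mset_set {1..m} \<longleftrightarrow>
      distinct (finite_part w) \<and> set (finite_part w) = {1..m}"
    by (intro mset_eq_mset_set_iff) simp
  also have "set (finite_part w) = {1..m} \<longleftrightarrow> (\<forall>a. (\<exists>i<length w. w ! i = enat a) \<longleftrightarrow> a \<in> {1..m})"
  proof -
    have "set (finite_part w) = {a. \<exists>i<length w. w ! i = enat a}"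
      by (force simp: finite_part_conv_nth)
    then show ?thesis by (simp only: set_eq_iff mem_Collect_eq)
  qed
  also have "distinct (finite_part w) \<longleftrightarrow>
      (\<forall>i<length w. \<forall>j<length w. w ! i = w ! j \<and> w ! i \<noteq> \<infinity> \<longrightarrow> i = j)"
  proof -
    have "distinct (finite_part w) \<longleftrightarrow> inj_on (\<lambda>i. the_enat (w ! i)) {i. i < length w \<and> w ! i \<noteq> \<infinity>}"
      by (simp add: finite_part_conv_nth distinct_map conj_commute)
    also have "\<dots> \<longleftrightarrow> (\<forall>i<length w. \<forall>j<length w. w ! i = w ! j \<and> w ! i \<noteq> \<infinity> \<longrightarrow> i = j)"
    proof
      assume inj: "inj_on (\<lambda>i. the_enat (w ! i)) {i. i < length w \<and> w ! i \<noteq> \<infinity>}"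
      show "\<forall>i<length w. \<forall>j<length w. w ! i = w ! j \<and> w ! i \<noteq> \<infinity> \<longrightarrow> i = j"
      proof (intro allI impI)
        fix i j assume ij: "i < length w" "j < length w" "w ! i = w ! j \<and> w ! i \<noteq> \<infinity>"
        then have eq: "w ! i = w ! j" and ni: "w ! i \<noteq> \<infinity>" by iprover+
        have nj: "w ! j \<noteq> \<infinity>" using ni unfolding eq .
        show "i = j"
        proof (rule inj_onD[OF inj])
          show "the_enat (w ! i) = the_enat (w ! j)" by (simp only: eq)
        qed (intro CollectI conjI ij(1,2) ni nj)+
      qed
    next
      assume *: "\<forall>i<length w. \<forall>j<length w. w ! i = w ! j \<and> w ! i \<noteq> \<infinity> \<longrightarrow> i = j"
      show "inj_on (\<lambda>i. the_enat (w ! i)) {i. i < length w \<and> w ! i \<noteq> \<infinity>}"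
      proof (rule inj_onI)
        fix i j assume i: "i \<in> {i. i < length w \<and> w ! i \<noteq> \<infinity>}"
          and j: "j \<in> {i. i < length w \<and> w ! i \<noteq> \<infinity>}" and eq: "the_enat (w ! i) = the_enat (w ! j)"
        have "enat (the_enat (w ! i)) = w ! i" "enat (the_enat (w ! j)) = w ! j"
          using i j by auto
        then have "w ! i = w ! j" using eq by metis
        then show "i = j" using * i j unfolding mem_Collect_eq by iprover
      qed
    qed
    finally show ?thesis .
  qed
  finally show ?thesis by auto
qed

lemma wordsD:
  assumes "m \<le> n" "w \<in> words m n"
  shows words_length: "length w = n"
    and words_letter_iff: "(\<exists>i<n. w ! i = enat a) \<longleftrightarrow> a \<in> {1..m}"
    and words_letter_unique: "i < n \<Longrightarrow> j < n \<Longrightarrow> w ! i = w ! j \<Longrightarrow> w ! i \<noteq> \<infinity> \<Longrightarrow> i = j"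
proof -
  note w = assms(2)[unfolded words_iff[OF assms(1)]]
  show "length w = n" by (rule conjunct1[OF w])
  show "(\<exists>i<n. w ! i = enat a) \<longleftrightarrow> a \<in> {1..m}"
    by (rule spec[OF conjunct1[OF conjunct2[OF w]]])
  show "i = j" if "i < n" "j < n" "w ! i = w ! j" "w ! i \<noteq> \<infinity>"
    using conjunct2[OF conjunct2[OF w], rule_format, OF that(1,2) conjI[OF that(3,4)]] .
qed

lemma finite_words: "m \<le> n \<Longrightarrow> finite (words m n)"
proof -
  assume mn: "m \<le> n"
  have "words m n \<subseteq> {w. set w \<subseteq> insert \<infinity> (enat ` {1..m}) \<and> length w = n}"
  proof
    fix w assume w: "w \<in> words m n"
    have "x \<in> insert \<infinity> (enat ` {1..m})" if x: "x \<in> set w" for x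
    proof (cases x)
      case (enat a)
      obtain i where i: "i < length w" "w ! i = x" using x by (auto simp: in_set_conv_nth)
      have "\<exists>i<n. w ! i = enat a"
        using i unfolding words_length[OF mn w] enat by metis
      then have "a \<in> {1..m}" by (rule iffD1[OF words_letter_iff[OF mn w]])
      then show ?thesis using enat by simp
    next
      case infinity
      then show ?thesis by simp
    qed
    then show "w \<in> {w. set w \<subseteq> insert \<infinity> (enat ` {1..m}) \<and> length w = n}"
      using words_length[OF mn w] by auto
  qed
  then show ?thesis by (rule finite_subset) (intro finite_lists_length_eq, simp)
qed

lemma card_infinities_words:
  assumes "m \<le> n" "w \<in> words m n"
  shows "card {i. i < n \<and> w ! i = \<infinity>} = n - m"
proof -
  have "count (mset w) \<infinity> = n - m"
    using assms(2) by (simp add: words_def count_eq_zero_iff image_iff)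
  moreover have "count (mset w) \<infinity> = length (filter ((=) \<infinity>) w)"
    by (simp add: count_mset count_list_eq_length_filter)
  moreover have "\<dots> = card {i. i < length w \<and> \<infinity> = w ! i}" by (rule length_filter_conv_card)
  ultimately show ?thesis
    unfolding words_length[OF assms] by (simp only: eq_commute[of \<infinity>])
qed

lemma word_face_full:
  assumes "m \<le> n" "w \<in> words m n"
  shows "word_face w \<in> full_faces {1..m} {1..n}"
proof -
  have w: "length w = n" "\<And>a. (\<exists>i<n. w ! i = enat a) \<longleftrightarrow> a \<in> {1..m}"
    "\<And>i j. i < n \<Longrightarrow> j < n \<Longrightarrow> w ! i = w ! j \<Longrightarrow> w ! i \<noteq> \<infinity> \<Longrightarrow> i = j"
    by (fact wordsD[OF assms])+
  have "word_face w \<subseteq> {1..m} \<times> {1..n}"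
  proof (rule subsetI)
    fix x assume "x \<in> word_face w"
    then obtain a i where x: "x = (a, Suc i)" "i < n" "w ! i = enat a"
      using w(1) by (auto simp: word_face_def)
    then have "a \<in> {1..m}" using w(2)[of a] by metis
    then show "x \<in> {1..m} \<times> {1..n}" using x by auto
  qed
  moreover have "fst ` word_face w = {1..m}"
  proof (intro equalityI subsetI)
    fix a assume "a \<in> {1..m}"
    then obtain i where "i < n" "w ! i = enat a" using w(2)[of a] by metis
    then have "(a, Suc i) \<in> word_face w" using w(1) by simp
    then show "a \<in> fst ` word_face w" by (metis fst_conv image_eqI)
  qed (use calculation in auto)
  moreover have "inj_on fst (word_face w)"
    using w(1) w(3) by (auto simp: inj_on_def word_face_def)
  moreover have "inj_on snd (word_face w)" by (auto simp: inj_on_def word_face_def)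
  ultimately show ?thesis by (simp add: full_faces_def chessboardI)
qed

lemma word_face_surject:
  assumes "m \<le> n" "F \<in> full_faces {1..m} {1..n}"
  obtains w where "w \<in> words m n" "word_face w = F"
proof -
  have F: "F \<subseteq> {1..m} \<times> {1..n}" "inj_on fst F" "inj_on snd F" "fst ` F = {1..m}"
    using assms(2) chessboardD[of F] by (auto simp: full_faces_def)
  define w where "w = map (\<lambda>i. if \<exists>a. (a, Suc i) \<in> F then enat (THE a. (a, Suc i) \<in> F) else \<infinity>) [0..<n]"
  have len: "length w = n" by (simp add: w_def)
  have nth: "w ! i = enat a \<longleftrightarrow> (a, Suc i) \<in> F" if "i < n" for i a
  proof (cases "\<exists>a. (a, Suc i) \<in> F")
    case True
    then obtain b where b: "(b, Suc i) \<in> F" by blast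
    have uniq: "c = b" if "(c, Suc i) \<in> F" for c
      using inj_onD[OF F(3), of "(c, Suc i)" "(b, Suc i)"] that b by simp
    have the: "(THE a. (a, Suc i) \<in> F) = b" using b uniq by (rule the_equality)
    have "w ! i = enat b" unfolding w_def using that True by (simp add: the)
    then have "w ! i = enat a \<longleftrightarrow> a = b" by auto
    moreover have "(a, Suc i) \<in> F \<longleftrightarrow> a = b" using b uniq[of a] by metis
    ultimately show ?thesis by (simp only:)
  next
    case False
    then show ?thesis using that by (auto simp: w_def)
  qed
  have face: "word_face w = F"
  proof (rule Set.set_eqI)
    fix x :: vertex
    obtain a j where x: "x = (a, j)" by (cases x)
    show "x \<in> word_face w \<longleftrightarrow> x \<in> F"
    proof (cases "j \<in> {1..n}")
      case True
      then obtain i where "j = Suc i" "i < n" by (cases j) auto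
      then show ?thesis using nth[of i a] len by (simp add: x)
    next
      case False
      then show ?thesis using F(1) len by (auto simp: x mem_word_face)
    qed
  qed
  have "w \<in> words m n"
    unfolding words_iff[OF assms(1)]
  proof (intro conjI allI impI len)
    show "(\<exists>i<n. w ! i = enat a) \<longleftrightarrow> a \<in> {1..m}" for a
    proof
      assume "\<exists>i<n. w ! i = enat a"
      then show "a \<in> {1..m}" using nth F(1) by blast
    next
      assume "a \<in> {1..m}"
      then obtain j where j: "(a, j) \<in> F" using F(4) by force
      then have "j \<in> {1..n}" using F(1) by auto
      then obtain i where "j = Suc i" "i < n" by (cases j) auto
      then show "\<exists>i<n. w ! i = enat a" using j nth by blast
    qed
    show "i = j" if ij: "i < n" "j < n" "w ! i = w ! j \<and> w ! i \<noteq> \<infinity>" for i j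
    proof -
      obtain a where a: "w ! i = enat a" using ij(3) unfolding not_infinity_eq by iprover
      then have "w ! j = enat a" using ij(3) by metis
      then have "(a, Suc i) \<in> F" "(a, Suc j) \<in> F"
        using a nth[OF ij(1), of a] nth[OF ij(2), of a] by metis+
      then show ?thesis using inj_onD[OF F(2)] by fastforce
    qed
  qed
  then show ?thesis using that face by blast
qed

lemma rev_less_if_last_difference:
  fixes v w :: "'a::linorder list"
  assumes "length v = length w" "i < length w" "v ! i < w ! i"
    and "\<And>j. i < j \<Longrightarrow> j < length w \<Longrightarrow> v ! j = w ! j"
  shows "rev v < rev w"
proof -
  let ?k = "length w - Suc i"
  have "take ?k (rev v) = take ?k (rev w)"
    using assms by (intro nth_equalityI) (auto simp: rev_nth)
  moreover have "rev v ! ?k < rev w ! ?k" using assms by (simp add: rev_nth)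
  ultimately have "(rev v, rev w) \<in> lexord {(u, v). u < v}"
    unfolding lexord_take_index_conv using assms by (intro disjI2 exI[of _ ?k]) auto
  then show ?thesis by (simp add: list_less_def)
qed

lemma last_difference:
  assumes "length v = length w" "v \<noteq> w"
  obtains i where "i < length w" "v ! i \<noteq> w ! i" "\<And>j. i < j \<Longrightarrow> j < length w \<Longrightarrow> v ! j = w ! j"
proof -
  let ?D = "{i. i < length w \<and> v ! i \<noteq> w ! i}"
  have ne: "?D \<noteq> {}" using assms by (auto simp: list_eq_iff_nth_eq)
  have fin: "finite ?D" by simp
  have "Max ?D \<in> ?D" using Max_in[OF fin ne] .
  moreover have "v ! j = w ! j" if "Max ?D < j" "j < length w" for j
  proof (rule ccontr)
    assume "v ! j \<noteq> w ! j"
    then have "j \<in> ?D" using that by simp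
    then have "j \<le> Max ?D" by (rule Max_ge[OF fin])
    then show False using that(1) by (rule leD[THEN notE])
  qed
  ultimately show ?thesis using that by blast
qed

section \<open>Straightening\<close>

text \<open>
  Let \<open>A\<close> be the finite letters of the increasing subsequence, \<open>p\<close> the position of the last of them, and \<open>E\<close>
  the positions before \<open>p\<close> with letter \<open>\<infinity>\<close>. The letters \<open>\<infinity>\<close> of the subsequence come after \<open>p\<close>, and \<open>w\<close> has
  \<open>n - m\<close> letters \<open>\<infinity>\<close>; so \<open>A\<close> outnumbers \<open>E\<close>, and the sum over all placements of \<open>A\<close> that avoid \<open>E\<close> is a
  coboundary. In this sum, \<open>w\<close> is the greatest word in the lexicographic order of reversed words. For consider the
  last position where another word differs from \<open>w\<close>. Either \<open>w\<close> has the letter \<open>\<infinity>\<close> there. Or no letter of \<open>A\<close> has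
  moved beyond \<open>p\<close>; then the only positions left for the letters \<open>A\<close> are those that they have in \<open>w\<close>, where they
  increase, and a smaller letter of \<open>A\<close> has replaced a larger one.
\<close>

lemma straightening:
  assumes "m \<le> n" "w \<in> words m n" "increasing_on I w" "n - m < card I"
  shows "\<exists>V \<subseteq> {v \<in> words m n. rev v < rev w}.
    frag_of (word_face w) + (\<Sum>v\<in>V. frag_of (word_face v)) \<in>
      coboundaries (chessboard {1..m} {1..n}) (int m - 1)"
proof -
  note not_infinity_eq [simp del]
  have w: "length w = n" "\<And>a. (\<exists>i<n. w ! i = enat a) \<longleftrightarrow> a \<in> {1..m}"
    "\<And>i j. i < n \<Longrightarrow> j < n \<Longrightarrow> w ! i = w ! j \<Longrightarrow> w ! i \<noteq> \<infinity> \<Longrightarrow> i = j"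
    by (fact wordsD[OF assms(1,2)])+
  have I: "\<And>i. i \<in> I \<Longrightarrow> i < n" "\<And>i j. i \<in> I \<Longrightarrow> j \<in> I \<Longrightarrow> i < j \<Longrightarrow> w ! i \<le> w ! j"
    using assms(3) w(1) by (auto simp: increasing_on_def)
  have finI: "finite I" using I(1) by (meson finite_lessThan finite_subset lessThan_iff subsetI)
  define J where "J = {i \<in> I. w ! i \<noteq> \<infinity>}"
  define Inf where "Inf = {i. i < n \<and> w ! i = \<infinity>}"
  have cInf: "card Inf = n - m" unfolding Inf_def by (rule card_infinities_words[OF assms(1,2)])
  have finInf: "finite Inf" by (simp add: Inf_def)
  have finJ: "finite J" using finI by (simp add: J_def)
  have "J \<noteq> {}"
  proof
    assume "J = {}"
    then have "I \<subseteq> Inf" unfolding J_def Inf_def using I(1) by blast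
    then have "card I \<le> card Inf" by (rule card_mono[OF finInf])
    then show False using cInf assms(4) by simp
  qed
  define p where "p = Max J"
  have pJ: "p \<in> J" using Max_in[OF finJ \<open>J \<noteq> {}\<close>] by (simp add: p_def)
  have leJ: "i \<le> p" if "i \<in> J" for i using Max_ge[OF finJ that] by (simp add: p_def)
  have pn: "p < n" using pJ I(1) by (auto simp: J_def)
  define E0 where "E0 = {i. i < p \<and> w ! i = \<infinity>}"
  (* Positions of w are counted from 0 here, positions of the faces from 1. *)
  have card_EJ: "card E0 < card J"
  proof -
    have later: "p < i" if "i \<in> I" "i \<notin> J" for i
    proof (rule ccontr)
      have "w ! i = \<infinity>" using that by (simp add: J_def)
      moreover have "w ! p \<noteq> \<infinity>" using pJ by (simp add: J_def)
      moreover assume "\<not> p < i"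
      ultimately have "i < p" by (metis linorder_neqE_nat)
      then have "w ! i \<le> w ! p" using I(2) that(1) pJ by (auto simp: J_def)
      then show False using \<open>w ! i = \<infinity>\<close> \<open>w ! p \<noteq> \<infinity>\<close> by simp
    qed
    have "E0 \<union> (I - J) \<subseteq> Inf" using I(1) pn by (auto simp: E0_def Inf_def J_def)
    then have "card (E0 \<union> (I - J)) \<le> n - m" using card_mono[OF finInf] cInf by metis
    moreover have "card (E0 \<union> (I - J)) = card E0 + card (I - J)"
      using later finI by (intro card_Un_disjoint) (auto simp: E0_def dest: less_asym)
    moreover have "card (I - J) = card I - card J" "card J \<le> card I"
      using finI by (auto simp: J_def intro!: card_Diff_subset card_mono)
    ultimately show ?thesis using assms(4) by linarith
  qed
  define A where "A = (\<lambda>i. the_enat (w ! i)) ` J"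
  have AJ: "w ! i = enat a \<Longrightarrow> i < n \<Longrightarrow> a \<in> A \<longleftrightarrow> i \<in> J" for i a
  proof
    assume wi: "w ! i = enat a" "i < n" and "a \<in> A"
    then obtain j where j: "j \<in> J" "a = the_enat (w ! j)" by (auto simp: A_def)
    then have "w ! j = w ! i" "j < n" using wi I(1) by (auto simp: J_def)
    then show "i \<in> J" using w(3)[of j i] wi j by auto
  next
    assume "w ! i = enat a" "i < n" "i \<in> J"
    then show "a \<in> A" by (force simp: A_def)
  qed
  have cA: "card A = card J"
    unfolding A_def
  proof (intro card_image inj_onI)
    fix i j assume ij: "i \<in> J" "j \<in> J" "the_enat (w ! i) = the_enat (w ! j)"
    then have "w ! i = w ! j" by (auto simp: J_def)
    then show "i = j" using w(3) ij I(1) by (auto simp: J_def)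
  qed
  have AX: "A \<subseteq> {1..m}"
  proof
    fix a assume "a \<in> A"
    then obtain i where i: "i \<in> J" "a = the_enat (w ! i)" by (auto simp: A_def)
    then have "i < n" "w ! i = enat a" using I(1) by (auto simp: J_def)
    then show "a \<in> {1..m}" using w(2)[of a] by metis
  qed
  define E where "E = Suc ` E0"
  have cE: "card E < card A" "finite E"
    using card_EJ cA by (auto simp: E_def E0_def card_image)
  define F where "F = word_face w"
  define G where "G = {x \<in> F. fst x \<notin> A}"
  define H0 where "H0 = {x \<in> F. fst x \<in> A}"
  have F: "F \<in> full_faces {1..m} {1..n}" unfolding F_def by (rule word_face_full[OF assms(1,2)])
  then have F': "F \<subseteq> {1..m} \<times> {1..n}" "inj_on fst F" "inj_on snd F" "fst ` F = {1..m}"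
    using chessboardD[of F] by (auto simp: full_faces_def)
  have G: "G \<in> full_faces ({1..m} - A) {1..n}"
  proof -
    have "G \<subseteq> F" "G \<subseteq> ({1..m} - A) \<times> {1..n}" using F'(1) by (auto simp: G_def)
    then have "G \<in> chessboard ({1..m} - A) {1..n}"
      using inj_on_subset[OF F'(2)] inj_on_subset[OF F'(3)] by (intro chessboardI)
    moreover have "fst ` G = {1..m} - A" unfolding F'(4)[symmetric] by (auto simp: G_def)
    ultimately show ?thesis by (simp add: full_faces_def)
  qed
  define Y where "Y = {1..n} - snd ` G - E"
  have H0: "H0 \<in> full_faces A Y"
  proof -
    have "snd x \<notin> snd ` G" if "x \<in> H0" for x
      using that F'(3) by (auto simp: H0_def G_def dest: inj_onD)
    moreover have "snd x \<notin> E" if "x \<in> H0" for x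
      using that w(1) by (cases x) (auto simp: H0_def F_def E_def E0_def mem_word_face)
    moreover have "fst x \<in> A \<and> snd x \<in> {1..n}" if "x \<in> H0" for x
      using that F'(1) by (auto simp: H0_def)
    ultimately have "H0 \<subseteq> A \<times> Y" unfolding Y_def by (intro subsetI) (simp add: mem_Times_iff)
    moreover have "H0 \<subseteq> F" by (auto simp: H0_def)
    ultimately have "H0 \<in> chessboard A Y"
      using inj_on_subset[OF F'(2)] inj_on_subset[OF F'(3)] by (intro chessboardI)
    moreover have "fst ` H0 = A" using AX unfolding F'(4)[symmetric] by (auto simp: H0_def)
    ultimately show ?thesis by (simp add: full_faces_def)
  qed
  have sndH0: "snd ` H0 = Suc ` J"
  proof (intro equalityI subsetI)
    fix j assume "j \<in> snd ` H0"
    then obtain a i where "(a, Suc i) \<in> F" "a \<in> A" "j = Suc i"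
      by (force simp: H0_def F_def word_face_def)
    then show "j \<in> Suc ` J" using AJ[of i a] w(1) by (auto simp: F_def)
  next
    fix j assume "j \<in> Suc ` J"
    then obtain i where "i \<in> J" "j = Suc i" by blast
    moreover from this obtain a where "w ! i = enat a" "i < n" using I(1) by (auto simp: J_def not_infinity_eq)
    ultimately have i: "i \<in> J" "j = Suc i" "w ! i = enat a" "i < n" by blast+
    then have "(a, Suc i) \<in> H0" using AJ[of i a] w(1) by (simp add: H0_def F_def)
    then show "j \<in> snd ` H0" using i(2) by force
  qed
  have finY: "finite Y" by (simp add: Y_def)
  have finA: "finite A" using finJ by (simp add: A_def)
  have "(\<Sum>H\<in>full_faces A Y. frag_of (G \<union> H)) \<in> coboundaries (chessboard {1..m} {1..n}) (int (card {1..m}) - 1)"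
    unfolding Y_def using AX G cE by (intro avoiding_sum_coboundary) auto
  moreover have "(\<Sum>H\<in>full_faces A Y. frag_of (G \<union> H)) =
      frag_of (G \<union> H0) + (\<Sum>H\<in>full_faces A Y - {H0}. frag_of (G \<union> H))"
    by (rule sum.remove[OF finite_full_faces[OF finA finY] H0])
  moreover have "G \<union> H0 = F" by (auto simp: G_def H0_def)
  ultimately have main: "frag_of F + (\<Sum>H\<in>full_faces A Y - {H0}. frag_of (G \<union> H)) \<in>
      coboundaries (chessboard {1..m} {1..n}) (int m - 1)" by simp
  have GH: "G \<union> H \<in> full_faces {1..m} {1..n}" if H: "H \<in> full_faces A Y" for H
  proof -
    have "G \<union> H \<in> full_faces (({1..m} - A) \<union> A) (snd ` G \<union> Y)"
      by (intro full_faces_Un full_faces_snd[OF G] H) (auto simp: Y_def)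
    moreover have "({1..m} - A) \<union> A = {1..m}" using AX by auto
    moreover have "snd ` G \<union> Y \<subseteq> {1..n}" using F'(1) by (auto simp: G_def Y_def)
    ultimately show ?thesis using full_faces_mono by (metis subsetD)
  qed
  define wd where "wd H = (SOME v. v \<in> words m n \<and> word_face v = G \<union> H)" for H
  have wd: "wd H \<in> words m n" "word_face (wd H) = G \<union> H" if HY: "H \<in> full_faces A Y" for H
  proof -
    obtain v where "v \<in> words m n \<and> word_face v = G \<union> H"
      using word_face_surject[OF assms(1) GH[OF HY]] by metis
    then have "wd H \<in> words m n \<and> word_face (wd H) = G \<union> H" unfolding wd_def by (rule someI)
    then show "wd H \<in> words m n" "word_face (wd H) = G \<union> H" by auto
  qed
  (* H runs over the placements of A, and wd H is the word in which the other letters keep their places. *)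
  have less: "rev (wd H) < rev w" if H: "H \<in> full_faces A Y" "H \<noteq> H0" for H
  proof -
    define v where "v = wd H"
    have v: "v \<in> words m n" "word_face v = G \<union> H" using wd[OF H(1)] by (simp_all add: v_def)
    have lv: "length v = n" by (rule words_length[OF assms(1) v(1)])
    have H': "H \<subseteq> A \<times> Y" "inj_on fst H" "inj_on snd H" "fst ` H = A"
      using H(1) chessboardD[of H] by (auto simp: full_faces_def)
    have GA: "fst x \<notin> A" if "x \<in> G" for x using that by (simp add: G_def)
    have "v \<noteq> w"
    proof
      assume "v = w"
      then have GF: "G \<union> H = F" using v(2) by (simp add: F_def)
      have "x \<in> H \<longleftrightarrow> x \<in> H0" for x
      proof
        assume x: "x \<in> H"
        then have "x \<in> F" "fst x \<in> A" using GF H'(1) by auto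
        then show "x \<in> H0" by (simp add: H0_def)
      next
        assume "x \<in> H0"
        then have "x \<in> F" "fst x \<in> A" by (simp_all add: H0_def)
        then show "x \<in> H" using GA[of x] GF by blast
      qed
      then show False using H(2) by blast
    qed
    then obtain i where i: "i < n" "v ! i \<noteq> w ! i" "\<And>j. i < j \<Longrightarrow> j < n \<Longrightarrow> v ! j = w ! j"
      using last_difference[of v w] unfolding lv w(1) by metis
    have vG: "v ! j = enat b" if "(b, Suc j) \<in> G \<union> H" for b j
      using that v(2) mem_word_face_Suc[of b j v] by simp
    have "v ! i < w ! i"
    proof (cases "w ! i")
      case infinity
      then show ?thesis using i(2) by simp
    next
      case (enat b)
      have bA: "b \<in> A"
      proof (rule ccontr)
        assume "b \<notin> A"
        then have "(b, Suc i) \<in> G" using enat i(1) w(1) by (simp add: G_def F_def)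
        then show False using vG[of b i] enat i(2) by simp
      qed
      then have iJ: "i \<in> J" using AJ enat i(1) by blast
      (* w has the finite letter b at the last difference i, so that no letter of A lies beyond p. *)
      have "snd ` H \<subseteq> Suc ` J"
      proof
        fix j' assume "j' \<in> snd ` H"
        then obtain c where c: "(c, j') \<in> H" by force
        then have cA: "c \<in> A" and jY: "j' \<in> Y" using H'(1) by auto
        then obtain j where j: "j' = Suc j" "j < n" by (cases j') (auto simp: Y_def)
        have vj: "v ! j = enat c" using vG c j by simp
        show "j' \<in> Suc ` J"
        proof (cases "p < j")
          case True
          then have "w ! j = enat c" using i(3)[of j] leJ[OF iJ] j(2) vj by simp
          then have "j \<in> J" using AJ cA j(2) by blast
          then show ?thesis using j by simp
        next
          case False
          have "w ! j \<noteq> \<infinity>"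
          proof
            assume "w ! j = \<infinity>"
            moreover from this have "j \<noteq> p" using pJ by (auto simp: J_def)
            ultimately have "Suc j \<in> E" using False by (auto simp: E_def E0_def)
            then show False using jY j(1) by (simp add: Y_def)
          qed
          then obtain d where d: "w ! j = enat d" unfolding not_infinity_eq by iprover
          have "d \<in> A"
          proof (rule ccontr)
            assume "d \<notin> A"
            then have "(d, Suc j) \<in> G" using d j(2) w(1) by (simp add: G_def F_def)
            then show False using jY j(1) by (force simp: Y_def)
          qed
          then show ?thesis using AJ d j by blast
        qed
      qed
      moreover have "card (snd ` H) = card (Suc ` J)"
        using card_image[OF H'(3)] card_image[OF H'(2)] H'(4) cA by (simp add: card_image)
      ultimately have "snd ` H = Suc ` J" using finJ by (intro card_subset_eq) auto
      then have "Suc i \<in> snd ` H" using iJ by simp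
      then obtain c where c: "(c, Suc i) \<in> H" by force
      then have cA: "c \<in> A" and vi: "v ! i = enat c" using H'(1) vG by auto
      have "\<not> b < c"
      proof
        assume bc: "b < c"
        (* In w, the letter c > b comes after b, hence at a position where both words agree. *)
        obtain q where "q \<in> J" "c = the_enat (w ! q)" using cA by (auto simp: A_def)
        then have q: "q \<in> J" "w ! q = enat c" by (auto simp: J_def)
        have qn: "q < n" using q I(1) by (auto simp: J_def)
        have "i < q"
        proof (rule ccontr)
          assume "\<not> i < q"
          then have "q = i \<or> q < i" by auto
          then have "w ! q \<le> w ! i" using I(2)[of q i] q(1) iJ by (auto simp: J_def)
          then show False using bc q(2) enat by simp
        qed
        then have "v ! q = enat c" using i(3) qn q(2) by simp
        moreover have "q = i" if "v ! q = v ! i"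
          using words_letter_unique[OF assms(1) v(1) qn i(1) that] vi that by simp
        ultimately show False using vi \<open>i < q\<close> by simp
      qed
      moreover have "c \<noteq> b" using i(2) enat vi by auto
      ultimately show ?thesis using enat vi by simp
    qed
    then show ?thesis
      unfolding v_def[symmetric] using i lv w(1) by (intro rev_less_if_last_difference[of v w i]) auto
  qed
  have inj: "inj_on wd (full_faces A Y - {H0})"
  proof (rule inj_onI)
    fix H H' assume H: "H \<in> full_faces A Y - {H0}" "H' \<in> full_faces A Y - {H0}" "wd H = wd H'"
    then have "G \<union> H = G \<union> H'" using wd(2)[of H] wd(2)[of H'] by simp
    moreover have "G \<inter> H = {}" "G \<inter> H' = {}"
      using H by (auto simp: G_def full_faces_def chessboard_def)
    ultimately show "H = H'" by blast
  qed
  have "(\<Sum>v\<in>wd ` (full_faces A Y - {H0}). frag_of (word_face v)) = (\<Sum>H\<in>full_faces A Y - {H0}. frag_of (G \<union> H))"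
    using wd(2) by (subst sum.reindex[OF inj]) (auto intro!: sum.cong)
  then show ?thesis
    using main wd(1) less unfolding F_def by (intro exI[of _ "wd ` (full_faces A Y - {H0})"]) auto
qed

section \<open>Signed sums over words\<close>

text \<open>
  Each letter between \<open>p\<close> and \<open>q\<close> forms an inversion with \<open>p\<close> in exactly one of the two words, and likewise
  with \<open>q\<close>; this preserves the parity. The pair of \<open>p\<close> and \<open>q\<close> itself changes it.
\<close>

lemma inv_sign_swap:
  fixes p q :: "'a::linorder"
  assumes "distinct (xs @ p # ys @ q # zs)"
  shows "inv_sign (<) (xs @ q # ys @ p # zs) = - inv_sign (<) (xs @ p # ys @ q # zs)"
proof -
  have split: "length (filter (\<lambda>u. u < r) ys) + length (filter (\<lambda>u. r < u) ys) = length ys"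
    if "r \<notin> set ys" for r
  proof -
    have "filter (\<lambda>u. r < u) ys = filter (\<lambda>u. \<not> u < r) ys"
    proof (rule filter_cong[OF refl])
      fix u assume "u \<in> set ys"
      then have "u \<noteq> r" using that by blast
      then show "r < u \<longleftrightarrow> \<not> u < r" by auto
    qed
    then show ?thesis by (simp add: sum_length_filter_compl)
  qed
  have count: "card (inversions (<) (xs @ p # ys @ q # zs)) = card (inversions (<) (xs @ ys @ zs)) +
      length (filter (\<lambda>u. p < u) xs) + length (filter (\<lambda>u. u < p) ys) + (if q < p then 1 else 0) +
      length (filter (\<lambda>u. u < p) zs) + length (filter (\<lambda>u. q < u) xs) +
      length (filter (\<lambda>u. q < u) ys) + length (filter (\<lambda>u. u < q) zs)" for p q
    using card_inversions_insert[of "(<)" xs p "ys @ q # zs"] card_inversions_insert[of "(<)" "xs @ ys" q zs]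
    by simp
  have "p \<notin> set ys" "q \<notin> set ys" "p \<noteq> q" using assms by auto
  then have "card (inversions (<) (xs @ p # ys @ q # zs)) + card (inversions (<) (xs @ q # ys @ p # zs)) =
    2 * (card (inversions (<) (xs @ ys @ zs)) + length (filter (\<lambda>u. p < u) xs) +
      length (filter (\<lambda>u. u < p) zs) + length (filter (\<lambda>u. q < u) xs) + length (filter (\<lambda>u. u < q) zs) + length ys) + 1"
    using split[of p] split[of q] unfolding count by auto
  then have "odd (card (inversions (<) (xs @ p # ys @ q # zs)) + card (inversions (<) (xs @ q # ys @ p # zs)))"
    by (simp only:) simp
  then show ?thesis by (auto simp: inv_sign_def)
qed

lemma inv_sign_transpose:
  fixes p q :: "'a::linorder"
  assumes "distinct w" "p \<in> set w" "q \<in> set w" "p \<noteq> q"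
  shows "inv_sign (<) (map (transpose p q) w) = - inv_sign (<) w"
proof -
  have *: "inv_sign (<) (map (transpose p q) w) = - inv_sign (<) w"
    if w: "w = xs @ p # ys @ q # zs" and dist: "distinct w" for p q :: 'a and xs ys zs
  proof -
    have id: "map (transpose p q) us = us" if "p \<notin> set us" "q \<notin> set us" for us
      using that by (induction us) (auto simp: transpose_def)
    have "map (transpose p q) w = xs @ q # ys @ p # zs"
      using dist unfolding w by (simp add: id)
    then show ?thesis using inv_sign_swap[of xs p ys q zs] dist by (simp add: w)
  qed
  obtain xs us where us: "w = xs @ p # us" using assms(2) split_list by metis
  show ?thesis
  proof (cases "q \<in> set us")
    case True
    then obtain ys zs where "us = ys @ q # zs" using split_list by metis
    then show ?thesis using *[of xs p ys q us] *[of xs p ys q zs] us assms(1) by simp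
  next
    case False
    then have "q \<in> set xs" using assms us by auto
    then obtain ys zs where "xs = ys @ q # zs" using split_list by metis
    then show ?thesis using *[of ys q zs p us] us assms(1) by (simp add: transpose_commute)
  qed
qed

definition placed :: "nat set \<Rightarrow> enat list \<Rightarrow> vertex set" where
  "placed B w = set (word_simplex (sorted_list_of_set B) w)"

lemma set_word_simplex:
  assumes "length js = length w"
  shows "set (word_simplex js w) = {(a, js ! i) | a i. i < length w \<and> w ! i = enat a}"
proof (rule Set.set_eqI)
  fix x :: vertex
  have "x \<in> set (word_simplex js w) \<longleftrightarrow>
      (\<exists>j y. (j, y) \<in> set (zip js w) \<and> y \<noteq> \<infinity> \<and> x = (the_enat y, j))"
    unfolding word_simplex_def by (force simp del: not_infinity_eq)
  also have "\<dots> \<longleftrightarrow> (\<exists>i<length w. w ! i \<noteq> \<infinity> \<and> x = (the_enat (w ! i), js ! i))"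
    using assms unfolding in_set_zip by (metis fst_conv snd_conv)
  also have "\<dots> \<longleftrightarrow> x \<in> {(a, js ! i) | a i. i < length w \<and> w ! i = enat a}"
    by (force simp: not_infinity_eq)
  finally show "x \<in> set (word_simplex js w) \<longleftrightarrow> x \<in> {(a, js ! i) | a i. i < length w \<and> w ! i = enat a}" .
qed

lemma mem_placed:
  assumes "finite B" "length w = card B" "i < card B"
  shows "(a, sorted_list_of_set B ! i) \<in> placed B w \<longleftrightarrow> w ! i = enat a"
proof -
  have "length (sorted_list_of_set B) = length w" using assms by simp
  note this[THEN set_word_simplex, folded placed_def]
  moreover have "sorted_list_of_set B ! i = sorted_list_of_set B ! i' \<longleftrightarrow> i = i'" if "i' < card B" for i'
    using assms that by (simp add: nth_eq_iff_index_eq)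
  ultimately show ?thesis using assms by auto
qed

context
  fixes A B :: "nat set"
  assumes finA: "finite A" and finB: "finite B" and cardB: "card B = Suc (card A)"
begin

abbreviation "block_words \<equiv> permutations_of_set (insert \<infinity> (enat ` A))"

lemma block_wordsD:
  assumes "w \<in> block_words"
  shows "set w = insert \<infinity> (enat ` A)" "distinct w" "length w = card B"
proof -
  show s: "set w = insert \<infinity> (enat ` A)" and d: "distinct w"
    using assms by (simp_all add: permutations_of_set_def)
  have "length w = card (insert \<infinity> (enat ` A))" using distinct_card[OF d] s by simp
  also have "\<dots> = Suc (card (enat ` A))" using finA by (intro card_insert_disjoint) auto
  also have "\<dots> = card B" by (simp add: cardB card_image inj_on_def)
  finally show "length w = card B" .
qed

lemma placed_full:
  assumes "w \<in> block_words"
  shows "placed B w \<in> full_faces A B"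
proof -
  note w = block_wordsD[OF assms]
  let ?js = "sorted_list_of_set B"
  have p: "placed B w = {(a, ?js ! i) | a i. i < length w \<and> w ! i = enat a}"
    using w(3) finB unfolding placed_def by (intro set_word_simplex) simp
  have nth_inj: "i < length w \<Longrightarrow> i' < length w \<Longrightarrow> ?js ! i = ?js ! i' \<longleftrightarrow> i = i'" for i i'
    using w(3) finB by (simp add: nth_eq_iff_index_eq)
  have "?js ! i \<in> B" if "i < length w" for i
    using that w(3) finB nth_mem[of i ?js] by simp
  moreover have "a \<in> A" if "i < length w" "w ! i = enat a" for a i
    using that nth_mem[of i w] w(1) by auto
  ultimately have sub: "placed B w \<subseteq> A \<times> B" unfolding p by blast
  have inj1: "inj_on fst (placed B w)"
  proof (rule inj_onI)
    fix x y assume "x \<in> placed B w" "y \<in> placed B w" "fst x = fst y"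
    then obtain a i i' where "x = (a, ?js ! i)" "y = (a, ?js ! i')" "i < length w" "i' < length w"
      "w ! i = enat a" "w ! i' = enat a" unfolding p by auto
    moreover from this have "i = i'" using w(2) by (metis nth_eq_iff_index_eq)
    ultimately show "x = y" by simp
  qed
  have inj2: "inj_on snd (placed B w)"
  proof (rule inj_onI)
    fix x y assume "x \<in> placed B w" "y \<in> placed B w" "snd x = snd y"
    then obtain a b i i' where *: "x = (a, ?js ! i)" "y = (b, ?js ! i')" "i < length w" "i' < length w"
      "w ! i = enat a" "w ! i' = enat b" "?js ! i = ?js ! i'" unfolding p by auto
    then have "i = i'" using nth_inj by blast
    then show "x = y" using * by simp
  qed
  have "A \<subseteq> fst ` placed B w"
  proof
    fix a assume "a \<in> A"
    then have "enat a \<in> set w" using w(1) by simp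
    then obtain i where "i < length w" "w ! i = enat a" by (metis in_set_conv_nth)
    then have "(a, ?js ! i) \<in> placed B w" unfolding p by blast
    then show "a \<in> fst ` placed B w" by (metis fst_conv image_eqI)
  qed
  then have "fst ` placed B w = A" using sub by auto
  then show ?thesis using chessboardI[OF sub inj1 inj2] by (simp add: full_faces_def)
qed

lemma placed_inject:
  assumes "w \<in> block_words" "v \<in> block_words" "placed B w = placed B v"
  shows "w = v"
proof (rule nth_equalityI)
  show "length w = length v" using block_wordsD(3) assms by simp
  fix i assume "i < length w"
  then have i: "i < card B" using block_wordsD(3)[OF assms(1)] by simp
  have eq: "w ! i = enat a \<longleftrightarrow> v ! i = enat a" for a
    using mem_placed[OF finB block_wordsD(3)[OF assms(1)] i, of a]
      mem_placed[OF finB block_wordsD(3)[OF assms(2)] i, of a] assms(3) by simp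
  show "w ! i = v ! i"
  proof (cases "w ! i")
    case (enat a)
    then show ?thesis using eq[of a] by metis
  next
    case infinity
    then have "v ! i \<noteq> enat a" for a using eq[of a] by simp
    then show ?thesis using infinity by (cases "v ! i") auto
  qed
qed

text \<open>
  Listed by increasing letters, the edges of a simplex are already in the order that orients the basis
  elements, and no sign remains.
\<close>

lemma rho_eq: "rho A B = (\<Sum>w\<in>block_words. frag_cmul (inv_sign (<) w) (frag_of (placed B w)))"
  unfolding rho_def
proof (rule sum.cong[OF refl])
  fix w assume w: "w \<in> block_words"
  let ?xs = "word_simplex (sorted_list_of_set B) w"
  let ?ys = "sort_key fst ?xs"
  have "distinct (map fst ?xs)"
  proof -
    have "distinct (filter (\<lambda>x. x \<noteq> \<infinity>) w)" using block_wordsD(2)[OF w] by simp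
    then have "distinct (map the_enat (filter (\<lambda>x. x \<noteq> \<infinity>) w))"
      unfolding distinct_map by (auto simp: inj_on_def)
    moreover have "map fst (word_simplex js w) = map the_enat (filter (\<lambda>x. x \<noteq> \<infinity>) w)"
      if "length js = length w" for js
      using that by (induction js w rule: list_induct2) (auto simp: word_simplex_def)
    ultimately show ?thesis using block_wordsD(3)[OF w] finB by simp
  qed
  then have "distinct (map fst ?ys)"
    by (metis mset_eq_imp_distinct_iff mset_map mset_sort)
  then have srt: "sorted_wrt (<) (map fst ?ys)"
    using sorted_sort_key[of fst ?xs] by (simp only: strict_sorted_iff simp_thms)
  have "\<not> vless (?ys ! j) (?ys ! i)" if "i < j" "j < length ?ys" for i j
    using sorted_wrt_nth_less[OF srt that(1)] that unfolding vless_def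
    by (cases "?ys ! i"; cases "?ys ! j") auto
  then have "inversions vless ?ys = {}" by (auto simp: inversions_def)
  then have "oriented_simplex ?ys = frag_of (placed B w)"
    by (simp add: oriented_simplex_def inv_sign_def placed_def)
  then show "frag_cmul (inv_sign (<) w) (oriented_simplex ?ys) = frag_cmul (inv_sign (<) w) (frag_of (placed B w))"
    by simp
qed

lemma lookup_rho:
  "coeff (rho A B) F = (\<Sum>w\<in>block_words. inv_sign (<) w * (if placed B w = F then 1 else 0))"
  by (auto simp: rho_eq lookup_sum lookup_frag_of intro!: sum.cong)

lemma lookup_rho_placed:
  assumes "w \<in> block_words"
  shows "coeff (rho A B) (placed B w) = inv_sign (<) w"
proof -
  have "coeff (rho A B) (placed B w) = (\<Sum>v\<in>block_words. if v = w then inv_sign (<) v else 0)"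
    unfolding lookup_rho using placed_inject[OF _ assms] by (intro sum.cong) auto
  then show ?thesis using assms finA by simp
qed

lemma rho_full: "support (rho A B) \<subseteq> full_faces A B"
proof
  fix F assume F: "F \<in> support (rho A B)"
  have "\<exists>w\<in>block_words. placed B w = F"
  proof (rule ccontr)
    assume "\<not> (\<exists>w\<in>block_words. placed B w = F)"
    then have "coeff (rho A B) F = 0" unfolding lookup_rho by (intro sum.neutral) auto
    then show False using F by (simp add: in_keys_iff)
  qed
  then show "F \<in> full_faces A B" using placed_full by blast
qed

text \<open>
  Exchanging \<open>a\<close> with \<open>\<infinity>\<close> reverses the sign of a word and moves no other letter, so that the words which
  leave \<open>G\<close> after the removal of \<open>a\<close> cancel in pairs.
\<close>

lemma rho_letter_sum:
  assumes a: "a \<in> A" and G: "G \<subseteq> (A - {a}) \<times> UNIV"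
  shows "(\<Sum>j\<in>B. coeff (rho A B) (insert (a, j) G)) = 0"
proof -
  define r where "r w = {x \<in> placed B w. fst x \<noteq> a}" for w
  define t where "t = map (transpose (enat a) \<infinity>)"
  have one: "(\<Sum>j\<in>B. if placed B w = insert (a, j) G then 1 else 0) = (if r w = G then 1 else (0::int))"
    if w: "w \<in> block_words" for w
  proof -
    note F = placed_full[OF w]
    have F': "placed B w \<subseteq> A \<times> B" "inj_on fst (placed B w)" "fst ` placed B w = A"
      using F chessboardD[of "placed B w"] by (auto simp: full_faces_def)
    obtain i where i: "(a, i) \<in> placed B w" using a F'(3) by force
    have iB: "i \<in> B" using i F'(1) by auto
    have uniq: "j = i" if "(a, j) \<in> placed B w" for j
      using inj_onD[OF F'(2), of "(a, j)" "(a, i)"] that i by simp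
    have split: "placed B w = insert (a, i) (r w)"
    proof (intro equalityI subsetI)
      fix x assume x: "x \<in> placed B w"
      show "x \<in> insert (a, i) (r w)"
      proof (cases "fst x = a")
        case True
        then have "x = (a, snd x)" by (cases x) simp
        then show ?thesis using uniq[of "snd x"] x by simp
      next
        case False
        then show ?thesis using x by (simp add: r_def)
      qed
    qed (use i in \<open>auto simp: r_def\<close>)
    have "placed B w = insert (a, j) G \<longleftrightarrow> j = i \<and> r w = G" for j
    proof
      assume *: "placed B w = insert (a, j) G"
      then have "j = i" using uniq[of j] by blast
      moreover have "r w = G" unfolding r_def * using G by auto
      ultimately show "j = i \<and> r w = G" by simp
    qed (use split in auto)
    then have "(\<Sum>j\<in>B. if placed B w = insert (a, j) G then 1 else 0) =
        (\<Sum>j\<in>B. if j = i then (if r w = G then 1 else (0::int)) else 0)"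
      by (intro sum.cong) auto
    then show ?thesis using iB finB by simp
  qed
  have "(\<Sum>j\<in>B. coeff (rho A B) (insert (a, j) G)) =
      (\<Sum>w\<in>block_words. inv_sign (<) w * (\<Sum>j\<in>B. if placed B w = insert (a, j) G then 1 else 0))"
    unfolding lookup_rho by (subst sum.swap) (simp add: sum_distrib_left)
  also have "\<dots> = (\<Sum>w\<in>block_words. inv_sign (<) w * (if r w = G then 1 else 0))" (is "_ = ?S")
    using one by (intro sum.cong) auto
  also have "?S = 0"
  proof -
    have tt: "t (t w) = w" for w by (simp add: t_def o_def)
    have t: "t w \<in> block_words" if w: "w \<in> block_words" for w
    proof -
      have "set (t w) = transpose (enat a) \<infinity> ` insert \<infinity> (enat ` A)"
        using block_wordsD(1)[OF w] by (simp add: t_def)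
      also have "\<dots> = insert \<infinity> (enat ` A)"
        using a by (intro transpose_image_eq) simp
      finally have "set (t w) = insert \<infinity> (enat ` A)" .
      moreover have "distinct (t w)"
        using block_wordsD(2)[OF w] by (simp add: t_def distinct_map)
      ultimately show ?thesis by (simp add: permutations_of_set_def)
    qed
    have rt: "r (t w) = r w" if w: "w \<in> block_words" for w
    proof -
      have p: "placed B w = {(b, sorted_list_of_set B ! i) | b i. i < length w \<and> w ! i = enat b}"
        if "w \<in> block_words" for w
        using block_wordsD(3)[OF that] finB unfolding placed_def by (intro set_word_simplex) simp
      have tw: "t w ! i = enat b \<longleftrightarrow> w ! i = enat b" if "i < length w" "b \<noteq> a" for i b
        using that by (auto simp: t_def transpose_def)
      have len: "length (t w) = length w" by (simp add: t_def)
      show ?thesis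
        unfolding r_def p[OF w] p[OF t[OF w]] len using tw by fastforce
    qed
    have st: "inv_sign (<) (t w) = - inv_sign (<) w" if w: "w \<in> block_words" for w
      unfolding t_def using block_wordsD[OF w] a by (intro inv_sign_transpose) auto
    have "?S = (\<Sum>w\<in>block_words. inv_sign (<) (t w) * (if r (t w) = G then 1 else 0))"
      by (rule sum.reindex_bij_witness[of _ t t]) (auto simp: tt t)
    also have "\<dots> = (\<Sum>w\<in>block_words. - (inv_sign (<) w * (if r w = G then 1 else 0)))"
      using rt st by (intro sum.cong) auto
    also have "\<dots> = - ?S" by (rule sum_negf)
    finally show ?thesis by simp
  qed
  finally show ?thesis .
qed

end

section \<open>Wedge products\<close>

lemma lookup_frag_extend:
  "coeff (frag_extend f c) G =
     (\<Sum>F\<in>support c. coeff c F * coeff (f F) G)"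
  by (simp add: frag_extend_def lookup_sum)

text \<open>
  As edges are ordered by their left vertices, the sign of the concatenation depends on \<open>A\<close> and \<open>A'\<close> only, and
  a face has at most one decomposition along \<open>A\<close> and \<open>A'\<close>.
\<close>

lemma lookup_wedge:
  assumes "finite A" "finite A'" "A \<inter> A' = {}"
    and c: "support c \<subseteq> full_faces A B" and d: "support d \<subseteq> full_faces A' B'"
    and H: "fst ` H \<subseteq> A \<union> A'"
  shows "coeff (wedge c d) H =
    (-1) ^ card {(a, b) \<in> A \<times> A'. b < a} *
      coeff c (H \<inter> A \<times> UNIV) * coeff d (H \<inter> A' \<times> UNIV)"
proof -
  let ?s = "(-1) ^ card {(a, b) \<in> A \<times> A'. b < a} :: int"
  let ?H = "H \<inter> A \<times> UNIV" and ?H' = "H \<inter> A' \<times> UNIV"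
  have sgn: "card {(u, v) \<in> F \<times> G. vless v u} = card {(a, b) \<in> A \<times> A'. b < a}"
    if F: "F \<in> full_faces A B" and G: "G \<in> full_faces A' B'" for F G
  proof -
    have F': "inj_on fst F" "fst ` F = A" and G': "inj_on fst G" "fst ` G = A'"
      using F G chessboardD(2)[of F A B] chessboardD(2)[of G A' B'] by (auto simp: full_faces_def)
    have ne: "fst u \<noteq> fst v" if "u \<in> F" "v \<in> G" for u v
      using that F'(2) G'(2) assms(3) by blast
    have "bij_betw (map_prod fst fst) {(u, v) \<in> F \<times> G. vless v u} {(a, b) \<in> A \<times> A'. b < a}"
    proof (rule bij_betwI')
      fix x y assume xy: "x \<in> {(u, v) \<in> F \<times> G. vless v u}" "y \<in> {(u, v) \<in> F \<times> G. vless v u}"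
      show "map_prod fst fst x = map_prod fst fst y \<longleftrightarrow> x = y"
      proof
        assume eq: "map_prod fst fst x = map_prod fst fst y"
        have "fst x = fst y" using eq xy by (intro inj_onD[OF F'(1)]) (auto simp: map_prod_def split: prod.splits)
        moreover have "snd x = snd y" using eq xy by (intro inj_onD[OF G'(1)]) (auto simp: map_prod_def split: prod.splits)
        ultimately show "x = y" by (rule prod_eqI)
      qed simp
    next
      fix x assume x: "x \<in> {(u, v) \<in> F \<times> G. vless v u}"
      obtain u v where uv: "x = (u, v)" by (cases x)
      then have "u \<in> F" "v \<in> G" "vless v u" using x by auto
      then have "fst v < fst u" using ne[of u v] by (cases u; cases v) (auto simp: vless_def)
      then show "map_prod fst fst x \<in> {(a, b) \<in> A \<times> A'. b < a}"
        using \<open>u \<in> F\<close> \<open>v \<in> G\<close> F'(2) G'(2) by (auto simp: uv)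
    next
      fix y assume "y \<in> {(a, b) \<in> A \<times> A'. b < a}"
      then obtain a b where ab: "y = (a, b)" "a \<in> A" "b \<in> A'" "b < a" by auto
      then obtain u v where uv: "u \<in> F" "v \<in> G" "fst u = a" "fst v = b" using F'(2) G'(2) by blast
      then have "(u, v) \<in> {(u, v) \<in> F \<times> G. vless v u}"
        using ab by (cases u; cases v) (auto simp: vless_def)
      then show "\<exists>x\<in>{(u, v) \<in> F \<times> G. vless v u}. y = map_prod fst fst x"
        using uv ab by (intro bexI[of _ "(u, v)"]) auto
    qed
    then show ?thesis by (rule bij_betw_same_card)
  qed
  have union: "F \<union> G = H \<longleftrightarrow> F = ?H \<and> G = ?H'"
    if F: "F \<in> full_faces A B" and G: "G \<in> full_faces A' B'" for F G
  proof
    have sub: "F \<subseteq> A \<times> UNIV" "G \<subseteq> A' \<times> UNIV"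
      using F G chessboardD(1)[of F A B] chessboardD(1)[of G A' B'] unfolding full_faces_def by blast+
    assume "F \<union> G = H"
    then show "F = ?H \<and> G = ?H'" using sub assms(3) by blast
  next
    assume "F = ?H \<and> G = ?H'"
    moreover have "H = ?H \<union> ?H'" using H by fastforce
    ultimately show "F \<union> G = H" by simp
  qed
  have "coeff (wedge c d) H =
      (\<Sum>F\<in>support c. coeff c F *
        (\<Sum>G\<in>support d. coeff d G *
          ((-1) ^ card {(u, v) \<in> F \<times> G. vless v u} * (if F \<union> G = H then 1 else 0))))"
    unfolding wedge_def lookup_frag_extend by (auto simp: lookup_frag_of intro!: sum.cong)
  also have "\<dots> = (\<Sum>F\<in>support c. coeff c F *
        (\<Sum>G\<in>support d. if G = ?H' then (if F = ?H then ?s * coeff d G else 0) else 0))"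
  proof (intro sum.cong refl arg_cong2[of _ _ _ _ "(*)"])
    fix F G assume "F \<in> support c" "G \<in> support d"
    then have FG: "F \<in> full_faces A B" "G \<in> full_faces A' B'" using c d by auto
    show "coeff d G * ((-1) ^ card {(u, v) \<in> F \<times> G. vless v u} * (if F \<union> G = H then 1 else 0)) =
      (if G = ?H' then (if F = ?H then ?s * coeff d G else 0) else 0)"
      unfolding sgn[OF FG] union[OF FG] by simp
  qed
  also have "\<dots> = (\<Sum>F\<in>support c. if F = ?H then ?s * coeff c ?H * coeff d ?H' else 0)"
    by (intro sum.cong refl) (auto simp: in_keys_iff)
  also have "\<dots> = ?s * coeff c ?H * coeff d ?H'"
    by (auto simp: in_keys_iff)
  finally show ?thesis .
qed

lemma keys_wedge:
  assumes "A \<inter> A' = {}" "B \<inter> B' = {}"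
    and "support c \<subseteq> full_faces A B" "support d \<subseteq> full_faces A' B'"
  shows "support (wedge c d) \<subseteq> full_faces (A \<union> A') (B \<union> B')"
proof
  fix H assume "H \<in> support (wedge c d)"
  then have "coeff (wedge c d) H \<noteq> 0" by (simp add: in_keys_iff)
  then obtain F where F: "F \<in> support c" and
    "coeff (frag_extend (\<lambda>G. frag_cmul ((-1) ^ card {(u, v) \<in> F \<times> G. vless v u}) (frag_of (F \<union> G))) d) H \<noteq> 0"
    unfolding wedge_def lookup_frag_extend[of _ c]
    by (metis (no_types, lifting) mult_eq_0_iff sum.neutral)
  then obtain G where G: "G \<in> support d" and
    "coeff (frag_cmul ((-1) ^ card {(u, v) \<in> F \<times> G. vless v u}) (frag_of (F \<union> G))) H \<noteq> 0"
    unfolding lookup_frag_extend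
    by (metis (no_types, lifting) mult_eq_0_iff sum.neutral)
  then have "F \<union> G = H" by (simp add: lookup_frag_of split: if_splits)
  then show "H \<in> full_faces (A \<union> A') (B \<union> B')"
    using full_faces_Un[of F A B G A' B'] F G assms by blast
qed

lemma wedge_product:
  fixes A B :: "'i \<Rightarrow> nat set" and f :: "'i \<Rightarrow> chain"
  assumes "distinct cs" "\<And>c. c \<in> set cs \<Longrightarrow> finite (A c)"
    and "\<And>c c'. c \<in> set cs \<Longrightarrow> c' \<in> set cs \<Longrightarrow> c \<noteq> c' \<Longrightarrow> A c \<inter> A c' = {} \<and> B c \<inter> B c' = {}"
    and "\<And>c. c \<in> set cs \<Longrightarrow> support (f c) \<subseteq> full_faces (A c) (B c)"
  shows "support (foldr wedge (map f cs) (frag_of {})) \<subseteq>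
      full_faces (\<Union>c\<in>set cs. A c) (\<Union>c\<in>set cs. B c) \<and>
    (\<exists>s\<in>{1, -1}. \<forall>H. fst ` H \<subseteq> (\<Union>c\<in>set cs. A c) \<longrightarrow>
      coeff (foldr wedge (map f cs) (frag_of {})) H =
        s * (\<Prod>c\<in>set cs. coeff (f c) (H \<inter> A c \<times> UNIV)))"
  using assms
proof (induction cs)
  case Nil
  then show ?case
    by (auto simp: full_faces_def chessboard_def lookup_frag_of intro!: bexI[of _ 1])
next
  case (Cons c cs)
  let ?E = "foldr wedge (map f cs) (frag_of {})"
  let ?A = "\<Union>c\<in>set cs. A c" and ?B = "\<Union>c\<in>set cs. B c"
  have "support ?E \<subseteq> full_faces ?A ?B \<and>
    (\<exists>s\<in>{1, -1}. \<forall>H. fst ` H \<subseteq> ?A \<longrightarrow> coeff ?E H =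
        s * (\<Prod>c\<in>set cs. coeff (f c) (H \<inter> A c \<times> UNIV)))"
    using Cons.prems by (intro Cons.IH) auto
  then obtain s where keysE: "support ?E \<subseteq> full_faces ?A ?B" and s: "s \<in> {1, -1}"
    and E: "\<And>H. fst ` H \<subseteq> ?A \<Longrightarrow> coeff ?E H =
        s * (\<Prod>c\<in>set cs. coeff (f c) (H \<inter> A c \<times> UNIV))" by blast
  have disj: "A c \<inter> ?A = {}" "B c \<inter> ?B = {}" using Cons.prems(1,3) by fastforce+
  have keysf: "support (f c) \<subseteq> full_faces (A c) (B c)" using Cons.prems(4) by simp
  define e :: int where "e = (-1) ^ card {(a, b) \<in> A c \<times> ?A. b < a}"
  have "coeff (wedge (f c) ?E) H =
      (e * s) * (\<Prod>c\<in>set (c # cs). coeff (f c) (H \<inter> A c \<times> UNIV))"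
    if H: "fst ` H \<subseteq> (\<Union>c\<in>set (c # cs). A c)" for H
  proof -
    have "coeff (wedge (f c) ?E) H =
        e * coeff (f c) (H \<inter> A c \<times> UNIV) * coeff ?E (H \<inter> ?A \<times> UNIV)"
      unfolding e_def using Cons.prems(2) H by (intro lookup_wedge[OF _ _ disj(1) keysf keysE]) auto
    also have "coeff ?E (H \<inter> ?A \<times> UNIV) =
        s * (\<Prod>d\<in>set cs. coeff (f d) (H \<inter> ?A \<times> UNIV \<inter> A d \<times> UNIV))"
      by (intro E) auto
    also have "(\<Prod>d\<in>set cs. coeff (f d) (H \<inter> ?A \<times> UNIV \<inter> A d \<times> UNIV)) =
        (\<Prod>d\<in>set cs. coeff (f d) (H \<inter> A d \<times> UNIV))"
      by (intro prod.cong refl arg_cong2[of _ _ _ _ coeff]) auto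
    finally show ?thesis using Cons.prems(1) by (simp add: mult_ac)
  qed
  moreover have "e * s \<in> {1, -1}"
    using s unfolding e_def by (cases "even (card {(a, b) \<in> A c \<times> ?A. b < a})") auto
  moreover have "support (wedge (f c) ?E) \<subseteq> full_faces (A c \<union> ?A) (B c \<union> ?B)"
    by (intro keys_wedge disj keysf keysE)
  ultimately show ?case by (intro conjI bexI[of _ "e * s"]) auto
qed

lemma boundary_eq_0I:
  assumes "finite X" "finite Y" "support c \<subseteq> full_faces X Y"
    and sum0: "\<And>a G. a \<in> X \<Longrightarrow> fst ` G = X - {a} \<Longrightarrow>
      (\<Sum>j\<in>Y. coeff c (insert (a, j) G)) = 0"
  shows "boundary c = 0"
proof (rule poly_mapping_eqI)
  fix G
  have look: "coeff (boundary c) G =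
      (\<Sum>F\<in>support c. coeff c F * coeff (boundary (frag_of F)) G)"
    unfolding boundary_def lookup_frag_extend[of _ c] by simp
  show "coeff (boundary c) G = coeff 0 G"
  proof (cases "\<exists>a\<in>X. fst ` G = X - {a}")
    case False
    have "coeff (boundary (frag_of F)) G = 0" if F: "F \<in> support c" for F
    proof -
      have F': "inj_on fst F" "fst ` F = X"
        using F assms(3) chessboardD(2) by (auto simp: full_faces_def)
      have "F - {v} \<noteq> G" if v: "v \<in> F" for v
      proof
        assume "F - {v} = G"
        then have "fst ` G = X - {fst v}" using inj_on_image_set_diff[OF F'(1), of F "{v}"] v F'(2) by auto
        moreover have "fst v \<in> X" using v F'(2) by auto
        ultimately show False using False by blast
      qed
      then show ?thesis unfolding lookup_boundary_frag_of by (intro sum.neutral) auto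
    qed
    then show ?thesis unfolding look by simp
  next
    case True
    then obtain a where a: "a \<in> X" "fst ` G = X - {a}" by blast
    define s :: int where "s = (-1) ^ card {b \<in> X. b < a}"
    let ?f = "\<lambda>j. insert (a, j) G"
    have inj: "inj_on ?f Y"
    proof (rule inj_onI)
      fix i j assume "?f i = ?f j"
      then have "(a, i) \<in> ?f j" by blast
      moreover have "(a, i) \<notin> G" using a(2) by (metis DiffD2 fst_conv image_eqI singletonI)
      ultimately show "i = j" by simp
    qed
    have "coeff (boundary c) G =
        (\<Sum>F\<in>support c. coeff c F * (if \<exists>j. F = ?f j then s else 0))"
      unfolding look s_def
    proof (intro sum.cong refl arg_cong2[of _ _ _ _ "(*)"])
      fix F assume "F \<in> support c"
      then show "coeff (boundary (frag_of F)) G =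
          (if \<exists>j. F = ?f j then (-1) ^ card {b \<in> X. b < a} else 0)"
        using assms(3) by (intro lookup_boundary_full_face[OF assms(1) _ a]) auto
    qed
    also have "\<dots> = (\<Sum>F\<in>support c \<union> ?f ` Y. coeff c F * (if \<exists>j. F = ?f j then s else 0))"
      using assms(2) by (intro sum.mono_neutral_left) (auto simp: in_keys_iff)
    also have "\<dots> = (\<Sum>F\<in>?f ` Y. coeff c F * (if \<exists>j. F = ?f j then s else 0))"
    proof (intro sum.mono_neutral_right ballI)
      fix F assume F: "F \<in> support c \<union> ?f ` Y - ?f ` Y"
      then have "F \<in> chessboard X Y" using assms(3) by (auto simp: full_faces_def)
      then have FY: "F \<subseteq> X \<times> Y" by (rule chessboardD(1))
      have "\<not> (\<exists>j. F = ?f j)"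
      proof
        assume "\<exists>j. F = ?f j"
        then obtain j where "F = ?f j" by blast
        moreover from this have "j \<in> Y" using FY by blast
        ultimately show False using F by blast
      qed
      then show "coeff c F * (if \<exists>j. F = ?f j then s else 0) = 0" by simp
    qed (use assms(2) in auto)
    also have "\<dots> = (\<Sum>j\<in>Y. coeff c (?f j) * s)"
      by (subst sum.reindex[OF inj]) (auto intro!: sum.cong)
    also have "\<dots> = (\<Sum>j\<in>Y. coeff c (?f j)) * s" by (simp add: sum_distrib_right)
    finally show ?thesis using sum0[OF a] by simp
  qed
qed

text \<open>
  Moving the letter \<open>a\<close> changes only the factor whose letters contain \<open>a\<close>, and the sum for this factor
  vanishes.
\<close>

lemma wedge_product_letter_sum:
  fixes A B :: "'i \<Rightarrow> nat set" and f :: "'i \<Rightarrow> chain"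
  assumes "distinct cs" "\<And>c. c \<in> set cs \<Longrightarrow> finite (A c)"
    and disj: "\<And>c c'. c \<in> set cs \<Longrightarrow> c' \<in> set cs \<Longrightarrow> c \<noteq> c' \<Longrightarrow> A c \<inter> A c' = {} \<and> B c \<inter> B c' = {}"
    and keys: "\<And>c. c \<in> set cs \<Longrightarrow> support (f c) \<subseteq> full_faces (A c) (B c)"
    and Y: "finite Y" "\<And>c. c \<in> set cs \<Longrightarrow> B c \<subseteq> Y"
    and sum0: "\<And>c a G. c \<in> set cs \<Longrightarrow> a \<in> A c \<Longrightarrow> G \<subseteq> (A c - {a}) \<times> UNIV \<Longrightarrow>
      (\<Sum>j\<in>B c. coeff (f c) (insert (a, j) G)) = 0"
    and a: "a \<in> (\<Union>c\<in>set cs. A c)" and G: "fst ` G = (\<Union>c\<in>set cs. A c) - {a}"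
  shows "(\<Sum>j\<in>Y. coeff (foldr wedge (map f cs) (frag_of {})) (insert (a, j) G)) = 0"
proof -
  obtain s where E: "\<And>H. fst ` H \<subseteq> (\<Union>c\<in>set cs. A c) \<Longrightarrow>
      coeff (foldr wedge (map f cs) (frag_of {})) H =
        s * (\<Prod>c\<in>set cs. coeff (f c) (H \<inter> A c \<times> UNIV))"
    using wedge_product[of cs A B f, OF assms(1-4)] by blast
  obtain c where c: "c \<in> set cs" "a \<in> A c" using a by blast
  define P where "P = (\<Prod>d\<in>set cs - {c}. coeff (f d) (G \<inter> A d \<times> UNIV))"
  let ?G = "G \<inter> A c \<times> UNIV"
  have "coeff (foldr wedge (map f cs) (frag_of {})) (insert (a, j) G) =
      s * P * coeff (f c) (insert (a, j) ?G)" for j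
  proof -
    have "fst ` insert (a, j) G \<subseteq> (\<Union>c\<in>set cs. A c)" using a G by auto
    then have "coeff (foldr wedge (map f cs) (frag_of {})) (insert (a, j) G) =
        s * (\<Prod>d\<in>set cs. coeff (f d) (insert (a, j) G \<inter> A d \<times> UNIV))" by (rule E)
    also have "(\<Prod>d\<in>set cs. coeff (f d) (insert (a, j) G \<inter> A d \<times> UNIV)) =
        coeff (f c) (insert (a, j) G \<inter> A c \<times> UNIV) *
        (\<Prod>d\<in>set cs - {c}. coeff (f d) (insert (a, j) G \<inter> A d \<times> UNIV))"
      using c(1) by (intro prod.remove) auto
    also have "(\<Prod>d\<in>set cs - {c}. coeff (f d) (insert (a, j) G \<inter> A d \<times> UNIV)) = P"
      unfolding P_def
    proof (intro prod.cong refl arg_cong2[of _ _ _ _ coeff])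
      fix d assume "d \<in> set cs - {c}"
      then have "a \<notin> A d" using disj[of c d] c by blast
      then show "insert (a, j) G \<inter> A d \<times> UNIV = G \<inter> A d \<times> UNIV" by auto
    qed
    also have "insert (a, j) G \<inter> A c \<times> UNIV = insert (a, j) ?G" using c(2) by auto
    finally show ?thesis by simp
  qed
  then have "(\<Sum>j\<in>Y. coeff (foldr wedge (map f cs) (frag_of {})) (insert (a, j) G)) =
      s * P * (\<Sum>j\<in>Y. coeff (f c) (insert (a, j) ?G))"
    by (simp add: sum_distrib_left)
  also have "(\<Sum>j\<in>Y. coeff (f c) (insert (a, j) ?G)) =
      (\<Sum>j\<in>B c. coeff (f c) (insert (a, j) ?G))"
  proof (intro sum.mono_neutral_right Y c ballI)
    fix j assume j: "j \<in> Y - B c"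
    have "insert (a, j) ?G \<notin> full_faces (A c) (B c)"
      using j chessboardD(1)[of "insert (a, j) ?G" "A c" "B c"] by (auto simp: full_faces_def)
    then show "coeff (f c) (insert (a, j) ?G) = 0"
      using keys[OF c(1)] by (auto simp: in_keys_iff)
  qed
  also have "\<dots> = 0"
  proof (rule sum0[OF c])
    show "?G \<subseteq> (A c - {a}) \<times> UNIV"
    proof
      fix x assume x: "x \<in> ?G"
      then have "fst x \<in> fst ` G" by blast
      then show "x \<in> (A c - {a}) \<times> UNIV" using G x by (cases x) auto
    qed
  qed
  finally show ?thesis by simp
qed

section \<open>Triangularity of the pairing\<close>

lemma abs_inv_sign: "\<bar>inv_sign lt xs\<bar> = 1"
  by (simp add: inv_sign_def power_abs)

lemma set_word_simplex_upt:
  assumes "length w = n"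
  shows "set (word_simplex [1..<Suc n] w) = word_face w"
proof -
  have "set (word_simplex [1..<Suc n] w) = {(a, [1..<Suc n] ! i) | a i. i < length w \<and> w ! i = enat a}"
    using assms by (intro set_word_simplex) simp
  also have "\<dots> = word_face w"
  proof -
    have "[1..<Suc n] ! i = Suc i" if "i < n" for i using that by (simp del: upt_Suc)
    then show ?thesis unfolding word_face_def assms by metis
  qed
  finally show ?thesis .
qed

context
  fixes m n :: nat and S T :: "nat tableau"
  assumes m: "m \<le> n" and pair: "(S, T) \<in> tableau_pairs m n"
begin

private definition "col i = fst (rs_pops m n S T ! i)"

private abbreviation "w \<equiv> rs_word m n S T"
private abbreviation "A \<equiv> pop_entries m n S T"
private abbreviation "B \<equiv> pop_positions m n S T"

private lemma w: "w \<in> words m n" by (rule rs_word_in_words[OF pair])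

lemma length_rs_pops: "length (rs_pops m n S T) = n"
  by (simp add: tableau_pairsD(6)[OF pair])

lemma w_nth: "i < n \<Longrightarrow> w ! i = snd (rs_pops m n S T ! i)"
  by (simp add: rs_word_def length_rs_pops)

lemma col_less: "i < n \<Longrightarrow> col i < n - m"
  using pops_column_decreasing[OF tableau_pairsD(3,4,5)[OF pair]] tableau_pairsD(7)[OF pair]
  by (simp add: col_def tableau_pairsD(6)[OF pair])

lemma col_decreasing: "i < j \<Longrightarrow> j < n \<Longrightarrow> col i = col j \<Longrightarrow> w ! j < w ! i"
  using pops_column_decreasing[OF tableau_pairsD(3,4,5)[OF pair]]
  by (simp add: col_def w_nth tableau_pairsD(6)[OF pair])

lemma col_letter_unique:
  assumes "i < n" "j < n" "col i = col j" "w ! i = w ! j"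
  shows "i = j"
  using col_decreasing[of i j] col_decreasing[of j i] assms by (cases i j rule: linorder_cases) auto

lemma mem_A: "a \<in> A c \<longleftrightarrow> (\<exists>i<n. col i = c \<and> w ! i = enat a)"
proof -
  have "a \<in> A c \<longleftrightarrow> (\<exists>i<n. rs_pops m n S T ! i = (c, enat a))"
    unfolding pop_entries_def in_set_conv_nth length_rs_pops by simp
  also have "\<dots> \<longleftrightarrow> (\<exists>i<n. col i = c \<and> w ! i = enat a)"
    using w_nth by (intro ex_cong1) (auto simp: col_def prod_eq_iff)
  finally show ?thesis .
qed

lemma B_eq: "B c = Suc ` {i. i < n \<and> col i = c}"
proof (rule Set.set_eqI)
  fix j
  show "j \<in> B c \<longleftrightarrow> j \<in> Suc ` {i. i < n \<and> col i = c}"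
    by (cases j) (auto simp: pop_positions_def col_def)
qed

lemma finite_A: "finite (A c)"
proof -
  have "A c \<subseteq> (\<lambda>i. the_enat (w ! i)) ` {..<n}"
  proof
    fix a assume "a \<in> A c"
    then obtain i where "i < n" "w ! i = enat a" using mem_A by blast
    then show "a \<in> (\<lambda>i. the_enat (w ! i)) ` {..<n}" by (intro image_eqI[of _ _ i]) auto
  qed
  then show ?thesis by (rule finite_subset) simp
qed

lemma finite_B: "finite (B c)" by (simp add: B_eq)

lemma B_subset: "B c \<subseteq> {1..n}" by (auto simp: B_eq)

lemma A_disjoint: "c \<noteq> c' \<Longrightarrow> A c \<inter> A c' = {}"
proof (rule ccontr)
  assume "c \<noteq> c'" "A c \<inter> A c' \<noteq> {}"
  then obtain a where "a \<in> A c" "a \<in> A c'" by blast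
  then obtain i j where "i < n" "j < n" "col i = c" "col j = c'" "w ! i = enat a" "w ! j = enat a"
    unfolding mem_A by metis
  then show False using words_letter_unique[OF m w, of i j] \<open>c \<noteq> c'\<close> by simp
qed

lemma B_disjoint: "c \<noteq> c' \<Longrightarrow> B c \<inter> B c' = {}" by (auto simp: B_eq)

lemma Union_A: "(\<Union>c\<in>{..<n - m}. A c) = {1..m}"
proof (intro equalityI subsetI)
  fix a assume "a \<in> (\<Union>c\<in>{..<n - m}. A c)"
  then have "\<exists>i<n. w ! i = enat a" using mem_A by fastforce
  then show "a \<in> {1..m}" by (rule iffD1[OF words_letter_iff[OF m w]])
next
  fix a assume "a \<in> {1..m}"
  then have "\<exists>i<n. w ! i = enat a" by (rule iffD2[OF words_letter_iff[OF m w]])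
  then obtain i where i: "i < n" "w ! i = enat a" by (elim exE conjE)
  then have "a \<in> A (col i)" unfolding mem_A by blast
  then show "a \<in> (\<Union>c\<in>{..<n - m}. A c)" using col_less[OF i(1)] by blast
qed

text \<open>
  The entries popped from one column are distinct, so each of the \<open>n - m\<close> columns pops \<open>\<infinity>\<close> at most once, and
  \<open>n - m\<close> letters \<open>\<infinity>\<close> are popped altogether.
\<close>

lemma infinity_in_col:
  assumes "c < n - m"
  obtains i where "i < n" "col i = c" "w ! i = \<infinity>"
proof -
  let ?I = "{i. i < n \<and> w ! i = \<infinity>}"
  have "inj_on col ?I" using col_letter_unique by (auto simp: inj_on_def)
  then have "card (col ` ?I) = n - m" using card_infinities_words[OF m w] by (simp add: card_image)
  moreover have "col ` ?I \<subseteq> {..<n - m}" using col_less by auto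
  ultimately have "col ` ?I = {..<n - m}" by (intro card_subset_eq) auto
  then have "c \<in> col ` ?I" using assms by simp
  then obtain i where "i \<in> ?I" "c = col i" by (rule imageE)
  then show thesis using that[of i] by simp
qed

lemma card_B:
  assumes "c < n - m"
  shows "card (B c) = Suc (card (A c))"
proof -
  obtain i where i: "i < n" "col i = c" "w ! i = \<infinity>" by (rule infinity_in_col[OF assms])
  let ?I = "{i. i < n \<and> col i = c}"
  have fin: "finite ?I" by simp
  have "card (B c) = card ?I" unfolding B_eq by (simp add: card_image)
  also have "\<dots> = Suc (card (?I - {i}))" using i fin by (intro card.remove) auto
  also have "card (?I - {i}) = card (A c)"
  proof (rule bij_betw_same_card)
    show "bij_betw (\<lambda>i. the_enat (w ! i)) (?I - {i}) (A c)"
    proof (rule bij_betwI')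
      have fin: "w ! j \<noteq> \<infinity>" if "j \<in> ?I - {i}" for j
        using col_letter_unique[of i j] that i by force
      fix j j' assume j: "j \<in> ?I - {i}" "j' \<in> ?I - {i}"
      show "the_enat (w ! j) = the_enat (w ! j') \<longleftrightarrow> j = j'"
      proof
        assume "the_enat (w ! j) = the_enat (w ! j')"
        then have "w ! j = w ! j'" using fin[OF j(1)] fin[OF j(2)] by auto
        then show "j = j'" using col_letter_unique j by simp
      qed simp
    next
      fix j assume j: "j \<in> ?I - {i}"
      then have "w ! j \<noteq> \<infinity>" using col_letter_unique[of i j] i by force
      then have "w ! j = enat (the_enat (w ! j))" by auto
      then show "the_enat (w ! j) \<in> A c" using j unfolding mem_A by blast
    next
      fix a assume "a \<in> A c"
      then obtain j where j: "j < n" "col j = c" "w ! j = enat a" unfolding mem_A by metis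
      then have "j \<noteq> i" using i by auto
      then show "\<exists>j\<in>?I - {i}. a = the_enat (w ! j)" using j by (intro bexI[of _ j]) auto
    qed
  qed
  finally show ?thesis .
qed

lemma lookup_rho_block:
  assumes c: "c < n - m"
  shows "\<bar>coeff (rho (A c) (B c)) (word_face w \<inter> A c \<times> UNIV)\<bar> = 1"
proof -
  let ?js = "sorted_list_of_set (B c)"
  define u where "u = map (\<lambda>j. w ! (j - 1)) ?js"
  have set_js: "set ?js = B c" using finite_B by simp
  have "set u = (\<lambda>j. w ! (j - 1)) ` B c" by (simp add: u_def set_js)
  also have "\<dots> = (\<lambda>i. w ! i) ` {i. i < n \<and> col i = c}" unfolding B_eq by (simp add: image_image)
  also have "\<dots> = insert \<infinity> (enat ` A c)"
  proof (intro equalityI subsetI)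
    fix x assume "x \<in> (\<lambda>i. w ! i) ` {i. i < n \<and> col i = c}"
    then obtain i where i: "i < n" "col i = c" "x = w ! i" by blast
    show "x \<in> insert \<infinity> (enat ` A c)"
    proof (cases x)
      case (enat a)
      then have "a \<in> A c" using i unfolding mem_A by metis
      then show ?thesis using enat by simp
    next
      case infinity
      then show ?thesis by simp
    qed
  next
    fix x assume "x \<in> insert \<infinity> (enat ` A c)"
    then consider "x = \<infinity>" | a where "a \<in> A c" "x = enat a" by blast
    then show "x \<in> (\<lambda>i. w ! i) ` {i. i < n \<and> col i = c}"
    proof cases
      case 1
      obtain i where "i < n" "col i = c" "w ! i = \<infinity>" by (rule infinity_in_col[OF c])
      then show ?thesis using 1 by (intro image_eqI[of _ _ i]) auto
    next
      case 2
      then obtain i where "i < n" "col i = c" "w ! i = enat a" unfolding mem_A by metis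
      then show ?thesis using 2 by (intro image_eqI[of _ _ i]) auto
    qed
  qed
  finally have set_u: "set u = insert \<infinity> (enat ` A c)" .
  have "inj_on (\<lambda>j. w ! (j - 1)) (B c)"
    unfolding B_eq using col_letter_unique by (auto simp: inj_on_def)
  then have "distinct u" by (simp add: u_def distinct_map set_js)
  then have u: "u \<in> permutations_of_set (insert \<infinity> (enat ` A c))"
    using set_u by (simp add: permutations_of_set_def)
  have "placed (B c) u = word_face w \<inter> A c \<times> UNIV"
  proof (rule Set.set_eqI)
    fix x :: vertex
    obtain a j where x: "x = (a, j)" by (cases x)
    have len: "length ?js = length u" by (simp add: u_def)
    have "x \<in> placed (B c) u \<longleftrightarrow> (\<exists>i<length u. j = ?js ! i \<and> u ! i = enat a)"
      unfolding placed_def set_word_simplex[OF len] x by auto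
    also have "\<dots> \<longleftrightarrow> (\<exists>i<length ?js. j = ?js ! i \<and> w ! (j - 1) = enat a)"
      unfolding u_def by (metis length_map nth_map)
    also have "\<dots> \<longleftrightarrow> j \<in> B c \<and> w ! (j - 1) = enat a"
      using in_set_conv_nth[of j ?js] unfolding set_js by metis
    also have "\<dots> \<longleftrightarrow> (\<exists>i<n. j = Suc i \<and> col i = c \<and> w ! i = enat a)"
      unfolding B_eq by auto
    also have "\<dots> \<longleftrightarrow> (\<exists>i<n. j = Suc i \<and> w ! i = enat a) \<and> a \<in> A c"
    proof
      assume "\<exists>i<n. j = Suc i \<and> col i = c \<and> w ! i = enat a"
      then show "(\<exists>i<n. j = Suc i \<and> w ! i = enat a) \<and> a \<in> A c" unfolding mem_A by metis
    next
      assume "(\<exists>i<n. j = Suc i \<and> w ! i = enat a) \<and> a \<in> A c"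
      then obtain i i' where i: "i < n" "j = Suc i" "w ! i = enat a" "i' < n" "col i' = c" "w ! i' = enat a"
        unfolding mem_A by metis
      then have "i = i'" using words_letter_unique[OF m w, of i i'] by simp
      then show "\<exists>i<n. j = Suc i \<and> col i = c \<and> w ! i = enat a" using i by metis
    qed
    also have "\<dots> \<longleftrightarrow> x \<in> word_face w \<inter> A c \<times> UNIV"
      unfolding x by (simp add: mem_word_face words_length[OF m w])
    finally show "x \<in> placed (B c) u \<longleftrightarrow> x \<in> word_face w \<inter> A c \<times> UNIV" .
  qed
  then show ?thesis
    using lookup_rho_placed[OF finite_A finite_B card_B[OF c] u] by (simp add: abs_inv_sign)
qed

lemma eta_product:
  shows "support (eta_cycle m n S T) \<subseteq> full_faces {1..m} (\<Union>c\<in>{..<n - m}. B c) \<and>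
    (\<exists>s\<in>{1, -1}. \<forall>H. fst ` H \<subseteq> {1..m} \<longrightarrow> coeff (eta_cycle m n S T) H =
        s * (\<Prod>c\<in>{..<n - m}. coeff (rho (A c) (B c)) (H \<inter> A c \<times> UNIV)))"
proof -
  have "set [0..<n - m] = {..<n - m}" by auto
  note wp = wedge_product[of "[0..<n - m]" A B "\<lambda>c. rho (A c) (B c)", unfolded this Union_A, folded eta_cycle_def]
  show ?thesis
  proof (rule wp)
    show "A c \<inter> A c' = {} \<and> B c \<inter> B c' = {}" if "c \<noteq> c'" for c c'
      using A_disjoint[OF that] B_disjoint[OF that] by simp
    show "support (rho (A c) (B c)) \<subseteq> full_faces (A c) (B c)" if "c \<in> {..<n - m}" for c
      using that by (intro rho_full finite_A finite_B card_B) simp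
  qed (simp_all add: finite_A)
qed

lemma eta_full: "support (eta_cycle m n S T) \<subseteq> full_faces {1..m} {1..n}"
proof -
  have "(\<Union>c\<in>{..<n - m}. B c) \<subseteq> {1..n}" using B_subset by blast
  from order.trans[OF conjunct1[OF eta_product] full_faces_mono[OF this]] show ?thesis .
qed

lemma boundary_eta: "boundary (eta_cycle m n S T) = 0"
proof (rule boundary_eq_0I[OF _ _ eta_full])
  fix a and G :: "vertex set"
  assume a: "a \<in> {1..m}" and G: "fst ` G = {1..m} - {a}"
  have "set [0..<n - m] = {..<n - m}" by auto
  note ls = wedge_product_letter_sum[of "[0..<n - m]" A B "\<lambda>c. rho (A c) (B c)" "{1..n}" a G,
      unfolded this Union_A, folded eta_cycle_def]
  show "(\<Sum>j\<in>{1..n}. coeff (eta_cycle m n S T) (insert (a, j) G)) = 0"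
  proof (rule ls)
    show "A c \<inter> A c' = {} \<and> B c \<inter> B c' = {}" if "c \<noteq> c'" for c c'
      using A_disjoint[OF that] B_disjoint[OF that] by simp
    show "support (rho (A c) (B c)) \<subseteq> full_faces (A c) (B c)" if "c \<in> {..<n - m}" for c
      using that by (intro rho_full finite_A finite_B card_B) simp
    show "(\<Sum>j\<in>B c. coeff (rho (A c) (B c)) (insert (a, j) G)) = 0"
      if "c \<in> {..<n - m}" "a \<in> A c" "G \<subseteq> (A c - {a}) \<times> UNIV" for c a G
      using that by (intro rho_letter_sum finite_A finite_B card_B) simp_all
    show "B c \<subseteq> {1..n}" for c by (rule B_subset)
  qed (use a G in \<open>simp_all add: finite_A\<close>)
qed auto

lemma lookup_eta_diagonal: "\<bar>coeff (eta_cycle m n S T) (word_face w)\<bar> = 1"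
proof -
  obtain s where s: "s \<in> {1, -1}" and E: "\<And>H. fst ` H \<subseteq> {1..m} \<Longrightarrow>
      coeff (eta_cycle m n S T) H =
        s * (\<Prod>c\<in>{..<n - m}. coeff (rho (A c) (B c)) (H \<inter> A c \<times> UNIV))"
    using conjunct2[OF eta_product] by (elim bexE) simp
  have sub: "fst ` word_face w \<subseteq> {1..m}" using word_face_full[OF m w] by (auto simp: full_faces_def)
  have prod1: "\<bar>\<Prod>c\<in>I. f c\<bar> = 1" if "\<And>c. c \<in> I \<Longrightarrow> \<bar>f c\<bar> = (1::int)" for I :: "nat set" and f
    using that by (induction I rule: infinite_finite_induct) (simp_all add: abs_mult)
  have "\<bar>\<Prod>c\<in>{..<n - m}. coeff (rho (A c) (B c)) (word_face w \<inter> A c \<times> UNIV)\<bar> = 1"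
    by (intro prod1 lookup_rho_block) simp
  then show ?thesis using s by (auto simp: E[OF sub] abs_mult)
qed

text \<open>
  A nonzero coefficient means that every letter of \<open>v\<close> lies in the block of positions, popped from one column,
  in which it also lies in \<open>w\<close>. Since \<open>w\<close> decreases on each block, \<open>w\<close> has, at the last difference, the smallest
  of the letters of its block that are not placed further to the right.
\<close>

lemma lookup_eta_triangular:
  assumes v: "v \<in> words m n" and ne: "coeff (eta_cycle m n S T) (word_face v) \<noteq> 0"
  shows "v = w \<or> rev w < rev v"
proof -
  obtain s where s: "s \<in> {1, -1}" and E: "\<And>H. fst ` H \<subseteq> {1..m} \<Longrightarrow>
      coeff (eta_cycle m n S T) H =
        s * (\<Prod>c\<in>{..<n - m}. coeff (rho (A c) (B c)) (H \<inter> A c \<times> UNIV))"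
    using conjunct2[OF eta_product] by (elim bexE) simp
  have "fst ` word_face v = {1..m}" using word_face_full[OF m v] by (simp add: full_faces_def)
  then have nz: "coeff (rho (A c) (B c)) (word_face v \<inter> A c \<times> UNIV) \<noteq> 0" if "c < n - m" for c
    using E[of "word_face v"] ne that by auto
  have block: "col i = c" if "i < n" "v ! i = enat a" "a \<in> A c" "c < n - m" for i a c
  proof -
    have "word_face v \<inter> A c \<times> UNIV \<in> full_faces (A c) (B c)"
      using nz[OF that(4)] rho_full[OF finite_A finite_B card_B[OF that(4)]] by (auto simp: in_keys_iff)
    moreover have "(a, Suc i) \<in> word_face v \<inter> A c \<times> UNIV"
      using that words_length[OF m v] by simp
    moreover have "F \<subseteq> A c \<times> B c" if "F \<in> full_faces (A c) (B c)" for F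
      using that chessboardD(1) by (simp add: full_faces_def)
    ultimately have "Suc i \<in> B c" by (metis SigmaD2 subsetD)
    then show ?thesis by (auto simp: B_eq)
  qed
  show ?thesis
  proof (cases "v = w")
    case False
    have len: "length w = n" "length v = n" by (rule words_length[OF m w], rule words_length[OF m v])
    have "length v = length w" by (simp only: len)
    obtain i where i: "i < n" "v ! i \<noteq> w ! i" "\<And>j. i < j \<Longrightarrow> j < n \<Longrightarrow> v ! j = w ! j"
      using last_difference[OF \<open>length v = length w\<close> False] unfolding len by blast
    have "w ! i < v ! i"
    proof (cases "v ! i")
      case infinity
      then show ?thesis using i(2) by (cases "w ! i") auto
    next
      case (enat a)
      then have "\<exists>i<n. v ! i = enat a" using i(1) by metis
      then have "a \<in> {1..m}" by (rule iffD1[OF words_letter_iff[OF m v]])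
      then obtain c where c: "c < n - m" "a \<in> A c" unfolding Union_A[symmetric] by blast
      then have ci: "col i = c" using block[OF i(1) enat] by blast
      obtain q where q: "q < n" "col q = c" "w ! q = enat a" using c(2) unfolding mem_A by metis
      have "\<not> i < q"
      proof
        assume "i < q"
        then have "v ! q = v ! i" using i(3) q enat by metis
        then show False using words_letter_unique[OF m v q(1) i(1)] enat \<open>i < q\<close> by simp
      qed
      moreover have "q \<noteq> i" using q(3) i(2) enat by metis
      ultimately have "q < i" by simp
      then show ?thesis using col_decreasing[of q i] i(1) q ci enat by simp
    qed
    moreover have "w ! j = v ! j" if "i < j" "j < length v" for j
      using i(3)[of j] that len(2) by simp
    moreover have "i < length v" using i(1) len(2) by simp
    ultimately have "rev w < rev v"
      by (metis rev_less_if_last_difference \<open>length v = length w\<close>)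
    then show ?thesis by (rule disjI2)
  qed simp
qed

end

section \<open>Bases of quotients of chain groups\<close>

text \<open>
  A presentation of \<open>G\<close> as a quotient of the group \<open>C\<close> of chains by means of the projection \<open>h\<close>. Homology and the
  free part of cohomology arise by one and two passages to a quotient, and the basis property is checked on
  chains.
\<close>

definition chain_epi :: "('a \<Rightarrow>\<^sub>0 int) set \<Rightarrow> ('g, 'b) monoid_scheme \<Rightarrow> (('a \<Rightarrow>\<^sub>0 int) \<Rightarrow> 'g) \<Rightarrow> bool" where
  "chain_epi C G h \<longleftrightarrow> comm_group G \<and> 0 \<in> C \<and> (\<forall>x\<in>C. \<forall>y\<in>C. x + y \<in> C) \<and> (\<forall>k. \<forall>x\<in>C. frag_cmul k x \<in> C) \<and>
     h ` C = carrier G \<and> (\<forall>x\<in>C. \<forall>y\<in>C. h (x + y) = h x \<otimes>\<^bsub>G\<^esub> h y)"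

context
  fixes C :: "('a \<Rightarrow>\<^sub>0 int) set" and G :: "('g, 'b) monoid_scheme" and h
  assumes epi: "chain_epi C G h"
begin

interpretation comm_group G using epi by (simp add: chain_epi_def)

lemma chain_epi_closed:
  "0 \<in> C" "x \<in> C \<Longrightarrow> y \<in> C \<Longrightarrow> x + y \<in> C" "x \<in> C \<Longrightarrow> frag_cmul k x \<in> C"
  "x \<in> C \<Longrightarrow> - x \<in> C" "x \<in> C \<Longrightarrow> y \<in> C \<Longrightarrow> x - y \<in> C"
proof -
  show "0 \<in> C" and add: "\<And>x y. x \<in> C \<Longrightarrow> y \<in> C \<Longrightarrow> x + y \<in> C"
    and cm: "\<And>x k. x \<in> C \<Longrightarrow> frag_cmul k x \<in> C"
    using epi by (auto simp: chain_epi_def)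
  show neg: "- x \<in> C" if "x \<in> C" for x using cm[OF that, of "-1"] by simp
  show "x - y \<in> C" if "x \<in> C" "y \<in> C" using add[OF that(1) neg[OF that(2)]] by simp
qed

lemma chain_epi_sum: "(\<And>i. i \<in> J \<Longrightarrow> f i \<in> C) \<Longrightarrow> sum f J \<in> C"
  by (induction J rule: infinite_finite_induct) (auto intro: chain_epi_closed)

lemma chain_epi_hom:
  "x \<in> C \<Longrightarrow> h x \<in> carrier G" "x \<in> C \<Longrightarrow> y \<in> C \<Longrightarrow> h (x + y) = h x \<otimes>\<^bsub>G\<^esub> h y"
  using epi by (auto simp: chain_epi_def)

lemma chain_epi_0: "h 0 = \<one>\<^bsub>G\<^esub>"
proof -
  have "h 0 = h 0 \<otimes>\<^bsub>G\<^esub> h 0"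
    using chain_epi_hom(2)[of 0 0] chain_epi_closed(1) by simp
  then show ?thesis using chain_epi_hom(1)[OF chain_epi_closed(1)] by (metis l_cancel_one)
qed

lemma chain_epi_eq_iff:
  assumes "x \<in> C" "y \<in> C"
  shows "h x = h y \<longleftrightarrow> h (x - y) = \<one>\<^bsub>G\<^esub>"
proof -
  have "h x = h (x - y) \<otimes>\<^bsub>G\<^esub> h y"
    using chain_epi_hom(2)[of "x - y" y] chain_epi_closed(5)[OF assms] assms by simp
  then show ?thesis
    using chain_epi_hom(1)[OF assms(2)] chain_epi_hom(1)[OF chain_epi_closed(5)[OF assms]]
    by (simp only: r_cancel_one)
qed

lemma chain_epi_cmul_nat: "x \<in> C \<Longrightarrow> h (frag_cmul (int k) x) = h x [^]\<^bsub>G\<^esub> k"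
proof (induction k)
  case (Suc k)
  have "frag_cmul (int (Suc k)) x = frag_cmul (int k) x + x"
    using frag_cmul_distrib[of "int k" 1 x] by (simp add: add.commute)
  then show ?case
    using Suc chain_epi_hom(2)[of "frag_cmul (int k) x" x] chain_epi_closed(3) by simp
qed (simp add: chain_epi_0)

lemma chain_epi_cmul:
  assumes x: "x \<in> C"
  shows "h (frag_cmul k x) = h x [^]\<^bsub>G\<^esub> k"
proof (cases k rule: int_cases2)
  case (nonneg n)
  then show ?thesis using chain_epi_cmul_nat[OF x] by (simp add: int_pow_int)
next
  case (nonpos n)
  have "h (frag_cmul k x) \<otimes>\<^bsub>G\<^esub> h (frag_cmul (int n) x) = h (frag_cmul k x + frag_cmul (int n) x)"
    using chain_epi_hom(2) chain_epi_closed(3)[OF x] by simp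
  also have "frag_cmul k x + frag_cmul (int n) x = 0"
    by (simp add: nonpos flip: frag_cmul_distrib)
  finally have "h (frag_cmul k x) \<otimes>\<^bsub>G\<^esub> (h x [^]\<^bsub>G\<^esub> n) = \<one>\<^bsub>G\<^esub>"
    by (simp add: chain_epi_cmul_nat[OF x] chain_epi_0)
  then have "h (frag_cmul k x) = inv\<^bsub>G\<^esub> (h x [^]\<^bsub>G\<^esub> n)"
    using chain_epi_hom(1)[OF x] chain_epi_hom(1)[OF chain_epi_closed(3)[OF x]]
    by (metis inv_equality nat_pow_closed)
  then show ?thesis using chain_epi_hom(1)[OF x] by (simp add: nonpos int_pow_neg_int)
qed

lemma chain_epi_combination:
  assumes "finite J" "\<And>i. i \<in> J \<Longrightarrow> e i \<in> C"
  shows "h (\<Sum>i\<in>J. frag_cmul (f i) (e i)) = (\<Otimes>\<^bsub>G\<^esub>i\<in>J. h (e i) [^]\<^bsub>G\<^esub> f i)"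
  using assms
proof (induction J rule: finite_induct)
  case empty
  then show ?case by (simp add: chain_epi_0)
next
  case (insert j J)
  have "h (\<Sum>i\<in>insert j J. frag_cmul (f i) (e i)) =
      h (frag_cmul (f j) (e j)) \<otimes>\<^bsub>G\<^esub> h (\<Sum>i\<in>J. frag_cmul (f i) (e i))"
    using insert by (simp add: chain_epi_hom(2) chain_epi_closed(3) chain_epi_sum)
  also have "\<dots> = (\<Otimes>\<^bsub>G\<^esub>i\<in>insert j J. h (e i) [^]\<^bsub>G\<^esub> f i)"
    using insert by (subst finprod_insert) (auto simp: chain_epi_cmul chain_epi_hom(1))
  finally show ?case .
qed

lemma is_basis_chain_epi:
  fixes e :: "'i \<Rightarrow> ('a \<Rightarrow>\<^sub>0 int)"
  assumes I: "finite I" "\<And>i. i \<in> I \<Longrightarrow> e i \<in> C" "\<And>i. i \<in> I \<Longrightarrow> b i = h (e i)"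
    and span: "\<And>x. x \<in> C \<Longrightarrow> \<exists>f. h (x - (\<Sum>i\<in>I. frag_cmul (f i) (e i))) = \<one>\<^bsub>G\<^esub>"
    and indep: "\<And>f i. h (\<Sum>i\<in>I. frag_cmul (f i) (e i)) = \<one>\<^bsub>G\<^esub> \<Longrightarrow> i \<in> I \<Longrightarrow> f i = (0::int)"
  shows "is_basis G I b"
proof -
  define s where "s f = (\<Sum>i\<in>I. frag_cmul (f i) (e i))" for f :: "'i \<Rightarrow> int"
  have s: "s f \<in> C" for f unfolding s_def by (intro chain_epi_sum chain_epi_closed(3) I)
  have comb: "(\<Otimes>\<^bsub>G\<^esub>i\<in>support c. b i [^]\<^bsub>G\<^esub> coeff c i) = h (s (coeff c))"
    if c: "support c \<subseteq> I" for c
  proof -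
    have "s (coeff c) = (\<Sum>i\<in>support c. frag_cmul (coeff c i) (e i))"
      unfolding s_def using c I(1) by (intro sum.mono_neutral_right) (auto simp: in_keys_iff)
    then have "h (s (coeff c)) =
        (\<Otimes>\<^bsub>G\<^esub>i\<in>support c. h (e i) [^]\<^bsub>G\<^esub> coeff c i)"
      using c I(2) by (subst chain_epi_combination[symmetric]) auto
    also have "\<dots> = (\<Otimes>\<^bsub>G\<^esub>i\<in>support c. b i [^]\<^bsub>G\<^esub> coeff c i)"
      using c I(2,3) by (intro finprod_cong') (auto simp: chain_epi_hom(1) subset_iff)
    finally show ?thesis by simp
  qed
  have "\<exists>!c :: 'i \<Rightarrow>\<^sub>0 int. support c \<subseteq> I \<and>
      x = (\<Otimes>\<^bsub>G\<^esub>i\<in>support c. b i [^]\<^bsub>G\<^esub> coeff c i)" if "x \<in> carrier G" for x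
  proof -
    have "x \<in> h ` C" using that epi by (simp add: chain_epi_def)
    then obtain z where z: "z \<in> C" "x = h z" by (rule imageE)
    obtain f where f: "h (z - s f) = \<one>\<^bsub>G\<^esub>" using span[OF z(1)] unfolding s_def by blast
    define c where "c = (\<Sum>i\<in>I. frag_cmul (f i) (frag_of i))"
    have lc: "coeff c i = (if i \<in> I then f i else 0)" for i
      using I(1) by (simp add: c_def lookup_sum lookup_frag_of if_distrib cong: if_cong)
    have kc: "support c \<subseteq> I" by (auto simp: in_keys_iff lc split: if_splits)
    have "s (coeff c) = s f" unfolding s_def by (intro sum.cong) (auto simp: lc)
    then have ex: "x = h (s (coeff c))"
      using chain_epi_eq_iff[OF z(1) s[of f]] f z(2) by simp
    show ?thesis
    proof (rule ex1I[of _ c])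
      show "support c \<subseteq> I \<and>
          x = (\<Otimes>\<^bsub>G\<^esub>i\<in>support c. b i [^]\<^bsub>G\<^esub> coeff c i)"
        using kc ex comb[OF kc] by simp
      fix d :: "'i \<Rightarrow>\<^sub>0 int" assume "support d \<subseteq> I \<and>
          x = (\<Otimes>\<^bsub>G\<^esub>i\<in>support d. b i [^]\<^bsub>G\<^esub> coeff d i)"
      then have d: "support d \<subseteq> I" "h (s (coeff d)) = h (s (coeff c))"
        using comb ex by auto
      have "s (coeff d) - s (coeff c) = s (\<lambda>i. coeff d i - coeff c i)"
        unfolding s_def by (simp add: sum_subtractf frag_cmul_diff_distrib)
      then have "h (s (\<lambda>i. coeff d i - coeff c i)) = \<one>\<^bsub>G\<^esub>"
        using chain_epi_eq_iff[OF s[of "coeff d"] s[of "coeff c"]] d(2) by simp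
      from indep[OF this[unfolded s_def]] have "coeff d i = coeff c i" if "i \<in> I" for i
        using that by fastforce
      moreover have "coeff d i = 0" "coeff c i = 0" if "i \<notin> I" for i
        using d(1) kc that by (auto simp: in_keys_iff)
      ultimately show "d = c" by (intro poly_mapping_eqI) metis
    qed
  qed
  moreover have "b \<in> I \<rightarrow> carrier G" using I by (auto simp: chain_epi_hom(1))
  ultimately show ?thesis
    using comm_group_axioms unfolding is_basis_def by blast
qed

lemma chain_epi_Mod:
  assumes N: "subgroup N G"
  shows "chain_epi C (G Mod N) (\<lambda>x. N #>\<^bsub>G\<^esub> h x)"
    "x \<in> C \<Longrightarrow> N #>\<^bsub>G\<^esub> h x = \<one>\<^bsub>G Mod N\<^esub> \<longleftrightarrow> h x \<in> N"
proof -
  have hC: "h ` C = carrier G" using epi by (simp add: chain_epi_def)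
  have nrm: "N \<lhd> G" by (rule subgroup_imp_normal[OF N])
  have "carrier (G Mod N) = (\<lambda>x. N #>\<^bsub>G\<^esub> h x) ` C"
    unfolding carrier_FactGroup hC[symmetric] by (simp add: image_image)
  moreover have "N #>\<^bsub>G\<^esub> h (x + y) = (N #>\<^bsub>G\<^esub> h x) \<otimes>\<^bsub>G Mod N\<^esub> (N #>\<^bsub>G\<^esub> h y)" if "x \<in> C" "y \<in> C" for x y
    using normal.rcos_sum[OF nrm] that by (simp add: chain_epi_hom)
  moreover have "comm_group (G Mod N)" by (rule abelian_FactGroup[OF N])
  ultimately show "chain_epi C (G Mod N) (\<lambda>x. N #>\<^bsub>G\<^esub> h x)"
    using chain_epi_closed by (auto simp: chain_epi_def)
  show "N #>\<^bsub>G\<^esub> h x = \<one>\<^bsub>G Mod N\<^esub> \<longleftrightarrow> h x \<in> N" if "x \<in> C"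
    using coset_join1[OF _ _ N] coset_join2[OF _ N] chain_epi_hom(1)[OF that] subgroup.subset[OF N] by auto
qed

lemma torsion_subgroup: "subgroup (torsion_subgroup G) G"
proof (rule subgroupI)
  show "torsion_subgroup G \<subseteq> carrier G" by (auto simp: torsion_subgroup_def)
  have "\<one>\<^bsub>G\<^esub> \<in> torsion_subgroup G" unfolding torsion_subgroup_def by (auto intro!: exI[of _ 1])
  then show "torsion_subgroup G \<noteq> {}" by blast
next
  fix x assume "x \<in> torsion_subgroup G"
  then obtain k :: nat where k: "x \<in> carrier G" "0 < k" "x [^]\<^bsub>G\<^esub> k = \<one>\<^bsub>G\<^esub>"
    by (auto simp: torsion_subgroup_def)
  then have "(inv\<^bsub>G\<^esub> x) [^]\<^bsub>G\<^esub> k = \<one>\<^bsub>G\<^esub>" by (simp add: nat_pow_inv)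
  then show "inv\<^bsub>G\<^esub> x \<in> torsion_subgroup G" using k by (auto simp: torsion_subgroup_def)
next
  fix x y assume "x \<in> torsion_subgroup G" "y \<in> torsion_subgroup G"
  then obtain k l :: nat where k: "x \<in> carrier G" "0 < k" "x [^]\<^bsub>G\<^esub> k = \<one>\<^bsub>G\<^esub>"
    and l: "y \<in> carrier G" "0 < l" "y [^]\<^bsub>G\<^esub> l = \<one>\<^bsub>G\<^esub>"
    unfolding torsion_subgroup_def by blast
  have "(x \<otimes>\<^bsub>G\<^esub> y) [^]\<^bsub>G\<^esub> (k * l) = x [^]\<^bsub>G\<^esub> (k * l) \<otimes>\<^bsub>G\<^esub> y [^]\<^bsub>G\<^esub> (l * k)"
    using k l by (simp add: nat_pow_distrib mult.commute)
  also have "\<dots> = \<one>\<^bsub>G\<^esub>" using k l by (simp add: nat_pow_pow[symmetric])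
  finally show "x \<otimes>\<^bsub>G\<^esub> y \<in> torsion_subgroup G"
    using k l unfolding torsion_subgroup_def by (auto intro!: exI[of _ "k * l"])
qed

end

lemma chain_epi_id:
  assumes "0 \<in> C" "\<And>x y. x \<in> C \<Longrightarrow> y \<in> C \<Longrightarrow> x + y \<in> C" "\<And>k x. x \<in> C \<Longrightarrow> frag_cmul k x \<in> C"
    and "carrier G = C" "\<And>x y. x \<otimes>\<^bsub>G\<^esub> y = x + y" "\<one>\<^bsub>G\<^esub> = 0"
  shows "chain_epi C G (\<lambda>x. x)"
proof -
  have "comm_group G"
  proof (rule comm_groupI)
    fix x assume "x \<in> carrier G"
    then show "\<exists>y\<in>carrier G. y \<otimes>\<^bsub>G\<^esub> x = \<one>\<^bsub>G\<^esub>"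
      using assms(3)[of x "-1"] by (intro bexI[of _ "- x"]) (auto simp: assms(4-))
  qed (auto simp: assms ac_simps)
  then show ?thesis using assms by (auto simp: chain_epi_def)
qed

section \<open>Unitriangular systems over the integers\<close>

context
  fixes I :: "'i set" and key :: "'i \<Rightarrow> 'l::linorder" and M :: "'i \<Rightarrow> 'i \<Rightarrow> int"
  assumes fin: "finite I" and inj: "inj_on key I"
    and diag: "\<And>p. p \<in> I \<Longrightarrow> \<bar>M p p\<bar> = 1"
    and tri: "\<And>p q. p \<in> I \<Longrightarrow> q \<in> I \<Longrightarrow> M p q \<noteq> 0 \<Longrightarrow> key p \<le> key q"
begin

lemma unitriangular_solve: "\<exists>f. \<forall>q\<in>I. (\<Sum>p\<in>I. f p * M p q) = v q"
proof -
  have "J \<subseteq> I \<Longrightarrow> \<exists>f. \<forall>q\<in>J. (\<Sum>p\<in>J. f p * M p q) = v q" if "finite J" for J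
    using that
  proof (induction J rule: finite_ranking_induct[where f = key])
    case empty
    then show ?case by simp
  next
    case (insert x J)
    show ?case
    proof (cases "x \<in> J")
      case True
      then show ?thesis using insert by (simp add: insert_absorb)
    next
      case False
      from insert obtain f where f: "\<And>q. q \<in> J \<Longrightarrow> (\<Sum>p\<in>J. f p * M p q) = v q" by auto
      define g where "g = f(x := (v x - (\<Sum>p\<in>J. f p * M p x)) * M x x)"
      have g: "(\<Sum>p\<in>J. g p * M p q) = (\<Sum>p\<in>J. f p * M p q)" for q
        using False by (intro sum.cong) (auto simp: g_def)
      have "(\<Sum>p\<in>insert x J. g p * M p q) = v q" if q: "q \<in> insert x J" for q
      proof (cases "q = x")
        case True
        have "M x x * M x x = 1" using diag[of x] insert.prems by (auto simp: abs_if split: if_splits)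
        then have "g x * M x x = v x - (\<Sum>p\<in>J. f p * M p x)" by (simp add: g_def mult.assoc)
        then show ?thesis using False insert.hyps(1) g True by simp
      next
        case False
        then have qJ: "q \<in> J" using q by simp
        have "M x q = 0"
        proof (rule ccontr)
          assume "M x q \<noteq> 0"
          then have "key x \<le> key q" using tri insert.prems q by blast
          then have "key x = key q" using insert.hyps(2)[OF qJ] by simp
          then show False using inj_onD[OF inj] insert.prems qJ \<open>q \<noteq> x\<close> by blast
        qed
        then show ?thesis using \<open>x \<notin> J\<close> insert.hyps(1) g f[OF qJ] by simp
      qed
      then show ?thesis by blast
    qed
  qed
  from this[OF fin] show ?thesis by simp
qed

lemma unitriangular_left_inject:
  assumes "\<And>q. q \<in> I \<Longrightarrow> (\<Sum>p\<in>I. f p * M p q) = 0" "p \<in> I"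
  shows "f p = 0"
proof (rule ccontr)
  let ?J = "{p \<in> I. f p \<noteq> 0}"
  assume "f p \<noteq> 0"
  then have "?J \<noteq> {}" "finite ?J" using assms(2) fin by auto
  then obtain r where r: "r \<in> I" "f r \<noteq> 0" and least: "\<And>q. q \<in> I \<Longrightarrow> f q \<noteq> 0 \<Longrightarrow> key r \<le> key q"
    using arg_min_if_finite[of ?J key] by (auto simp: not_less)
  have "(\<Sum>p\<in>I. f p * M p r) = (\<Sum>p\<in>{r}. f p * M p r)"
  proof (intro sum.mono_neutral_right fin ballI)
    fix q assume q: "q \<in> I - {r}"
    show "f q * M q r = 0"
    proof (rule ccontr)
      assume "f q * M q r \<noteq> 0"
      then have "key r \<le> key q" "key q \<le> key r" using least[of q] tri[of q r] q r(1) by simp_all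
      then have "key r = key q" by (rule antisym)
      then show False using inj_onD[OF inj] q r(1) by blast
    qed
  qed (use r in auto)
  then have "f r * M r r = 0" using assms(1)[OF r(1)] by simp
  then have "M r r = 0" using r(2) by simp
  then show False using diag[OF r(1)] by simp
qed

lemma unitriangular_right_inject:
  assumes "\<And>p. p \<in> I \<Longrightarrow> (\<Sum>q\<in>I. M p q * f q) = 0" "p \<in> I"
  shows "f p = 0"
proof (rule ccontr)
  let ?J = "{p \<in> I. f p \<noteq> 0}"
  assume "f p \<noteq> 0"
  then have J: "?J \<noteq> {}" "finite ?J" using assms(2) fin by auto
  have "Max (key ` ?J) \<in> key ` ?J" using J by (intro Max_in) auto
  then obtain r where r: "r \<in> ?J" "key r = Max (key ` ?J)" by (metis (no_types, lifting) imageE)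
  have greatest: "key q \<le> key r" if "q \<in> I" "f q \<noteq> 0" for q
    unfolding r(2) using that J(2) by (intro Max_ge) auto
  have rI: "r \<in> I" "f r \<noteq> 0" using r(1) by auto
  have "(\<Sum>q\<in>I. M r q * f q) = (\<Sum>q\<in>{r}. M r q * f q)"
  proof (intro sum.mono_neutral_right fin ballI)
    fix q assume q: "q \<in> I - {r}"
    show "M r q * f q = 0"
    proof (rule ccontr)
      assume "M r q * f q \<noteq> 0"
      then have "key r \<le> key q" "key q \<le> key r" using greatest[of q] tri[of r q] q rI(1) by simp_all
      then have "key r = key q" by (rule antisym)
      then show False using inj_onD[OF inj] q rI(1) by blast
    qed
  qed (use rI in auto)
  then have "M r r * f r = 0" using assms(1)[OF rI(1)] by simp
  then have "M r r = 0" using rI(2) by simp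
  then show False using diag[OF rI(1)] by simp
qed

end

section \<open>The two bases\<close>

lemma boundary_add: "boundary (c + d) = boundary c + boundary d"
  by (simp add: boundary_def frag_extend_add)

lemma boundary_cmul: "boundary (frag_cmul k c) = frag_cmul k (boundary c)"
  by (simp add: boundary_def frag_extend_cmul)

lemma boundary_0 [simp]: "boundary 0 = 0"
  by (simp add: boundary_def)

lemma pairing_0 [simp]: "pairing 0 d = 0"
  by (simp add: pairing_def)

lemma pairing_sum: "pairing (\<Sum>i\<in>J. f i) d = (\<Sum>i\<in>J. pairing (f i) d)"
  by (induction J rule: infinite_finite_induct) (simp_all add: pairing_add)

lemma pairing_diff: "pairing (c - d) e = pairing c e - pairing d e"
  using pairing_add[of "c - d" d e] by simp

lemma keys_sum_cmul_subset:
  assumes "\<And>i. i \<in> J \<Longrightarrow> support (g i) \<subseteq> U"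
  shows "support (\<Sum>i\<in>J. frag_cmul (f i) (g i)) \<subseteq> U"
proof -
  have "support (frag_cmul (f i) (g i)) \<subseteq> U" if "i \<in> J" for i
    using keys_cmul[of "f i" "g i"] assms[OF that] by blast
  then show ?thesis using keys_sum[of "\<lambda>i. frag_cmul (f i) (g i)" J] by blast
qed

context
  fixes m n :: nat
  assumes m0: "0 < m" and mn: "m \<le> n"
  (* Otherwise the simplifier rewrites {1..m} and misses the facts stated for it. *)
  notes One_nat_def [simp del]
begin

private abbreviation "K \<equiv> chessboard {1..m} {1..n}"
private abbreviation "Top \<equiv> full_faces {1..m} {1..n}"
private abbreviation "N \<equiv> coboundaries K (int m - 1)"

lemma finite_K: "finite K" by (intro finite_chessboard) auto

lemma top_iff: "F \<in> Top \<longleftrightarrow> F \<in> K \<and> finite F \<and> int (card F) = int m"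
proof -
  have "F \<in> K" if "F \<in> Top" using that by (simp add: full_faces_def)
  then show ?thesis using chessboard_card[of F "{1..m}" "{1..n}"] by auto
qed

lemma card_K: "F \<in> K \<Longrightarrow> card F \<le> m"
  using chessboard_card(2)[of F "{1..m}" "{1..n}"] by simp

lemma carrier_Top_chains: "carrier (chain_group K (int m - 1)) = {c. support c \<subseteq> Top}"
proof -
  have eq: "{F \<in> K. finite F \<and> int (card F) = int m - 1 + 1} = Top"
    unfolding set_eq_iff mem_Collect_eq top_iff diff_add_cancel by simp
  show ?thesis unfolding chain_group_def eq free_Abelian_group_def by simp
qed

text \<open>
  There are no faces with more than \<open>m\<close> vertices.
\<close>

lemma boundaries_top: "boundaries K (int m - 1) = {0}"
proof -
  have eq: "{F \<in> K. finite F \<and> int (card F) = int m - 1 + 1 + 1} = {}"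
  proof -
    have "\<not> int (card F) = int m - 1 + 1 + 1" if "F \<in> K" for F
      using card_K[OF that] by linarith
    then show ?thesis by blast
  qed
  have "carrier (chain_group K (int m - 1 + 1)) = {0}"
    unfolding chain_group_def eq free_Abelian_group_def by simp
  then show ?thesis by (simp add: boundaries_def)
qed

lemma chain_epi_cycles:
  "chain_epi {c. support c \<subseteq> Top \<and> boundary c = 0} (cycle_group K (int m - 1)) (\<lambda>x. x)"
proof (rule chain_epi_id)
  fix x y assume "x \<in> {c. support c \<subseteq> Top \<and> boundary c = 0}"
    "y \<in> {c. support c \<subseteq> Top \<and> boundary c = 0}"
  then show "x + y \<in> {c. support c \<subseteq> Top \<and> boundary c = 0}"
    using keys_add[of x y] by (auto simp: boundary_add)
next
  fix k x assume "x \<in> {c. support c \<subseteq> Top \<and> boundary c = 0}"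
  then show "frag_cmul k x \<in> {c. support c \<subseteq> Top \<and> boundary c = 0}"
    using keys_cmul[of k x] by (auto simp: boundary_cmul)
next
  show "carrier (cycle_group K (int m - 1)) = {c. support c \<subseteq> Top \<and> boundary c = 0}"
    by (simp add: cycle_group_def carrier_Top_chains)
qed (simp_all add: cycle_group_def chain_group_def)

lemma homology_epi:
  shows "chain_epi {c. support c \<subseteq> Top \<and> boundary c = 0} (homology_group (int m - 1) K)
      (homology_class (int m - 1) K)"
    and "support c \<subseteq> Top \<Longrightarrow> boundary c = 0 \<Longrightarrow>
      homology_class (int m - 1) K c = \<one>\<^bsub>homology_group (int m - 1) K\<^esub> \<longleftrightarrow> c = 0"
proof -
  have "group (cycle_group K (int m - 1))"
    using chain_epi_cycles by (simp add: chain_epi_def comm_group_def)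
  from group.triv_subgroup[OF this] have sub: "subgroup {0} (cycle_group K (int m - 1))"
    by (simp add: cycle_group_def chain_group_def)
  show "chain_epi {c. support c \<subseteq> Top \<and> boundary c = 0} (homology_group (int m - 1) K)
      (homology_class (int m - 1) K)"
    using chain_epi_Mod(1)[OF chain_epi_cycles sub]
    by (simp add: homology_group_def homology_class_def[abs_def] boundaries_top)
  show "support c \<subseteq> Top \<Longrightarrow> boundary c = 0 \<Longrightarrow>
      homology_class (int m - 1) K c = \<one>\<^bsub>homology_group (int m - 1) K\<^esub> \<longleftrightarrow> c = 0"
    using chain_epi_Mod(2)[OF chain_epi_cycles sub, of c]
    by (simp add: homology_group_def homology_class_def boundaries_top)
qed

lemma coboundary_top:
  assumes "support c \<subseteq> Top"
  shows "coboundary K c = 0"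
  unfolding coboundary_def
proof (rule sum.neutral, rule ballI)
  fix F assume F: "F \<in> K"
  have "coeff (boundary (frag_of F)) G = 0" if G: "G \<in> support c" for G
  proof -
    have cG: "card G = m" using assms G top_iff by auto
    have "F - {v} \<noteq> G" if "v \<in> F" for v
    proof
      assume "F - {v} = G"
      moreover have "finite F" using chessboard_card(1)[OF F] by simp
      ultimately have "card F = Suc (card G)" using that card.remove by metis
      then show False using card_K[OF F] cG by simp
    qed
    then show ?thesis unfolding lookup_boundary_frag_of by (intro sum.neutral) auto
  qed
  then have "pairing c (boundary (frag_of F)) = 0" by (simp add: pairing_def)
  then show "frag_cmul (pairing c (boundary (frag_of F))) (frag_of F) = 0" by simp
qed

lemma chain_epi_cocycles:
  "chain_epi {c. support c \<subseteq> Top} (cocycle_group K (int m - 1)) (\<lambda>x. x)"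
proof (rule chain_epi_id)
  fix x y :: chain assume "x \<in> {c. support c \<subseteq> Top}" "y \<in> {c. support c \<subseteq> Top}"
  then show "x + y \<in> {c. support c \<subseteq> Top}" using keys_add[of x y] by auto
next
  fix k and x :: chain assume "x \<in> {c. support c \<subseteq> Top}"
  then show "frag_cmul k x \<in> {c. support c \<subseteq> Top}" using keys_cmul[of k x] by auto
next
  show "carrier (cocycle_group K (int m - 1)) = {c. support c \<subseteq> Top}"
    by (simp add: cocycle_group_def carrier_Top_chains coboundary_top cong: conj_cong)
qed (simp_all add: cocycle_group_def chain_group_def)

lemma coboundaries_top:
  assumes "c \<in> N"
  shows "support c \<subseteq> Top"
proof
  fix F assume F: "F \<in> support c"
  obtain b where b: "support b \<subseteq> {G \<in> K. finite G \<and> int (card G) = int m - 1}" "c = coboundary K b"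
    using assms unfolding coboundaries_iff by blast
  have "coeff c F \<noteq> 0" using F by (simp add: in_keys_iff)
  moreover have look: "coeff c F = (if F \<in> K then pairing b (boundary (frag_of F)) else 0)"
    unfolding b(2) coboundary_def using finite_K
    by (simp add: lookup_sum lookup_frag_of if_distrib cong: if_cong)
  ultimately have FK: "F \<in> K" and "pairing b (boundary (frag_of F)) \<noteq> 0" by (auto split: if_splits)
  then obtain G where G: "G \<in> support b" "coeff (boundary (frag_of F)) G \<noteq> 0"
    unfolding pairing_def by (metis (no_types, lifting) mult_eq_0_iff sum.neutral)
  have "\<exists>v\<in>F. F - {v} = G"
  proof (rule ccontr)
    assume "\<not> (\<exists>v\<in>F. F - {v} = G)"
    then have "coeff (boundary (frag_of F)) G = 0"
      unfolding lookup_boundary_frag_of by (intro sum.neutral) auto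
    then show False using G(2) by simp
  qed
  then obtain v where v: "v \<in> F" "F - {v} = G" by blast
  have finF: "finite F" using chessboard_card(1)[OF FK] by simp
  then have "card F = Suc (card G)" using v card.remove by metis
  moreover have "int (card G) = int m - 1" using b(1) G(1) by auto
  ultimately show "F \<in> Top" using top_iff FK finF by simp
qed

lemma cohomology_epi:
  shows "chain_epi {c. support c \<subseteq> Top} (cohomology_group (int m - 1) K)
      (cohomology_class (int m - 1) K)"
    and "support c \<subseteq> Top \<Longrightarrow>
      cohomology_class (int m - 1) K c = \<one>\<^bsub>cohomology_group (int m - 1) K\<^esub> \<longleftrightarrow> c \<in> N"
proof -
  let ?G = "cocycle_group K (int m - 1)"
  have carrier: "carrier ?G = {c. support c \<subseteq> Top}"
    using chain_epi_cocycles by (simp add: chain_epi_def)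
  have G: "group ?G"
    using chain_epi_cocycles by (simp add: chain_epi_def comm_group_def)
  have mult: "x \<otimes>\<^bsub>?G\<^esub> y = x + y" "\<one>\<^bsub>?G\<^esub> = 0" for x y
    by (auto simp: cocycle_group_def chain_group_def)
  have sub: "subgroup N ?G"
  proof (rule group.subgroupI[OF G])
    show "N \<subseteq> carrier ?G" unfolding carrier using coboundaries_top by blast
    show "N \<noteq> {}" using coboundaries_0 by blast
    show "inv\<^bsub>?G\<^esub> x \<in> N" if x: "x \<in> N" for x
    proof -
      have neg: "- x \<in> N" using coboundaries_cmul[OF x, of "-1"] by simp
      have "inv\<^bsub>?G\<^esub> x = - x"
        using x neg coboundaries_top by (intro group.inv_equality[OF G]) (auto simp: mult carrier)
      then show ?thesis using neg by simp
    qed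
    show "x \<otimes>\<^bsub>?G\<^esub> y \<in> N" if "x \<in> N" "y \<in> N" for x y
      unfolding mult by (rule coboundaries_add[OF that])
  qed
  show "chain_epi {c. support c \<subseteq> Top} (cohomology_group (int m - 1) K)
      (cohomology_class (int m - 1) K)"
    using chain_epi_Mod(1)[OF chain_epi_cocycles sub]
    by (simp add: cohomology_group_def cohomology_class_def[abs_def])
  show "support c \<subseteq> Top \<Longrightarrow>
      cohomology_class (int m - 1) K c = \<one>\<^bsub>cohomology_group (int m - 1) K\<^esub> \<longleftrightarrow> c \<in> N"
    using chain_epi_Mod(2)[OF chain_epi_cocycles sub, of c]
    by (simp add: cohomology_group_def cohomology_class_def)
qed

lemma free_part_epi:
  defines "H \<equiv> cohomology_group (int m - 1) K" and "h \<equiv> cohomology_class (int m - 1) K"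
  shows "chain_epi {c. support c \<subseteq> Top} (free_part H) (\<lambda>c. free_part_class H (h c))"
    and "support c \<subseteq> Top \<Longrightarrow>
      free_part_class H (h c) = \<one>\<^bsub>free_part H\<^esub> \<longleftrightarrow> (\<exists>k>0. frag_cmul (int k) c \<in> N)"
proof -
  note epi = cohomology_epi(1)[folded H_def h_def]
  note sub = torsion_subgroup[OF epi]
  show "chain_epi {c. support c \<subseteq> Top} (free_part H) (\<lambda>c. free_part_class H (h c))"
    using chain_epi_Mod(1)[OF epi sub] by (simp add: free_part_def free_part_class_def)
  assume c: "support c \<subseteq> Top"
  have kc: "support (frag_cmul k c) \<subseteq> Top" for k using keys_cmul[of k c] c by blast
  have "free_part_class H (h c) = \<one>\<^bsub>free_part H\<^esub> \<longleftrightarrow> h c \<in> torsion_subgroup H"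
    using chain_epi_Mod(2)[OF epi sub, of c] c by (simp add: free_part_def free_part_class_def)
  also have "\<dots> \<longleftrightarrow> (\<exists>k>0::nat. h c [^]\<^bsub>H\<^esub> k = \<one>\<^bsub>H\<^esub>)"
    using chain_epi_hom(1)[OF epi, of c] c by (auto simp: torsion_subgroup_def)
  also have "\<dots> \<longleftrightarrow> (\<exists>k>0. frag_cmul (int k) c \<in> N)"
  proof -
    have "h c [^]\<^bsub>H\<^esub> k = \<one>\<^bsub>H\<^esub> \<longleftrightarrow> frag_cmul (int k) c \<in> N" for k :: nat
      using chain_epi_cmul_nat[OF epi, of c k] c cohomology_epi(2)[OF kc[of "int k"], folded H_def h_def]
      by simp
    then show ?thesis by simp
  qed
  finally show "free_part_class H (h c) = \<one>\<^bsub>free_part H\<^esub> \<longleftrightarrow> (\<exists>k>0. frag_cmul (int k) c \<in> N)" .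
qed

private abbreviation "P \<equiv> tableau_pairs m n"
private definition "pair_word p = (case p of (S, T) \<Rightarrow> rs_word m n S T)"
private definition "pair_face p = word_face (pair_word p)"
private definition "pair_eta p = (case p of (S, T) \<Rightarrow> eta_cycle m n S T)"

lemma pair_word_inject: "inj_on pair_word P"
  using rs_word_inject by (fastforce simp: inj_on_def pair_word_def)

lemma pair_word_in_words: "p \<in> P \<Longrightarrow> pair_word p \<in> words m n"
  using rs_word_in_words by (cases p) (simp add: pair_word_def)

lemma finite_P: "finite P"
  using finite_imageD[OF finite_subset[OF _ finite_words[OF mn]] pair_word_inject] pair_word_in_words by blast

lemma pair_face_top: "p \<in> P \<Longrightarrow> pair_face p \<in> Top"
  unfolding pair_face_def by (intro word_face_full mn pair_word_in_words)

lemma pair_eta_cycle: "p \<in> P \<Longrightarrow> support (pair_eta p) \<subseteq> Top \<and> boundary (pair_eta p) = 0"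
  using eta_full[OF mn] boundary_eta[OF mn] by (cases p) (simp add: pair_eta_def)

private definition "span_words c \<longleftrightarrow> (\<exists>f. c - (\<Sum>p\<in>P. frag_cmul (f p) (frag_of (pair_face p))) \<in> N)"

lemma span_words_combination:
  assumes "\<And>i. i \<in> J \<Longrightarrow> span_words (c i)"
  shows "span_words (\<Sum>i\<in>J. frag_cmul (k i) (c i))"
proof -
  have "\<forall>i\<in>J. \<exists>f. c i - (\<Sum>p\<in>P. frag_cmul (f p) (frag_of (pair_face p))) \<in> N"
    using assms unfolding span_words_def by (rule ballI)
  from bchoice[OF this] obtain f where
    f: "\<And>i. i \<in> J \<Longrightarrow> c i - (\<Sum>p\<in>P. frag_cmul (f i p) (frag_of (pair_face p))) \<in> N"
    by (elim exE) (rule that, rule bspec)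
  have "(\<Sum>i\<in>J. frag_cmul (k i) (c i)) - (\<Sum>p\<in>P. frag_cmul (\<Sum>i\<in>J. k i * f i p) (frag_of (pair_face p))) =
      (\<Sum>i\<in>J. frag_cmul (k i) (c i - (\<Sum>p\<in>P. frag_cmul (f i p) (frag_of (pair_face p)))))"
  proof (rule poly_mapping_eqI)
    fix F :: "vertex set"
    have "(\<Sum>p\<in>P. (\<Sum>i\<in>J. k i * f i p) * coeff (frag_of (pair_face p)) F) =
        (\<Sum>i\<in>J. k i * (\<Sum>p\<in>P. f i p * coeff (frag_of (pair_face p)) F))"
      unfolding sum_distrib_left sum_distrib_right by (subst sum.swap) (simp add: mult.assoc)
    then show "coeff ((\<Sum>i\<in>J. frag_cmul (k i) (c i)) -
        (\<Sum>p\<in>P. frag_cmul (\<Sum>i\<in>J. k i * f i p) (frag_of (pair_face p)))) F =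
      coeff (\<Sum>i\<in>J. frag_cmul (k i) (c i - (\<Sum>p\<in>P. frag_cmul (f i p) (frag_of (pair_face p))))) F"
      by (simp add: lookup_minus lookup_sum right_diff_distrib sum_subtractf)
  qed
  also have "\<dots> \<in> N" using f by (intro coboundaries_sum coboundaries_cmul)
  finally show ?thesis
    unfolding span_words_def by (rule exI[of _ "\<lambda>p. \<Sum>i\<in>J. k i * f i p"])
qed

text \<open>
  Induction along the lexicographic order of reversed words: straightening leads to smaller words, and a word
  that cannot be straightened comes from a pair of tableaux.
\<close>

lemma span_words_word: "v \<in> words m n \<Longrightarrow> span_words (frag_of (word_face v))"
proof (induction "card {u \<in> words m n. rev u < rev v}" arbitrary: v rule: less_induct)
  case less
  show ?case
  proof (cases "\<exists>I. increasing_on I v \<and> n - m < card I")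
    case True
    then obtain V where V: "V \<subseteq> {u \<in> words m n. rev u < rev v}"
      "frag_of (word_face v) + (\<Sum>u\<in>V. frag_of (word_face u)) \<in> N"
      using straightening[OF mn less.prems] by blast
    have "span_words (frag_of (word_face u))" if u: "u \<in> V" for u
    proof (rule less.hyps)
      have uw: "u \<in> words m n" "rev u < rev v" using V(1) u by auto
      show "u \<in> words m n" by (rule uw(1))
      have "{x \<in> words m n. rev x < rev u} \<subset> {x \<in> words m n. rev x < rev v}"
        using uw by (auto intro: less_trans)
      then show "card {x \<in> words m n. rev x < rev u} < card {x \<in> words m n. rev x < rev v}"
        using finite_words[OF mn] by (intro psubset_card_mono) auto
    qed
    from span_words_combination[of V "\<lambda>u. frag_of (word_face u)" "\<lambda>_. -1", OF this]
    obtain f where "(\<Sum>u\<in>V. frag_cmul (-1) (frag_of (word_face u))) -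
        (\<Sum>p\<in>P. frag_cmul (f p) (frag_of (pair_face p))) \<in> N"
      unfolding span_words_def by blast
    from coboundaries_add[OF V(2) this] have
      "frag_of (word_face v) - (\<Sum>p\<in>P. frag_cmul (f p) (frag_of (pair_face p))) \<in> N"
      by (simp add: sum_negf)
    then show ?thesis unfolding span_words_def by blast
  next
    case False
    then have "\<And>I. increasing_on I v \<Longrightarrow> card I \<le> n - m" by (meson not_le)
    from rs_word_surject[OF m0 mn less.prems this] obtain S T where
      ST: "(S, T) \<in> P" "rs_word m n S T = v" by blast
    have "(\<Sum>p\<in>P. frag_cmul (if p = (S, T) then 1 else 0) (frag_of (pair_face p))) = frag_of (pair_face (S, T))"
      using ST(1) finite_P by (simp add: if_distrib[of "\<lambda>k. frag_cmul k _"] cong: if_cong)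
    also have "pair_face (S, T) = word_face v" by (simp add: pair_face_def pair_word_def ST(2))
    finally show ?thesis
      unfolding span_words_def by (intro exI[of _ "\<lambda>p. if p = (S, T) then 1 else 0"]) (simp add: coboundaries_0)
  qed
qed

lemma span_words_top:
  assumes "support c \<subseteq> Top"
  shows "span_words c"
proof -
  have "span_words (frag_of F)" if F: "F \<in> support c" for F
  proof -
    obtain v where "v \<in> words m n" "word_face v = F" using word_face_surject[OF mn] F assms by blast
    then show ?thesis using span_words_word by blast
  qed
  from span_words_combination[of "support c" frag_of "coeff c", OF this]
  show ?thesis using frag_expansion[of c] by (simp add: frag_extend_def)
qed

lemma pairing_coboundary_cycle:
  assumes "c \<in> N" "support z \<subseteq> Top" "boundary z = 0"
  shows "pairing c z = 0"
proof -
  obtain b where b: "c = coboundary K b" using assms(1) unfolding coboundaries_iff by blast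
  have "support z \<subseteq> K" using assms(2) by (auto simp: full_faces_def)
  from pairing_coboundary[OF finite_K this, of b] show ?thesis
    using assms(3) by (simp add: b pairing_def)
qed

text \<open>
  Cycles pair to zero with coboundaries, and modulo coboundaries every face is a combination of the words that
  come from pairs of tableaux.
\<close>

lemma cycle_eq_0:
  assumes "support z \<subseteq> Top" "boundary z = 0"
    and "\<And>p. p \<in> P \<Longrightarrow> coeff z (pair_face p) = 0"
  shows "z = 0"
proof (rule ccontr)
  assume "z \<noteq> 0"
  then obtain F where F: "F \<in> support z" by (metis all_not_in_conv keys_eq_empty)
  have "support (frag_of F) \<subseteq> Top" using F assms(1) by auto
  from span_words_top[OF this] obtain f where
    "frag_of F - (\<Sum>p\<in>P. frag_cmul (f p) (frag_of (pair_face p))) \<in> N"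
    unfolding span_words_def by blast
  from pairing_coboundary_cycle[OF this assms(1,2)]
  have "coeff z F = (\<Sum>p\<in>P. f p * coeff z (pair_face p))"
    by (simp add: pairing_diff pairing_sum pairing_cmul pairing_frag_of)
  also have "\<dots> = 0" using assms(3) by simp
  finally show False using F by (simp add: in_keys_iff)
qed

private definition "M p q = coeff (pair_eta p) (pair_face q)"

lemma unitriangular_M:
  shows "inj_on (\<lambda>p. rev (pair_word p)) P"
    and "p \<in> P \<Longrightarrow> \<bar>M p p\<bar> = 1"
    and "p \<in> P \<Longrightarrow> q \<in> P \<Longrightarrow> M p q \<noteq> 0 \<Longrightarrow> rev (pair_word p) \<le> rev (pair_word q)"
proof -
  show "inj_on (\<lambda>p. rev (pair_word p)) P" using pair_word_inject by (auto simp: inj_on_def)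
  show "\<bar>M p p\<bar> = 1" if "p \<in> P"
    using lookup_eta_diagonal[OF mn] that
    by (cases p) (simp add: M_def pair_eta_def pair_face_def pair_word_def)
  show "rev (pair_word p) \<le> rev (pair_word q)" if "p \<in> P" "q \<in> P" "M p q \<noteq> 0"
  proof -
    obtain S T where p: "p = (S, T)" by (cases p)
    have "pair_word q = rs_word m n S T \<or> rev (rs_word m n S T) < rev (pair_word q)"
      using that pair_word_in_words[OF that(2)]
      by (intro lookup_eta_triangular[OF mn]) (auto simp: p M_def pair_eta_def pair_face_def)
    then show ?thesis by (auto simp: p pair_word_def)
  qed
qed

lemma M_solve: "\<exists>f. \<forall>q\<in>P. (\<Sum>p\<in>P. f p * M p q) = v q"
  by (rule unitriangular_solve[OF finite_P unitriangular_M(1)]) (fact unitriangular_M)+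

lemma M_left_inject:
  assumes "\<And>q. q \<in> P \<Longrightarrow> (\<Sum>p\<in>P. f p * M p q) = 0" "p \<in> P"
  shows "f p = 0"
  by (rule unitriangular_left_inject[OF finite_P unitriangular_M(1) _ _ assms]) (fact unitriangular_M)+

lemma M_right_inject:
  assumes "\<And>p. p \<in> P \<Longrightarrow> (\<Sum>q\<in>P. M p q * f q) = 0" "p \<in> P"
  shows "f p = 0"
  by (rule unitriangular_right_inject[OF finite_P unitriangular_M(1) _ _ assms]) (fact unitriangular_M)+

text \<open>
  The unitriangular system yields an integer combination of the cycles with the same coefficients as a given
  cycle at the words of the pairs of tableaux; these coefficients determine the cycle.
\<close>

lemma homology_basis:
  "is_basis (homology_group (int m - 1) K) P (\<lambda>(S, T). eta_class m n S T)"
proof (rule is_basis_chain_epi[OF homology_epi(1) finite_P, where e = pair_eta])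
  show "pair_eta p \<in> {c. support c \<subseteq> Top \<and> boundary c = 0}" if "p \<in> P" for p
    using pair_eta_cycle[OF that] by simp
  show "(case p of (S, T) \<Rightarrow> eta_class m n S T) = homology_class (int m - 1) K (pair_eta p)" for p
    by (cases p) (simp add: pair_eta_def eta_class_def)
  have lk: "coeff (\<Sum>p\<in>P. frag_cmul (f p) (pair_eta p)) (pair_face q) = (\<Sum>p\<in>P. f p * M p q)" for f q
    by (simp add: lookup_sum M_def)
  have cyc: "support (\<Sum>p\<in>P. frag_cmul (f p) (pair_eta p)) \<subseteq> Top \<and>
      boundary (\<Sum>p\<in>P. frag_cmul (f p) (pair_eta p)) = 0" for f
  proof
    show "support (\<Sum>p\<in>P. frag_cmul (f p) (pair_eta p)) \<subseteq> Top"
      using pair_eta_cycle by (intro keys_sum_cmul_subset) blast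
    have "boundary (\<Sum>p\<in>J. frag_cmul (f p) (pair_eta p)) = 0" if "J \<subseteq> P" for J
      using that pair_eta_cycle
      by (induction J rule: infinite_finite_induct) (simp_all add: boundary_add boundary_cmul)
    then show "boundary (\<Sum>p\<in>P. frag_cmul (f p) (pair_eta p)) = 0" by simp
  qed
  {
    fix z :: chain assume "z \<in> {c. support c \<subseteq> Top \<and> boundary c = 0}"
    then have z: "support z \<subseteq> Top" "boundary z = 0" by auto
    obtain f where f: "\<forall>q\<in>P. (\<Sum>p\<in>P. f p * M p q) = coeff z (pair_face q)"
      using M_solve[of "\<lambda>q. coeff z (pair_face q)"] by (rule exE)
    define y where "y = z - (\<Sum>p\<in>P. frag_cmul (f p) (pair_eta p))"
    have y: "support y \<subseteq> Top" "boundary y = 0"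
      using chain_epi_closed(5)[OF chain_epi_cycles, of z "\<Sum>p\<in>P. frag_cmul (f p) (pair_eta p)"] z cyc[of f]
      by (auto simp: y_def)
    have "y = 0"
      using f by (intro cycle_eq_0[OF y]) (simp add: y_def lookup_minus lk)
    then have "homology_class (int m - 1) K y = \<one>\<^bsub>homology_group (int m - 1) K\<^esub>"
      using homology_epi(2)[OF y] by simp
    then show "\<exists>f. homology_class (int m - 1) K (z - (\<Sum>p\<in>P. frag_cmul (f p) (pair_eta p))) =
        \<one>\<^bsub>homology_group (int m - 1) K\<^esub>"
      unfolding y_def by blast
  }
  fix f p
  assume "homology_class (int m - 1) K (\<Sum>p\<in>P. frag_cmul (f p) (pair_eta p)) = \<one>\<^bsub>homology_group (int m - 1) K\<^esub>"
    and p: "p \<in> P"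
  then have "(\<Sum>p\<in>P. frag_cmul (f p) (pair_eta p)) = 0" using homology_epi(2) cyc[of f] by blast
  then have "(\<Sum>p\<in>P. f p * M p q) = 0" for q using lk[of f q] by simp
  from M_left_inject[of f, OF this p] show "f p = 0" .
qed

text \<open>
  The classes span even before torsion is divided out. If a multiple of a combination of them is a coboundary,
  it pairs to zero with all the cycles of the homology basis, and unitriangularity makes its coefficients
  vanish.
\<close>

lemma cohomology_basis:
  "is_basis (free_part (cohomology_group (int m - 1) K)) P
     (\<lambda>(S, T). free_part_class (cohomology_group (int m - 1) K) (gamma_class m n S T))"
proof -
  define s where "s p = inv_sign vless (word_simplex [1..<Suc n] (pair_word p))" for p
  define e where "e p = frag_cmul (s p) (frag_of (pair_face p))" for p
  have s1: "\<bar>s p\<bar> = 1" for p by (simp add: s_def abs_inv_sign)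
  have ss: "s p * s p = 1" for p using s1[of p] by (auto simp: abs_if split: if_splits)
  have e: "oriented_simplex (word_simplex [1..<Suc n] (pair_word p)) = e p" if "p \<in> P" for p
  proof -
    have "length (pair_word p) = n" by (rule words_length[OF mn pair_word_in_words[OF that]])
    from set_word_simplex_upt[OF this] show ?thesis
      by (simp only: oriented_simplex_def e_def s_def pair_face_def)
  qed
  have e_top: "support (\<Sum>p\<in>P. frag_cmul (f p) (e p)) \<subseteq> Top" for f
    using pair_face_top by (intro keys_sum_cmul_subset) (auto simp: e_def)
  show ?thesis
  proof (rule is_basis_chain_epi[OF free_part_epi(1) finite_P, where e = e])
    show "e p \<in> {c. support c \<subseteq> Top}" if "p \<in> P" for p
      using keys_cmul[of "s p" "frag_of (pair_face p)"] pair_face_top[OF that] by (auto simp: e_def)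
    show "(case p of (S, T) \<Rightarrow> free_part_class (cohomology_group (int m - 1) K) (gamma_class m n S T)) =
        free_part_class (cohomology_group (int m - 1) K) (cohomology_class (int m - 1) K (e p))" if "p \<in> P" for p
      using e[OF that] by (cases p) (simp add: gamma_class_def pair_word_def)
    {
      fix c :: chain assume "c \<in> {c. support c \<subseteq> Top}"
      then have c: "support c \<subseteq> Top" by simp
      from span_words_top[OF this] obtain f where
        f: "c - (\<Sum>p\<in>P. frag_cmul (f p) (frag_of (pair_face p))) \<in> N" unfolding span_words_def by blast
      have "(\<Sum>p\<in>P. frag_cmul (f p * s p) (e p)) = (\<Sum>p\<in>P. frag_cmul (f p) (frag_of (pair_face p)))"
        by (intro sum.cong) (simp_all add: e_def mult.assoc ss)
      then have inN: "c - (\<Sum>p\<in>P. frag_cmul (f p * s p) (e p)) \<in> N" using f by simp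
      have "free_part_class (cohomology_group (int m - 1) K)
          (cohomology_class (int m - 1) K (c - (\<Sum>p\<in>P. frag_cmul (f p * s p) (e p)))) =
          \<one>\<^bsub>free_part (cohomology_group (int m - 1) K)\<^esub>"
        unfolding free_part_epi(2)[OF coboundaries_top[OF inN]] using inN by (intro exI[of _ 1]) simp
      then show "\<exists>f. free_part_class (cohomology_group (int m - 1) K)
          (cohomology_class (int m - 1) K (c - (\<Sum>p\<in>P. frag_cmul (f p) (e p)))) =
          \<one>\<^bsub>free_part (cohomology_group (int m - 1) K)\<^esub>" by (intro exI[of _ "\<lambda>p. f p * s p"])
    }
    fix f p
    assume "free_part_class (cohomology_group (int m - 1) K)
        (cohomology_class (int m - 1) K (\<Sum>p\<in>P. frag_cmul (f p) (e p))) =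
        \<one>\<^bsub>free_part (cohomology_group (int m - 1) K)\<^esub>" and p: "p \<in> P"
    then obtain k :: nat where k: "0 < k" "frag_cmul (int k) (\<Sum>p\<in>P. frag_cmul (f p) (e p)) \<in> N"
      unfolding free_part_epi(2)[OF e_top] by blast
    have "(\<Sum>q\<in>P. M r q * (f q * s q)) = 0" if r: "r \<in> P" for r
    proof -
      have "pairing (frag_cmul (int k) (\<Sum>p\<in>P. frag_cmul (f p) (e p))) (pair_eta r) = 0"
        using pairing_coboundary_cycle[OF k(2)] pair_eta_cycle[OF r] by blast
      then have "int k * (\<Sum>q\<in>P. f q * (s q * M r q)) = 0"
        by (simp only: pairing_cmul pairing_sum e_def pairing_frag_of M_def)
      then have "(\<Sum>q\<in>P. f q * (s q * M r q)) = 0" using k(1) by simp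
      then show ?thesis by (simp only: mult_ac)
    qed
    from M_right_inject[of "\<lambda>q. f q * s q", OF this p] have "f p * s p = 0" .
    then show "f p = 0" using s1[of p] by auto
  qed
qed

end

theorem theorem6p3:
  fixes m n :: nat
  assumes "0 < m" and "m \<le> n"
  shows "is_basis (homology_group (int m - 1) (chessboard {1..m} {1..n}))
           (tableau_pairs m n) (\<lambda>(S, T). eta_class m n S T)
    \<and> is_basis (free_part (cohomology_group (int m - 1) (chessboard {1..m} {1..n})))
           (tableau_pairs m n)
           (\<lambda>(S, T). free_part_class (cohomology_group (int m - 1) (chessboard {1..m} {1..n}))
              (gamma_class m n S T))"
  using homology_basis[OF assms] cohomology_basis[OF assms] by blast

end
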